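(* Let $\delta_d$ (respectively $\delta^{\mathrm{lat}}_d$) denote the largest center density of a sphere packing (respectively lattice sphere packing) in $\mathbb{R}^d$. Then $$\delta^{\mathrm{lat}}_{38}\ge \frac{3^{31/2}}{2^{19}\cdot 5}=9.48\ldots,\qquad \delta^{\mathrm{lat}}_{39}\ge \frac{3^{16}}{2^{20}\cdot 5^{1/2}}=18.35\ldots,\qquad \delta^{\mathrm{lat}}_{40}\ge \frac{3^{16}}{2^{20}}=41.05\ldots,$$ $$\delta^{\mathrm{lat}}_{41}\ge \frac{3^{17}}{2^{21}}=61.57\ldots,\qquad \delta^{\mathrm{lat}}_{42}\ge \frac{3^{35/2}}{2^{21}}=106.65\ldots,\qquad \delta_{43}\ge \frac{137^{43/2}}{2^{223/2}\cdot 3^{21}}=226.51\ldots.$$ Moreover, there exist packings whose center densities are exactly the six displayed values, such that the packings in dimensions $38,39,40,41,42$ are lattice packings, namely bare cross-section packings of a $48$-dimensional unimodular lattice of minimum $6$, and the packing in dimension $43$ is centered at a union of six translates of a lattice.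
   Context: A sphere packing in $\mathbb{R}^d$ is a collection of congruent balls with disjoint interiors; its density $\Delta$ is the fraction of space covered, and its center density is $\delta=\Delta/V_d$, where $V_d$ is the volume of the unit ball of $\mathbb{R}^d$. (A packing by balls of radius $\rho$ centered at a union of $s$ disjoint translates of a rank-$d$ lattice $L$ has center density $s\rho^d/\sqrt{\det L}$, where $\det L$ is the determinant of a Gram matrix of $L$.) It is a lattice packing if the set of centers is a lattice. $\delta_d$ and $\delta^{\mathrm{lat}}_d$ are the suprema of center densities over all packings, respectively all lattice packings, in $\mathbb{R}^d$. A lattice is unimodular if it is integral (all inner products are integers) of determinant $1$; its minimum is the smallest squared norm of a nonzero vector. A cross-section of rank $k$ of a lattice $\Lambda\subset\mathbb{R}^{48}$ is a sublattice $K=\Lambda\cap U$ of rank $k$, where $U\subset\mathbb{R}^{48}$ is a $k$-dimensional subspace. For $\Lambda$ unimodular of rank $48$ and minimum $6$, the bare cross-section packing associated with $K$ is the packing in $V=U^{\perp}$ (dimension $48-k$) by balls of radius $\sqrt6/2$ centered at the points of $L=\Lambda\cap V$; its center density is $(3/2)^{(48-k)/2}/\sqrt{\det K}$. *)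

theory Defs
  imports "HOL-Analysis.Analysis"
begin

definition sphere_packing :: "'a::euclidean_space set \<Rightarrow> real \<Rightarrow> bool" where
  "sphere_packing C r \<longleftrightarrow> r > 0 \<and> disjoint_family_on (\<lambda>x. interior (cball x r)) C"

definition covered_fraction :: "'a::euclidean_space set \<Rightarrow> real \<Rightarrow> real \<Rightarrow> real" where
  "covered_fraction C r R =
     measure lborel ((\<Union>x\<in>C. cball x r) \<inter> cball 0 R) / measure lborel (cball (0::'a) R)"

text \<open>For an arbitrary packing, the fraction of space covered is the upper density, since the limit
  need not exist.\<close>

definition packing_density :: "'a::euclidean_space set \<Rightarrow> real \<Rightarrow> ereal" where
  "packing_density C r = Limsup at_top (\<lambda>R. ereal (covered_fraction C r R))"

definition center_density :: "'a::euclidean_space set \<Rightarrow> real \<Rightarrow> ereal" where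
  "center_density C r = packing_density C r / ereal (measure lborel (cball (0::'a) 1))"

text \<open>The stronger notion, requiring the limit to exist; used for explicitly given packings.\<close>

definition has_center_density :: "'a::euclidean_space set \<Rightarrow> real \<Rightarrow> real \<Rightarrow> bool" where
  "has_center_density C r \<delta> \<longleftrightarrow>
     ((\<lambda>R. covered_fraction C r R / measure lborel (cball (0::'a) 1)) \<longlongrightarrow> \<delta>) at_top"

lemma has_center_density_imp_center_density:
  fixes C :: "'a::euclidean_space set"
  assumes "has_center_density C r \<delta>"
  shows "center_density C r = ereal \<delta>"
proof -
  define V where "V = measure lborel (cball (0::'a) 1)"
  have V: "V > 0"
    unfolding V_def using content_cball_pos[of 1 "0::'a"] by simp
  have "((\<lambda>R. covered_fraction C r R / V * V) \<longlongrightarrow> \<delta> * V) at_top"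
    using assms unfolding has_center_density_def V_def by (intro tendsto_mult_right)
  then have "((\<lambda>R. ereal (covered_fraction C r R)) \<longlongrightarrow> ereal (\<delta> * V)) at_top"
    using V by simp
  then have "packing_density C r = ereal (\<delta> * V)"
    unfolding packing_density_def by (intro lim_imp_Limsup) simp_all
  then show ?thesis
    using V unfolding center_density_def V_def[symmetric] by simp
qed

definition int_span :: "'a::real_vector set \<Rightarrow> 'a set" where
  "int_span B = {(\<Sum>b\<in>B. of_int (c b) *\<^sub>R b) | c :: 'a \<Rightarrow> int. True}"

definition lattice_basis :: "'a::euclidean_space set \<Rightarrow> 'a set \<Rightarrow> bool" where
  "lattice_basis L B \<longleftrightarrow> independent B \<and> L = int_span B"

definition lattice_of_rank :: "nat \<Rightarrow> 'a::euclidean_space set \<Rightarrow> bool" where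
  "lattice_of_rank k L \<longleftrightarrow> (\<exists>B. lattice_basis L B \<and> card B = k)"

definition full_lattice :: "'a::euclidean_space set \<Rightarrow> bool" where
  "full_lattice L \<longleftrightarrow> lattice_of_rank DIM('a) L"

definition gram_matrix :: "('k \<Rightarrow> 'a::real_inner) \<Rightarrow> real ^ 'k ^ 'k" where
  "gram_matrix b = (\<chi> i j. b i \<bullet> b j)"

definition lattice_has_det :: "(real ^ 'n) set \<Rightarrow> real \<Rightarrow> bool" where
  "lattice_has_det L D \<longleftrightarrow>
     (\<exists>b :: 'n \<Rightarrow> real ^ 'n. inj b \<and> lattice_basis L (range b) \<and> det (gram_matrix b) = D)"

definition integral_lattice :: "'a::euclidean_space set \<Rightarrow> bool" where
  "integral_lattice L \<longleftrightarrow> (\<forall>x\<in>L. \<forall>y\<in>L. x \<bullet> y \<in> \<int>)"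

definition unimodular_lattice :: "(real ^ 'n) set \<Rightarrow> bool" where
  "unimodular_lattice L \<longleftrightarrow> full_lattice L \<and> integral_lattice L \<and> lattice_has_det L 1"

definition lattice_has_minimum :: "'a::euclidean_space set \<Rightarrow> real \<Rightarrow> bool" where
  "lattice_has_minimum L m \<longleftrightarrow>
     (\<exists>x\<in>L - {0}. (norm x)\<^sup>2 = m) \<and> (\<forall>x\<in>L - {0}. m \<le> (norm x)\<^sup>2)"

definition union_of_translates :: "nat \<Rightarrow> 'a::euclidean_space set \<Rightarrow> bool" where
  "union_of_translates s C \<longleftrightarrow>
     (\<exists>L T. full_lattice L \<and> finite T \<and> card T = s \<and>
        disjoint_family_on (\<lambda>t. (+) t ` L) T \<and> C = (\<Union>t\<in>T. (+) t ` L))"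

definition lattice_packing :: "'a::euclidean_space set \<Rightarrow> real \<Rightarrow> bool" where
  "lattice_packing C r \<longleftrightarrow> sphere_packing C r \<and> full_lattice C"

definition sup_center_density :: "'a::euclidean_space itself \<Rightarrow> ereal" where
  "sup_center_density _ = Sup {center_density C r | (C :: 'a set) r. sphere_packing C r}"

definition sup_lattice_center_density :: "'a::euclidean_space itself \<Rightarrow> ereal" where
  "sup_lattice_center_density _ = Sup {center_density C r | (C :: 'a set) r. lattice_packing C r}"

definition cuts_cross_section :: "'a::euclidean_space set \<Rightarrow> 'a set \<Rightarrow> bool" where
  "cuts_cross_section \<Lambda> U \<longleftrightarrow> subspace U \<and> lattice_of_rank (dim U) (\<Lambda> \<inter> U)"

text \<open>The centers of a bare cross-section packing lie in the orthogonal complement of U. To regard it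
  as a packing in 'd, that complement is identified with 'd by a linear isometry f, which forces the
  dimension of 'd to be 48 - dim U. Center density does not depend on the choice of f.\<close>

definition bare_cross_section_packing ::
    "(real ^ 48) set \<Rightarrow> 'd::euclidean_space set \<Rightarrow> real \<Rightarrow> bool" where
  "bare_cross_section_packing \<Lambda> C r \<longleftrightarrow>
     (\<exists>U (f :: 'd \<Rightarrow> real ^ 48).
        cuts_cross_section \<Lambda> U \<and>
        linear f \<and> (\<forall>x. norm (f x) = norm x) \<and> range f = orthogonal_comp U \<and>
        f ` C = \<Lambda> \<inter> orthogonal_comp U \<and> r = sqrt 6 / 2)"

end

theory Submission
  imports Defs "Jordan_Normal_Form.Determinant"
begin

text \<open>The 48-dimensional lattice \<open>\<Lambda>\<close> comes from the ternary Pless symmetry code of length 48: \<open>\<surd>12 \<Lambda>\<close>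
  consists of the integral vectors whose coordinates have the same parity, reduce mod 3 to a
  codeword, and have a sum congruent mod 4 to twice the first coordinate. This lattice is even, and
  its minimum is 6 because the code has minimum weight 15 and its 96 words of weight 48 have the wrong coordinate sum mod 4
  for an odd vector of norm 4.

  Let \<open>K\<close> be a sublattice with basis \<open>b\<^sub>i\<close> such that \<open>b\<^sub>i \<bullet> t\<^sub>j = \<delta>\<^sub>i\<^sub>j\<close> for suitable lattice vectors \<open>t\<^sub>j\<close>. Then \<open>K\<close> is a
  cross-section, and as \<open>\<Lambda>\<close> is self-dual, the lattice \<open>L = K\<^sup>\<bottom> \<inter> \<Lambda>\<close> has the determinant of \<open>K\<close>. A chain of such \<open>K\<close>
  of ranks 6 to 10 and determinants \<open>3\<^sup>7\<close>, \<open>2 3\<^sup>7\<close>, \<open>3\<^sup>8\<close>, \<open>10 3\<^sup>7\<close>, \<open>25 3\<^sup>7\<close> yields the five lattice packings.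
  In dimension 43, the rank of \<open>K\<close> is 5 and its determinant is 3072. The projections of \<open>0, t\<^sub>1, \<dots>, t\<^sub>5\<close> to
  the span of \<open>K\<close> have mutual squared distances at most \<open>14/48\<close>, so their projections to \<open>K\<^sup>\<bottom>\<close> translate \<open>L\<close> to
  six sets with mutual squared distances at least \<open>6 - 14/48 = 137/24\<close>.\<close>

hide_const (open) Determinant.det Matrix.mat Matrix.vec Matrix.dim_vec Polynomial.content Matrix.row Matrix.col Matrix.rows Matrix.cols
hide_const (open) Matrix.orthogonal
hide_type (open) Matrix.vec
no_notation Matrix.vec_index (infixl "$" 100)
no_notation Matrix.scalar_prod (infix "\<bullet>" 70)

section \<open>Center density of periodic packings\<close>

text \<open>Direct enumeration is out of reach: the code has \<open>3 ^ 24\<close> words and the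
  lattice has rank 48. Two facts about the code are needed, and each shrinks to a small computation.
  For the minimum weight, \<open>S\<close> squares to -23, which is 1 mod 3, so either half of a
  codeword determines the other; a word of weight at most 12 can then be taken to come from at most
  6 rows, and affine maps of the field move two of these, if finite, to fixed places. Weights are
  multiples of 3, so excluding 12 and less gives 15. For full weight, orthogonality to the code mod
  3 forces membership in it, which makes any 12 coordinates of a random codeword independent and
  fixes enough moments of the weight distribution to count these words; an explicit list of the
  right length is then complete. Likewise no determinant of order 48 is evaluated: self-duality is
  tested against a few families of vectors and forces determinant 1. In dimension 43 radius is
  traded for number: six translates with the radius shrunk by the factor sqrt(137/144) multiply the
  density of the bare section by 6 (137/144)^(43/2), slightly more than 2.\<close>

lemma fract_lattice_decomp:
  fixes A :: "real^'n^'n" and y :: "real^'n"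
  assumes "invertible A"
  shows "\<exists>!z. (\<forall>i. z $ i \<in> \<int>) \<and> y - A *v z \<in> (*v) A ` {q. \<forall>i. 0 \<le> q $ i \<and> q $ i < 1}"
proof -
  obtain A' where A': "A ** A' = mat 1" "A' ** A = mat 1"
    using assms unfolding invertible_def by blast
  define w where "w = A' *v y"
  have yw: "y = A *v w" by (simp add: w_def matrix_vector_mul_assoc A')
  have inj: "A *v u = A *v v \<Longrightarrow> u = v" for u v
    by (metis A'(2) matrix_vector_mul_assoc matrix_vector_mul_lid)
  \<comment> \<open>Floors of the coordinates of \<open>y\<close> with respect to the columns of
    \<open>A\<close>; the half-open cube makes this choice the only possible one.\<close>
  define z :: "real^'n" where "z = (\<chi> i. of_int \<lfloor>w $ i\<rfloor>)"
  show ?thesis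
  proof (rule ex1I[of _ z])
    show "(\<forall>i. z $ i \<in> \<int>) \<and> y - A *v z \<in> (*v) A ` {q. \<forall>i. 0 \<le> q $ i \<and> q $ i < 1}"
    proof
      have "y - A *v z = A *v (w - z)" by (simp add: yw matrix_vector_mult_diff_distrib)
      moreover have "w - z \<in> {q. \<forall>i. 0 \<le> q $ i \<and> q $ i < 1}"
        by (auto simp: z_def) linarith
      ultimately show "y - A *v z \<in> (*v) A ` {q. \<forall>i. 0 \<le> q $ i \<and> q $ i < 1}" by blast
    qed (simp add: z_def)
  next
    fix u assume u: "(\<forall>i. u $ i \<in> \<int>) \<and> y - A *v u \<in> (*v) A ` {q. \<forall>i. 0 \<le> q $ i \<and> q $ i < 1}"
    then obtain q where q: "y - A *v u = A *v q" "\<forall>i. 0 \<le> q $ i \<and> q $ i < 1" by blast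
    have "A *v (w - u) = A *v q" using q yw by (simp add: matrix_vector_mult_diff_distrib)
    then have "w - u = q" by (rule inj)
    then have *: "w $ i - u $ i = q $ i" for i by (metis vector_minus_component)
    show "u = z"
    proof (simp add: z_def Finite_Cartesian_Product.vec_eq_iff, intro allI)
      fix i
      obtain k where k: "u $ i = of_int k" using u Ints_cases by blast
      have "\<lfloor>w $ i\<rfloor> = k" using *[of i] q(2) k by (intro floor_unique) (auto simp: algebra_simps dest: spec[of _ i])
      then show "u $ i = of_int \<lfloor>w $ i\<rfloor>" using k by simp
    qed
  qed
qed

lemma measure_unit_halfopen_cube:
  fixes Q :: "(real^'n) set"
  defines "Q \<equiv> {q. \<forall>i. 0 \<le> q $ i \<and> q $ i < 1}"
  shows "Q \<in> lmeasurable" "measure lebesgue Q = 1"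
proof -
  have b: "box 0 1 \<subseteq> Q" "Q \<subseteq> cbox 0 (1::real^'n)"
    unfolding Q_def by (auto simp: mem_box_cart less_imp_le)
  have "Q = (\<Inter>i. {q. 0 \<le> q $ i} \<inter> {q. q $ i < 1})" by (auto simp: Q_def)
  also have "\<dots> \<in> sets borel"
    by (intro sets.finite_INT sets.Int) (auto intro!: borel_closed borel_open closed_Collect_le open_Collect_less continuous_intros)
  finally have s: "Q \<in> sets lebesgue" by (simp add: sets_completionI_sets)
  show m: "Q \<in> lmeasurable"
    using s b(2) by (meson fmeasurableI2 lmeasurable_cbox)
  have "measure lebesgue (box 0 (1::real^'n)) \<le> measure lebesgue Q"
    using b m by (intro measure_mono_fmeasurable) auto
  moreover have "measure lebesgue Q \<le> measure lebesgue (cbox 0 (1::real^'n))"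
    using b m by (intro measure_mono_fmeasurable) (auto simp: fmeasurableD)
  moreover have "(\<Prod>b\<in>Basis. (1::real^'n) \<bullet> b) = 1"
    by (rule prod.neutral) (auto simp: Basis_vec_def inner_axis)
  then have "measure lebesgue (cbox 0 (1::real^'n)) = 1" "measure lebesgue (box 0 (1::real^'n)) = 1"
    by (simp_all add: measure_lborel_cbox_eq measure_lborel_box_eq Basis_vec_def inner_axis)
  ultimately show "measure lebesgue Q = 1" by linarith
qed

lemma lattice_has_det_parametrization:
  fixes L :: "(real^'n) set"
  assumes "lattice_has_det L D"
  obtains A :: "real^'n^'n" where "invertible A" "D = (det A)\<^sup>2"
    "L = (*v) A ` {z. \<forall>i. z $ i \<in> \<int>}"
proof -
  obtain b :: "'n \<Rightarrow> real^'n" where b: "inj b" "lattice_basis L (range b)" "det (gram_matrix b) = D"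
    using assms unfolding lattice_has_det_def by blast
  define A :: "real^'n^'n" where "A = (\<chi> i j. b j $ i)"
  have Av: "A *v z = (\<Sum>j\<in>UNIV. z $ j *\<^sub>R b j)" for z
    by (simp add: A_def matrix_vector_mult_def Finite_Cartesian_Product.vec_eq_iff mult.commute)
  have "gram_matrix b = transpose A ** A"
    by (simp add: gram_matrix_def A_def transpose_def matrix_matrix_mult_def inner_vec_def Finite_Cartesian_Product.vec_eq_iff)
  then have D: "D = (det A)\<^sup>2" using b(3) by (simp add: det_mul power2_eq_square)
  have "inj ((*v) A)"
  proof (rule injI)
    fix u v assume "A *v u = A *v v"
    then have "(\<Sum>j\<in>UNIV. (u $ j - v $ j) *\<^sub>R b j) = 0"
      by (simp add: Av scaleR_diff_left sum_subtractf)
    then have "(\<Sum>x\<in>range b. (u $ (inv_into UNIV b x) - v $ (inv_into UNIV b x)) *\<^sub>R x) = 0"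
      by (simp add: sum.reindex[OF b(1)] b(1))
    moreover have "independent (range b)" using b(2) by (simp add: lattice_basis_def)
    ultimately have "\<forall>x\<in>range b. u $ (inv_into UNIV b x) - v $ (inv_into UNIV b x) = 0"
      unfolding independent_explicit_finite_subsets by (drule_tac spec[of _ "range b"]) auto
    then show "u = v" using b(1) by (simp add: Finite_Cartesian_Product.vec_eq_iff)
  qed
  then have inv: "invertible A" by (metis invertible_left_inverse matrix_left_invertible_injective)
  have "L = (*v) A ` {z. \<forall>i. z $ i \<in> \<int>}"
  proof -
    have L: "L = int_span (range b)" using b(2) by (simp add: lattice_basis_def)
    have "int_span (range b) \<subseteq> (*v) A ` {z. \<forall>i. z $ i \<in> \<int>}"
    proof
      fix x assume "x \<in> int_span (range b)"
      then obtain c where "x = (\<Sum>y\<in>range b. of_int (c y) *\<^sub>R y)" unfolding int_span_def by blast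
      then have "x = A *v (\<chi> i. of_int (c (b i)))" by (simp add: Av sum.reindex[OF b(1)])
      then show "x \<in> (*v) A ` {z. \<forall>i. z $ i \<in> \<int>}" by (intro image_eqI[where x="\<chi> i. of_int (c (b i))"]) auto
    qed
    moreover have "(*v) A ` {z. \<forall>i. z $ i \<in> \<int>} \<subseteq> int_span (range b)"
    proof clarify
      fix z :: "real^'n" assume "\<forall>i. z $ i \<in> \<int>"
      then have "\<forall>i. \<exists>k. z $ i = of_int k" by (meson Ints_cases)
      then obtain k where k: "\<And>i. z $ i = of_int (k i)" by metis
      have "A *v z = (\<Sum>y\<in>range b. of_int (k (inv_into UNIV b y)) *\<^sub>R y)"
        by (simp add: Av sum.reindex[OF b(1)] b(1) k)
      then show "A *v z \<in> int_span (range b)"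
        unfolding int_span_def by (intro CollectI exI[of _ "\<lambda>y. k (inv_into UNIV b y)"] conjI TrueI)
    qed
    ultimately show ?thesis using L by blast
  qed
  with D inv show ?thesis using that by blast
qed

text \<open>Attach to each point of \<open>t + L\<close> in the ball of radius \<open>R\<close> a
  copy of the fundamental parallelepiped, of volume \<open>sqrt D\<close>. The copies are disjoint,
  lie in the ball of radius \<open>R + a\<close> and cover the ball of radius \<open>R - a\<close>,
  where \<open>a\<close> bounds the norms in the parallelepiped. As \<open>a\<close> does not depend
  on \<open>t\<close>, the bounds can be added up over translates.\<close>

lemma lattice_point_count:
  fixes L :: "((real,'n::{finite,wellorder}) vec) set"
  assumes "lattice_has_det L D"
  obtains a where "a > 0" "D > 0"
    "\<And>t R. finite {x\<in>L. norm (t + x) \<le> R}"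
    "\<And>t R. real (card {x\<in>L. norm (t + x) \<le> R}) * sqrt D \<le> measure lborel (cball (0::(real,'n::{finite,wellorder}) vec) (R + a))"
    "\<And>t R. measure lborel (cball (0::(real,'n::{finite,wellorder}) vec) (R - a)) \<le> real (card {x\<in>L. norm (t + x) \<le> R}) * sqrt D"
proof -
  obtain A :: "((real,'n) vec,'n) vec" where A: "invertible A" "D = (det A)\<^sup>2"
    and L: "L = (*v) A ` {z. \<forall>i. z $ i \<in> \<int>}"
    using lattice_has_det_parametrization[OF assms] by blast
  have d0: "det A \<noteq> 0" using A(1) invertible_det_nz by blast
  then have Dpos: "D > 0" using A(2) by simp
  have sq: "sqrt D = \<bar>det A\<bar>" by (simp add: A(2))
  define Q :: "((real,'n) vec) set" where "Q = {q. \<forall>i. 0 \<le> q $ i \<and> q $ i < 1}"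
  define P where "P = (*v) A ` Q"
  have Pm: "P \<in> lmeasurable" "measure lebesgue P = sqrt D"
    using measurable_linear_image[of "(*v) A" Q] measure_linear_image[of "(*v) A" Q]
      measure_unit_halfopen_cube[where 'n='n] unfolding P_def Q_def by (auto simp: sq)
  have "bounded Q"
    by (rule bounded_subset[of "cbox 0 1"]) (auto simp: Q_def mem_box_cart less_imp_le)
  then have "bounded P" unfolding P_def by (intro bounded_linear_image) auto
  then obtain a where a: "a > 0" "\<And>p. p \<in> P \<Longrightarrow> norm p \<le> a" using bounded_pos by blast
  have ex1: "\<exists>!x. x \<in> L \<and> y - x \<in> P" for y
    using fract_lattice_decomp[OF A(1), of y] unfolding L P_def Q_def by (smt (verit) image_iff mem_Collect_eq)
  have disj: "pairwise (\<lambda>x x'. disjnt ((+) (t + x) ` P) ((+) (t + x') ` P)) L" for t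
  proof (rule pairwiseI)
    fix x x' assume xx: "x \<in> L" "x' \<in> L" "x \<noteq> x'"
    show "disjnt ((+) (t + x) ` P) ((+) (t + x') ` P)"
    proof (rule ccontr)
      assume "\<not> disjnt ((+) (t + x) ` P) ((+) (t + x') ` P)"
      then obtain p p' where p: "p \<in> P" "p' \<in> P" "t + x + p = t + x' + p'" by (auto simp: disjnt_iff)
      then have "(x + p) - x' = p'" by (simp add: add.assoc)
      moreover have "(x + p) - x = p" by (rule add_diff_cancel_left')
      ultimately have "(x + p) - x' \<in> P" "(x + p) - x \<in> P" using p(1,2) by (simp_all only:)
      then show False using ex1[of "x + p"] xx by blast
    qed
  qed
  have meas: "measure lebesgue (\<Union>x\<in>F. (+) (t + x) ` P) = real (card F) * sqrt D"
    if "finite F" "F \<subseteq> L" for F t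
  proof -
    have "measure lebesgue (\<Union>x\<in>F. (+) (t + x) ` P) = (\<Sum>x\<in>F. measure lebesgue ((+) (t + x) ` P))"
      using that disj[of t] Pm(1) by (intro measure_UNION') (auto intro: measurable_translation pairwise_subset)
    then show ?thesis by (simp add: measure_translation Pm)
  qed
  have Um: "(\<Union>x\<in>F. (+) (t + x) ` P) \<in> lmeasurable" if "finite F" for F t
    using that Pm(1) by (intro fmeasurable.finite_UN) (auto intro: measurable_translation)
  have up: "real (card F) * sqrt D \<le> measure lborel (cball (0::(real,'n) vec) (R + a))"
    if F: "finite F" "F \<subseteq> {x\<in>L. norm (t + x) \<le> R}" for F t R
  proof -
    have "(\<Union>x\<in>F. (+) (t + x) ` P) \<subseteq> cball 0 (R + a)"
    proof clarsimp
      fix x p assume "x \<in> F" "p \<in> P"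
      then have "norm (t + x) \<le> R" "norm p \<le> a" using F a by auto
      then show "norm (t + x + p) \<le> R + a" using norm_triangle_mono by blast
    qed
    then have "measure lebesgue (\<Union>x\<in>F. (+) (t + x) ` P) \<le> measure lebesgue (cball (0::(real,'n) vec) (R + a))"
      using Um[OF F(1)] by (intro measure_mono_fmeasurable) (auto simp: fmeasurableD)
    moreover have "F \<subseteq> L" using F(2) by blast
    ultimately show ?thesis using meas[OF F(1), of t] by simp
  qed
  have fin: "finite {x\<in>L. norm (t + x) \<le> R}" for t R
  proof -
    \<comment> \<open>The volume bound holds for every finite set of such points, so it caps their
      number before finiteness is known.\<close>
    define C where "C = nat \<lceil>measure lborel (cball (0::(real,'n) vec) (R + a)) / sqrt D\<rceil>"
    have "card F \<le> C" if "F \<subseteq> {x\<in>L. norm (t + x) \<le> R}" "finite F" for F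
    proof -
      have "real (card F) \<le> measure lborel (cball (0::(real,'n) vec) (R + a)) / sqrt D"
        using up[OF that(2,1)] Dpos by (simp add: field_simps)
      then show ?thesis unfolding C_def by linarith
    qed
    then show ?thesis using finite_if_finite_subsets_card_bdd by blast
  qed
  show ?thesis
  proof (rule that[OF a(1) Dpos fin])
    show "real (card {x\<in>L. norm (t + x) \<le> R}) * sqrt D \<le> measure lborel (cball (0::(real,'n) vec) (R + a))" for t R
      using up[OF fin[of t R]] by blast
    show "measure lborel (cball (0::(real,'n) vec) (R - a)) \<le> real (card {x\<in>L. norm (t + x) \<le> R}) * sqrt D" for t R
    proof -
      let ?F = "{x\<in>L. norm (t + x) \<le> R}"
      have "cball 0 (R - a) \<subseteq> (\<Union>x\<in>?F. (+) (t + x) ` P)"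
      proof
        fix y :: "(real,'n) vec" assume y: "y \<in> cball 0 (R - a)"
        obtain x where x: "x \<in> L" "(y - t) - x \<in> P" using ex1[of "y - t"] by blast
        have "norm (t + x) = norm (y - ((y - t) - x))" by (simp add: algebra_simps)
        also have "\<dots> \<le> norm y + norm ((y - t) - x)" by (rule norm_triangle_ineq4)
        also have "\<dots> \<le> R" using y a(2)[OF x(2)] by simp
        finally have "x \<in> ?F" using x by simp
        moreover have "y \<in> (+) (t + x) ` P" using x(2) by (intro image_eqI[where x="(y - t) - x"]) auto
        ultimately show "y \<in> (\<Union>x\<in>?F. (+) (t + x) ` P)" by blast
      qed
      then have "measure lebesgue (cball (0::(real,'n) vec) (R - a)) \<le> measure lebesgue (\<Union>x\<in>?F. (+) (t + x) ` P)"
        by (rule measure_mono_fmeasurable[OF _ _ Um[OF fin[of t R], of t]]) simp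
      moreover have "?F \<subseteq> L" by blast
      ultimately show ?thesis using meas[OF fin[of t R], of t] by simp
    qed
  qed
qed

lemma measure_lborel_cball_scale:
  "r \<ge> 0 \<Longrightarrow> measure lborel (cball (c::'a::euclidean_space) r) = measure lborel (cball (0::'a) 1) * r ^ DIM('a)"
  using content_ball_conv_unit_ball[of r c] by (simp add: content_cball_conv_ball mult.commute)

lemma fmeasurable_lborel_cball: "cball (c::'a::euclidean_space) r \<in> fmeasurable lborel"
  and fmeasurable_lborel_ball: "ball (c::'a::euclidean_space) r \<in> fmeasurable lborel"
  using emeasure_lborel_cball_finite[of c r] emeasure_lborel_ball_finite[of c r]
  by (auto simp: fmeasurable_def)

lemma covered_measure_bounds:
  fixes C :: "'a::euclidean_space set"
  assumes pack: "sphere_packing C r" and fin: "\<And>R. finite {x\<in>C. norm x \<le> R}"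
  defines "V \<equiv> measure lborel (cball (0::'a) 1)"
  defines "X \<equiv> \<lambda>R. (\<Union>x\<in>C. cball x r) \<inter> cball 0 R"
  shows "measure lborel (X R) \<le> real (card {x\<in>C. norm x \<le> R + r}) * (V * r ^ DIM('a))"
    "real (card {x\<in>C. norm x \<le> R - r}) * (V * r ^ DIM('a)) \<le> measure lborel (X R)"
proof -
  have r: "r > 0" and disj: "disjoint_family_on (\<lambda>x. ball x r) C"
    using pack by (auto simp: sphere_packing_def interior_cball)
  let ?U = "{x\<in>C. norm x \<le> R + r}" and ?L = "{x\<in>C. norm x \<le> R - r}"
  have X: "X R = (\<Union>x\<in>?U. cball x r) \<inter> cball 0 R"
  proof -
    have "norm x \<le> R + r" if "y \<in> cball x r" "y \<in> cball 0 R" for x y :: 'a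
      using that norm_triangle_ineq[of y "x - y"] by (simp add: dist_norm)
    then show ?thesis unfolding X_def by blast
  qed
  have Xb: "X R \<in> sets borel" unfolding X using fin by (intro sets.Int sets.finite_UN) auto
  have "measure lborel (X R) \<le> measure lborel (\<Union>x\<in>?U. cball x r)"
    using fin[of "R + r"] Xb by (intro measure_mono_fmeasurable) (auto simp: X intro!: fmeasurable.finite_UN fmeasurable_lborel_cball)
  also have "\<dots> \<le> (\<Sum>x\<in>?U. measure lborel (cball x r))"
    using fin by (intro measure_UNION_le) auto
  also have "\<dots> = real (card ?U) * (V * r ^ DIM('a))"
    using r by (simp add: measure_lborel_cball_scale[of r] V_def)
  finally show "measure lborel (X R) \<le> real (card ?U) * (V * r ^ DIM('a))" .
  \<comment> \<open>Open balls here: the closed balls of a packing may touch, and only the open ones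
    are literally disjoint.\<close>
  have "real (card ?L) * (V * r ^ DIM('a)) = (\<Sum>x\<in>?L. measure lborel (ball x r))"
    using r by (simp add: content_cball_conv_ball[symmetric] measure_lborel_cball_scale[of r] V_def)
  also have "\<dots> = measure lborel (\<Union>x\<in>?L. ball x r)"
    using fin[of "R - r"] disj
    by (intro measure_UNION'[symmetric]) (auto simp: disjoint_family_on_def pairwise_def disjnt_def fmeasurable_lborel_ball)
  also have "\<dots> \<le> measure lborel (X R)"
  proof (rule measure_mono_fmeasurable)
    have "norm y \<le> R" if "y \<in> ball x r" "norm x \<le> R - r" for x y :: 'a
      using that norm_triangle_ineq[of x "y - x"] by (simp add: dist_norm norm_minus_commute)
    then show "(\<Union>x\<in>?L. ball x r) \<subseteq> X R" unfolding X_def using ball_subset_cball by auto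
    show "X R \<in> fmeasurable lborel"
      by (rule fmeasurableI2[of "cball 0 R"]) (use Xb in \<open>auto simp: X fmeasurable_lborel_cball\<close>)
  qed (use fin in auto)
  finally show "real (card ?L) * (V * r ^ DIM('a)) \<le> measure lborel (X R)" .
qed

text \<open>Counting centers with the radius moved by \<open>r\<close> for balls cut by the boundary
  and by \<open>a\<close> for boundary cells squeezes the covered fraction between two values whose
  ratios to the limit are \<open>((R - (r + a)) / R) ^ n\<close> and
  \<open>((R + (r + a)) / R) ^ n\<close>. Both tend to 1.\<close>

lemma periodic_packing_center_density:
  fixes L :: "((real,'n::{finite,wellorder}) vec) set"
  assumes L: "lattice_has_det L D"
    and T: "finite T" "disjoint_family_on (\<lambda>t. (+) t ` L) T"
    and C: "C = (\<Union>t\<in>T. (+) t ` L)"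
    and pack: "sphere_packing C r"
  shows "has_center_density C r (real (card T) * r ^ CARD('n) / sqrt D)"
proof -
  obtain a where a: "a > 0" "D > 0"
    and fin: "\<And>t R. finite {x\<in>L. norm (t + x) \<le> R}"
    and up: "\<And>t R. real (card {x\<in>L. norm (t + x) \<le> R}) * sqrt D \<le> measure lborel (cball (0::(real,'n) vec) (R + a))"
    and lo: "\<And>t R. measure lborel (cball (0::(real,'n) vec) (R - a)) \<le> real (card {x\<in>L. norm (t + x) \<le> R}) * sqrt D"
    using lattice_point_count[OF L] by blast
  define V where "V = measure lborel (cball (0::(real,'n) vec) 1)"
  define n where "n = CARD('n)"
  have V: "V > 0" unfolding V_def using content_cball_pos[of 1 "0::(real,'n) vec"] by simp
  have r: "r > 0" using pack by (simp add: sphere_packing_def)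
  define s where "s = real (card T)"
  have Ceq: "{x\<in>C. norm x \<le> R} = (\<Union>t\<in>T. (+) t ` {x\<in>L. norm (t + x) \<le> R})" for R
    unfolding C by auto
  have finC: "finite {x\<in>C. norm x \<le> R}" for R unfolding Ceq using T(1) fin by blast
  have cardC: "real (card {x\<in>C. norm x \<le> R}) = (\<Sum>t\<in>T. real (card {x\<in>L. norm (t + x) \<le> R}))" for R
  proof -
    have "card {x\<in>C. norm x \<le> R} = (\<Sum>t\<in>T. card ((+) t ` {x\<in>L. norm (t + x) \<le> R}))"
      unfolding Ceq using T fin by (intro card_UN_disjoint) (auto simp: disjoint_family_on_def)
    then show ?thesis by (simp add: card_image)
  qed
  have cu: "real (card {x\<in>C. norm x \<le> R}) * sqrt D \<le> s * (V * (R + a) ^ n)" if "R + a \<ge> 0" for R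
  proof -
    have "real (card {x\<in>C. norm x \<le> R}) * sqrt D \<le> (\<Sum>t\<in>T. measure lborel (cball (0::(real,'n) vec) (R + a)))"
      unfolding cardC sum_distrib_right by (intro sum_mono up)
    then show ?thesis using that by (simp add: s_def V_def n_def measure_lborel_cball_scale[of "R + a"])
  qed
  have cl: "s * (V * (R - a) ^ n) \<le> real (card {x\<in>C. norm x \<le> R}) * sqrt D" if "R - a \<ge> 0" for R
  proof -
    have "(\<Sum>t\<in>T. measure lborel (cball (0::(real,'n) vec) (R - a))) \<le> real (card {x\<in>C. norm x \<le> R}) * sqrt D"
      unfolding cardC sum_distrib_right by (intro sum_mono lo)
    then show ?thesis using that by (simp add: s_def V_def n_def measure_lborel_cball_scale[of "R - a"])
  qed
  define \<delta> where "\<delta> = s * r ^ n / sqrt D"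
  define f where "f = (\<lambda>R. covered_fraction C r R / V)"
  have fR: "f R = measure lborel ((\<Union>x\<in>C. cball x r) \<inter> cball 0 R) / (V * V * R ^ n)" if "R > 0" for R
    using that by (simp add: f_def covered_fraction_def measure_lborel_cball_scale[of R] V_def n_def)
  have sD: "sqrt D > 0" using a by simp
  have "f R \<le> \<delta> * ((R + (r + a)) / R) ^ n" if R: "R > r + a" for R
  proof -
    have R0: "R > 0" using R r a by simp
    have "measure lborel ((\<Union>x\<in>C. cball x r) \<inter> cball 0 R) \<le> real (card {x\<in>C. norm x \<le> R + r}) * (V * r ^ n)"
      using covered_measure_bounds(1)[OF pack finC, of R] by (simp add: V_def n_def)
    also have "\<dots> \<le> (s * (V * (R + r + a) ^ n) / sqrt D) * (V * r ^ n)"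
      using cu[of "R + r"] sD R0 r a V by (intro mult_right_mono) (auto simp: field_simps)
    finally have "f R \<le> (s * (V * (R + r + a) ^ n) / sqrt D) * (V * r ^ n) / (V * V * R ^ n)"
      unfolding fR[OF R0] using V R0 by (intro divide_right_mono) auto
    also have "\<dots> = \<delta> * ((R + (r + a)) / R) ^ n"
      using V R0 sD by (simp add: \<delta>_def power_divide add.assoc)
    finally show ?thesis .
  qed
  moreover have "\<delta> * ((R - (r + a)) / R) ^ n \<le> f R" if R: "R > r + a" for R
  proof -
    have R0: "R > 0" using R r a by simp
    have "\<delta> * ((R - (r + a)) / R) ^ n = (s * (V * (R - r - a) ^ n) / sqrt D) * (V * r ^ n) / (V * V * R ^ n)"
      using V R0 sD by (simp add: \<delta>_def power_divide diff_diff_eq)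
    also have "\<dots> \<le> real (card {x\<in>C. norm x \<le> R - r}) * (V * r ^ n) / (V * V * R ^ n)"
      using cl[of "R - r"] sD R R0 r a V by (intro divide_right_mono mult_right_mono) (auto simp: field_simps)
    also have "\<dots> \<le> measure lborel ((\<Union>x\<in>C. cball x r) \<inter> cball 0 R) / (V * V * R ^ n)"
      using covered_measure_bounds(2)[OF pack finC, of R] V R0 by (intro divide_right_mono) (auto simp: V_def n_def)
    finally show ?thesis unfolding fR[OF R0] .
  qed
  ultimately have ev: "\<forall>\<^sub>F R in at_top. f R \<le> \<delta> * ((R + (r + a)) / R) ^ n"
      "\<forall>\<^sub>F R in at_top. \<delta> * ((R - (r + a)) / R) ^ n \<le> f R"
    by (auto intro: eventually_mono[OF eventually_gt_at_top[of "r + a"]])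
  have lim: "((\<lambda>R. (R + c) / R) \<longlongrightarrow> 1) at_top" for c :: real
  proof -
    have "((\<lambda>R. 1 + c / R) \<longlongrightarrow> 1 + 0) at_top"
      by (intro tendsto_intros tendsto_divide_0[OF tendsto_const] filterlim_at_top_imp_at_infinity filterlim_ident)
    moreover have "\<forall>\<^sub>F R in at_top. 1 + c / R = (R + c) / R"
      by (rule eventually_mono[OF eventually_gt_at_top[of 0]]) (simp add: field_simps)
    ultimately show ?thesis by (auto elim: Lim_transform_eventually)
  qed
  have "((\<lambda>R. \<delta> * ((R + c) / R) ^ n) \<longlongrightarrow> \<delta> * 1 ^ n) at_top" for c :: real
    by (intro tendsto_intros lim)
  from this[of "r + a"] this[of "- (r + a)"] have "(f \<longlongrightarrow> \<delta>) at_top"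
    using tendsto_sandwich[OF ev(2) ev(1), of \<delta>] by (simp add: algebra_simps)
  then show ?thesis unfolding has_center_density_def f_def V_def \<delta>_def s_def n_def .
qed

section \<open>Cross-sections of self-dual lattices\<close>

lemma lattice_has_det_pos: "lattice_has_det (L :: (real^'n) set) D \<Longrightarrow> D > 0"
  by (metis invertible_det_nz lattice_has_det_parametrization zero_less_power2)

text \<open>Integer-valued functionals that separate the points of a subgroup replace discreteness.
  By induction on their number, the kernel \<open>G'\<close> of the last one has a basis; the values
  of that functional are the multiples of the least positive one, and a vector \<open>h\<close>
  attaining it completes the basis.\<close>

lemma nat_indexed_int_basis:
  fixes G :: "'a::euclidean_space set" and \<phi> :: "nat \<Rightarrow> 'a \<Rightarrow> real"
  assumes "0 \<in> G" "\<And>x y. x \<in> G \<Longrightarrow> y \<in> G \<Longrightarrow> x - y \<in> G"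
    and "\<And>i. i < n \<Longrightarrow> linear (\<phi> i)"
    and "\<And>i x. i < n \<Longrightarrow> x \<in> G \<Longrightarrow> \<phi> i x \<in> \<int>"
    and "\<And>x. x \<in> G \<Longrightarrow> (\<And>i. i < n \<Longrightarrow> \<phi> i x = 0) \<Longrightarrow> x = 0"
  shows "\<exists>B. lattice_basis G B"
  using assms
proof (induction n arbitrary: G)
  case 0
  then have "G = {0}" by auto
  then have "lattice_basis G {}" by (simp add: lattice_basis_def int_span_def real_vector.independent_empty)
  then show ?case by blast
next
  case (Suc n)
  have lin: "linear (\<phi> n)" using Suc.prems by simp
  define G' where "G' = {x\<in>G. \<phi> n x = 0}"
  have "\<exists>B. lattice_basis G' B"
  proof (rule Suc.IH)
    fix x assume "x \<in> G'" "\<And>i. i < n \<Longrightarrow> \<phi> i x = 0"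
    then show "x = 0" using Suc.prems(5)[of x] by (auto simp: G'_def less_Suc_eq)
  qed (use Suc.prems lin in \<open>auto simp: G'_def linear_0 linear_diff\<close>)
  then obtain B where B: "independent B" "G' = int_span B" by (auto simp: lattice_basis_def)
  have finB: "finite B" using B(1) by (rule independent_imp_finite)
  show ?case
  proof (cases "G' = G")
    case True then show ?thesis using B by (auto simp: lattice_basis_def)
  next
    case False
    have G_neg: "- x \<in> G" if "x \<in> G" for x using Suc.prems(1,2) that by (metis diff_0)
    have G_add: "x + y \<in> G" if "x \<in> G" "y \<in> G" for x y
      using Suc.prems(2)[OF that(1) G_neg[OF that(2)]] by simp
    have G_scale: "of_int k *\<^sub>R x \<in> G" if x: "x \<in> G" for x k
    proof -
      have nat: "of_nat m *\<^sub>R x \<in> G" for m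
        by (induction m) (use x Suc.prems(1) G_add in \<open>auto simp: scaleR_left_distrib\<close>)
      show ?thesis
      proof (cases "k \<ge> 0")
        case True then show ?thesis using nat[of "nat k"] by simp
      next
        case False then show ?thesis using G_neg[OF nat[of "nat (- k)"]] by simp
      qed
    qed
    define I where "I = {k::nat. k > 0 \<and> (\<exists>x\<in>G. \<phi> n x = of_nat k)}"
    have "I \<noteq> {}"
    proof -
      obtain x where x: "x \<in> G" "\<phi> n x \<noteq> 0" using False by (auto simp: G'_def)
      obtain k where k: "\<phi> n x = of_int k" using Suc.prems(4)[of n x] x by (auto elim: Ints_cases)
      show ?thesis
      proof (cases "k > 0")
        case True then have "nat k \<in> I" using k x by (auto simp: I_def)
        then show ?thesis by blast
      next
        case False
        then have "nat (- k) \<in> I" using k x G_neg[OF x(1)] lin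
          by (auto simp: I_def linear_neg intro!: bexI[of _ "- x"])
        then show ?thesis by blast
      qed
    qed
    define d where "d = Inf I"
    have "d \<in> I" unfolding d_def using \<open>I \<noteq> {}\<close> by (rule Inf_nat_def1)
    then obtain h where h: "d > 0" "h \<in> G" "\<phi> n h = of_nat d" by (auto simp: I_def)
    have dmin: "d \<le> k" if "k \<in> I" for k unfolding d_def using that by (rule cInf_lower) simp
    have decomp: "\<exists>k::int. x - of_int k *\<^sub>R h \<in> G'" if x: "x \<in> G" for x
    proof -
      obtain m where m: "\<phi> n x = of_int m" using Suc.prems(4)[of n x] x by (auto elim: Ints_cases)
      define y where "y = x - of_int (m div int d) *\<^sub>R h"
      have yG: "y \<in> G" unfolding y_def using x h G_scale Suc.prems(2) by blast
      have "(of_int m :: real) = of_int (m div int d) * of_nat d + of_int (m mod int d)"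
        by (metis div_mult_mod_eq of_int_add of_int_mult of_int_of_nat_eq)
      then have py: "\<phi> n y = of_int (m mod int d)"
        using lin m h by (simp add: y_def linear_diff linear_scale)
      have "m mod int d = 0"
      proof (rule ccontr)
        assume "m mod int d \<noteq> 0"
        moreover have "0 \<le> m mod int d" "m mod int d < int d" using h(1) by simp_all
        ultimately have "nat (m mod int d) \<in> I" "nat (m mod int d) < d"
          using yG py by (auto simp: I_def intro!: bexI[of _ y])
        then show False using dmin by fastforce
      qed
      then have "y \<in> G'" using yG py by (simp add: G'_def)
      then show ?thesis unfolding y_def by blast
    qed
    have span0: "\<phi> n x = 0" if "x \<in> span B" for x
    proof -
      have "B \<subseteq> {x. \<phi> n x = 0}"
      proof
        fix b assume b: "b \<in> B"
        have "b = (\<Sum>x\<in>B. of_int (if x = b then 1 else 0) *\<^sub>R x)"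
          using b finB by (simp add: if_distrib[of "\<lambda>c. of_int c *\<^sub>R _"] sum.delta cong: if_cong)
        then have "b \<in> int_span B" unfolding int_span_def
          by (intro CollectI exI[of _ "\<lambda>x. if x = b then 1 else 0"]) auto
        then show "b \<in> {x. \<phi> n x = 0}" using B(2) by (auto simp: G'_def)
      qed
      moreover have "subspace {x. \<phi> n x = 0}"
        using lin by (auto simp: subspace_def linear_0 linear_add linear_scale)
      ultimately show ?thesis using that span_minimal by blast
    qed
    have hB: "h \<notin> span B" using span0[of h] h by auto
    then have hnB: "h \<notin> B" using span_base by blast
    have "independent (insert h B)" using B(1) hB by (simp add: independent_insert)
    moreover have "G = int_span (insert h B)"
    proof
      show "G \<subseteq> int_span (insert h B)"
      proof
        fix x assume "x \<in> G"
        then obtain k where "x - of_int k *\<^sub>R h \<in> int_span B" using decomp B(2) by blast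
        then obtain c where c: "x - of_int k *\<^sub>R h = (\<Sum>b\<in>B. of_int (c b) *\<^sub>R b)" by (auto simp: int_span_def)
        have "(\<Sum>b\<in>B. of_int ((c(h := k)) b) *\<^sub>R b) = (\<Sum>b\<in>B. of_int (c b) *\<^sub>R b)"
          using hnB by (intro sum.cong) auto
        then have "x = (\<Sum>b\<in>insert h B. of_int ((c(h := k)) b) *\<^sub>R b)"
          using c finB hnB by (simp add: algebra_simps)
        then show "x \<in> int_span (insert h B)" unfolding int_span_def by blast
      qed
    next
      show "int_span (insert h B) \<subseteq> G"
      proof
        fix x assume "x \<in> int_span (insert h B)"
        then obtain c where c: "x = (\<Sum>b\<in>insert h B. of_int (c b) *\<^sub>R b)" by (auto simp: int_span_def)
        have "(\<Sum>b\<in>B. of_int (c b) *\<^sub>R b) \<in> int_span B" unfolding int_span_def by blast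
        then have "(\<Sum>b\<in>B. of_int (c b) *\<^sub>R b) \<in> G" using B(2) by (auto simp: G'_def)
        then show "x \<in> G" using c finB hnB G_add G_scale[OF h(2)] by simp
      qed
    qed
    ultimately show ?thesis by (auto simp: lattice_basis_def)
  qed
qed

lemma mult_eq_1_Ints:
  fixes x y :: real
  assumes "x \<in> \<int>" "y \<in> \<int>" "x * y = 1" "y \<ge> 0" shows "y = 1"
proof -
  obtain a b where ab: "x = of_int a" "y = of_int b" using assms by (auto elim!: Ints_cases)
  have "of_int (a * b) = (of_int 1 :: real)" using assms(3) ab by simp
  then have "a * b = 1" using of_int_eq_iff by blast
  moreover have "b \<ge> 0" using assms ab by simp
  ultimately have "b = 1" using zmult_eq_1_iff[of a b] by auto
  then show ?thesis using ab by simp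
qed

lemma det_Ints:
  fixes A :: "real^'n^'n"
  assumes "\<And>i j. A $ i $ j \<in> \<int>" shows "det A \<in> \<int>"
  unfolding Determinants.det_def by (intro Ints_sum Ints_mult Ints_prod assms) auto

section \<open>Self-dual lattices: subgroup structure, bases, determinant\<close>

definition dual_lattice :: "'a::euclidean_space set \<Rightarrow> 'a set" where
  "dual_lattice L = {y. \<forall>x\<in>L. x \<bullet> y \<in> \<int>}"

text \<open>Self-duality is assumed of a mere set. Closure under addition, full rank, a basis and
  determinant 1 are consequences, so a concrete lattice needs the verification of one equality of
  sets only.\<close>

locale self_dual =
  fixes \<Lambda> :: "'a::euclidean_space set"
  assumes self_dual: "dual_lattice \<Lambda> = \<Lambda>"
begin

lemma inner_Ints: "x \<in> \<Lambda> \<Longrightarrow> y \<in> \<Lambda> \<Longrightarrow> x \<bullet> y \<in> \<int>"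
  using self_dual by (auto simp: dual_lattice_def)

lemma memI: "(\<And>x. x \<in> \<Lambda> \<Longrightarrow> x \<bullet> y \<in> \<int>) \<Longrightarrow> y \<in> \<Lambda>"
  using self_dual by (auto simp: dual_lattice_def)

lemma zero: "0 \<in> \<Lambda>" by (rule memI) auto

lemma diff: "x \<in> \<Lambda> \<Longrightarrow> y \<in> \<Lambda> \<Longrightarrow> x - y \<in> \<Lambda>"
  by (rule memI) (auto simp: inner_diff_right inner_Ints)

lemma add: "x \<in> \<Lambda> \<Longrightarrow> y \<in> \<Lambda> \<Longrightarrow> x + y \<in> \<Lambda>"
  by (rule memI) (auto simp: inner_add_right inner_Ints)

lemma scale: "x \<in> \<Lambda> \<Longrightarrow> k \<in> \<int> \<Longrightarrow> k *\<^sub>R x \<in> \<Lambda>"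
  by (rule memI) (auto simp: inner_Ints)

lemma sum: "(\<And>i. i \<in> I \<Longrightarrow> f i \<in> \<Lambda>) \<Longrightarrow> sum f I \<in> \<Lambda>"
  by (rule memI) (auto simp: inner_sum_right inner_Ints)

text \<open>A vector orthogonal to \<Lambda> stays in the dual, hence in \<Lambda>, under every
  scaling; scaled to length 1/2 it would be a lattice vector with inner square 1/4.\<close>

lemma orthogonal_eq_0: assumes "\<And>x. x \<in> \<Lambda> \<Longrightarrow> x \<bullet> y = 0" shows "y = 0"
proof (rule ccontr)
  assume "y \<noteq> 0"
  define z where "z = (1 / (2 * norm y)) *\<^sub>R y"
  have "z \<in> \<Lambda>" by (rule memI) (simp add: z_def assms)
  then have "z \<bullet> z \<in> \<int>" by (rule inner_Ints) fact
  moreover have "z \<bullet> z = 1 / 4" using \<open>y \<noteq> 0\<close>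
    by (simp add: z_def power2_norm_eq_inner[symmetric] power2_eq_square field_simps)
  ultimately obtain k where "real_of_int k = 1 / 4" by (metis Ints_cases)
  then have "of_int (4 * k) = (of_int 1 :: real)" by simp
  then have "4 * k = 1" using of_int_eq_iff by blast
  then show False by presburger
qed

lemma span_UNIV: "span \<Lambda> = UNIV"
proof (rule ccontr)
  assume "span \<Lambda> \<noteq> UNIV"
  then obtain y where "y \<noteq> 0" "\<And>x. x \<in> span \<Lambda> \<Longrightarrow> orthogonal y x"
    by (metis orthogonal_to_subspace_exists_gen psubsetI span_UNIV span_mono span_span subset_UNIV)
  then show False using orthogonal_eq_0[of y] by (metis inner_commute Linear_Algebra.orthogonal_def span_base)
qed

text \<open>The separating functionals are the inner products with a basis of the space chosen
  inside \<Lambda>. The injection \<open>f\<close> lets one statement serve both \<Lambda> itself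
  and its part in an orthogonal complement.\<close>

lemma subgroup_has_basis:
  fixes f :: "'b::euclidean_space \<Rightarrow> 'a"
  assumes f: "linear f" "inj f" and G: "0 \<in> G" "\<And>x y. x \<in> G \<Longrightarrow> y \<in> G \<Longrightarrow> x - y \<in> G" "f ` G \<subseteq> \<Lambda>"
  shows "\<exists>B. lattice_basis G B"
proof -
  obtain B where B: "B \<subseteq> \<Lambda>" "independent B" "\<Lambda> \<subseteq> span B" using maximal_independent_subset by blast
  obtain e where e: "bij_betw e {..<card B} B"
    using independent_imp_finite[OF B(2)] by (metis atLeast0LessThan ex_bij_betw_nat_finite)
  show ?thesis
  proof (rule nat_indexed_int_basis[where n = "card B" and \<phi> = "\<lambda>i x. e i \<bullet> f x"])
    show "linear (\<lambda>x. e i \<bullet> f x)" for i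
      using f(1) by (auto intro!: linearI simp: linear_add linear_scale inner_add_right)
    show "e i \<bullet> f x \<in> \<int>" if "i < card B" "x \<in> G" for i x
      using that G(3) B(1) bij_betwE[OF e] by (intro inner_Ints) auto
    show "x = 0" if "x \<in> G" "\<And>i. i < card B \<Longrightarrow> e i \<bullet> f x = 0" for x
    proof -
      have "b \<bullet> f x = 0" if b: "b \<in> B" for b
      proof -
        obtain i where "i < card B" "b = e i" using b bij_betw_imp_surj_on[OF e] by auto
        then show ?thesis using \<open>\<And>i. i < card B \<Longrightarrow> e i \<bullet> f x = 0\<close> by simp
      qed
      then have "orthogonal (f x) b" if "b \<in> span B" for b
        using that by (meson Linear_Algebra.orthogonal_def orthogonal_commute orthogonal_to_span)
      then have "f x = 0" using span_mono[OF B(3)] span_UNIV by (metis UNIV_I orthogonal_self span_span subsetD)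
      then show ?thesis using f by (metis injD linear_0)
    qed
  qed (use G in auto)
qed

end

text \<open>By self-duality the dual basis of the generators lies in \<Lambda>, so it is an integral
  combination of them: the inverse \<open>M\<close> of the Gram matrix is integral. The two integral
  determinants multiply to 1, and that of the Gram matrix is a square, hence not negative.\<close>

lemma self_dual_generators_det:
  fixes W :: "real^'n^'n"
  assumes "self_dual \<Lambda>" and W: "\<And>i. W $ i \<in> \<Lambda>"
    and gen: "\<And>x. x \<in> \<Lambda> \<Longrightarrow> \<exists>k::'n \<Rightarrow> int. x = (\<Sum>i\<in>UNIV. of_int (k i) *\<^sub>R W $ i)"
  shows "(det W)\<^sup>2 = 1"
proof -
  interpret self_dual \<Lambda> by fact
  have "\<Lambda> \<subseteq> span (rows W)"
  proof
    fix x assume "x \<in> \<Lambda>"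
    then obtain k :: "'n \<Rightarrow> int" where "x = (\<Sum>i\<in>UNIV. of_int (k i) *\<^sub>R W $ i)" using gen by blast
    moreover have "W $ i \<in> rows W" for i
    proof -
      have "row i W = W $ i" by (simp add: Finite_Cartesian_Product.row_def)
      then show ?thesis unfolding Finite_Cartesian_Product.rows_def
        by (intro CollectI exI[of _ i]) simp
    qed
    then have "(\<Sum>i\<in>UNIV. of_int (k i) *\<^sub>R W $ i) \<in> span (rows W)"
      by (intro span_sum span_scale span_base)
    ultimately show "x \<in> span (rows W)" by simp
  qed
  then have "span (rows W) = UNIV" using span_mono span_UNIV by (metis span_span top.extremum_uniqueI)
  then obtain B where BW: "B ** W = mat 1" using matrix_left_invertible_span_rows by blast
  then have WB: "W ** B = mat 1" by (simp add: matrix_left_right_inverse)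
  define v where "v j = column j B" for j
  have Wv: "W $ i \<bullet> v j = (if i = j then 1 else 0)" for i j
  proof -
    have "(W ** B) $ i $ j = W $ i \<bullet> v j"
      by (simp add: matrix_matrix_mult_def v_def column_def inner_vec_def)
    then show ?thesis by (simp add: WB Finite_Cartesian_Product.mat_def)
  qed
  have "v j \<in> \<Lambda>" for j
  proof (rule memI)
    fix x assume "x \<in> \<Lambda>"
    then obtain k :: "'n \<Rightarrow> int" where "x = (\<Sum>i\<in>UNIV. of_int (k i) *\<^sub>R W $ i)" using gen by blast
    then have "x \<bullet> v j = of_int (k j)"
      by (simp add: inner_sum_left Wv if_distrib sum.delta cong: if_cong)
    then show "x \<bullet> v j \<in> \<int>" by simp
  qed
  then have "\<forall>j. \<exists>k::'n \<Rightarrow> int. v j = (\<Sum>i\<in>UNIV. of_int (k i) *\<^sub>R W $ i)" using gen by blast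
  then obtain N :: "'n \<Rightarrow> 'n \<Rightarrow> int" where N: "\<And>j. v j = (\<Sum>i\<in>UNIV. of_int (N j i) *\<^sub>R W $ i)" by metis
  define M :: "real^'n^'n" where "M = (\<chi> j i. of_int (N j i))"
  have BM: "transpose B = M ** W"
    unfolding Finite_Cartesian_Product.vec_eq_iff
  proof (intro allI)
    fix j l
    have "transpose B $ j $ l = v j $ l" by (simp add: v_def column_def transpose_def)
    also have "\<dots> = (M ** W) $ j $ l" by (simp add: N M_def matrix_matrix_mult_def)
    finally show "transpose B $ j $ l = (M ** W) $ j $ l" .
  qed
  have "mat 1 = transpose (W ** B)" by (simp add: WB transpose_mat)
  also have "\<dots> = M ** (W ** transpose W)" by (simp add: matrix_transpose_mul BM matrix_mul_assoc)
  finally have M1: "det M * det (W ** transpose W) = 1" by (metis det_I det_mul)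
  have M2: "det M \<in> \<int>" by (rule det_Ints) (simp add: M_def)
  have M3: "det (W ** transpose W) \<in> \<int>"
  proof (rule det_Ints)
    fix i j
    have "(W ** transpose W) $ i $ j = W $ i \<bullet> W $ j"
      by (simp add: matrix_matrix_mult_def transpose_def inner_vec_def)
    then show "(W ** transpose W) $ i $ j \<in> \<int>" using inner_Ints W by simp
  qed
  have eq: "det (W ** transpose W) = (det W)\<^sup>2" by (simp add: det_mul power2_eq_square)
  have "det (W ** transpose W) \<ge> 0" unfolding eq by simp
  then have "det (W ** transpose W) = 1" by (rule mult_eq_1_Ints[OF M2 M3 M1])
  then show ?thesis unfolding eq .
qed

section \<open>Determinants of a cross-section and of its orthogonal complement\<close>

lemma det_conv_mat_det:
  fixes h :: "nat \<Rightarrow> 'n::finite" and F :: "'n \<Rightarrow> 'n \<Rightarrow> real"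
  assumes h: "bij_betw h {0..<n} UNIV"
  shows "det (\<chi> i j. F i j) = Determinant.det (Matrix.mat n n (\<lambda>(i, j). F (h i) (h j)))"
proof -
  \<comment> \<open>Conjugation by \<open>h\<close> carries permutations of the initial segment to
    permutations of the index type and preserves signs. Matrices indexed by numbers can then be cut
    into blocks of sizes \<open>d\<close> and \<open>k\<close>.\<close>
  let ?m = "map_permutation {0..<n} h"
  have inj: "inj_on h {0..<n}" and img: "h ` {0..<n} = UNIV" using h by (auto simp: bij_betw_def)
  have m: "bij_betw ?m {p. p permutes {0..<n}} {p. p permutes UNIV}"
  proof -
    have "?m = (\<lambda>\<pi> x. if x \<in> UNIV then h (\<pi> (inv_into {0..<n} h x)) else x)"
      by (simp add: fun_eq_iff map_permutation_def img)
    then show ?thesis using bij_betw_permutations[OF h] by simp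
  qed
  have "det (\<chi> i j. F i j) = (\<Sum>p | p permutes (UNIV::'n set). of_int (sign p) * (\<Prod>i\<in>UNIV. F i (p i)))"
    by (simp add: Determinants.det_def)
  also have "\<dots> = (\<Sum>p | p permutes {0..<n}. of_int (sign (?m p)) * (\<Prod>i\<in>UNIV. F i (?m p i)))"
    by (rule sum.reindex_bij_betw[OF m, symmetric])
  also have "\<dots> = (\<Sum>p | p permutes {0..<n}. of_int (sign p) * (\<Prod>i=0..<n. F (h i) (h (p i))))"
  proof (rule sum.cong[OF refl])
    fix p assume "p \<in> {p. p permutes {0..<n}}"
    then have p: "p permutes {0..<n}" by simp
    have "(\<Prod>i\<in>UNIV. F i (?m p i)) = (\<Prod>i=0..<n. F (h i) (?m p (h i)))"
      by (rule prod.reindex_bij_betw[OF h, symmetric])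
    also have "\<dots> = (\<Prod>i=0..<n. F (h i) (h (p i)))"
      by (intro prod.cong refl) (simp add: map_permutation_apply[OF inj])
    finally show "of_int (sign (?m p)) * (\<Prod>i\<in>UNIV. F i (?m p i)) =
        of_int (sign p) * (\<Prod>i=0..<n. F (h i) (h (p i)))"
      using sign_map_permutation[OF inj p] by simp
  qed
  also have "\<dots> = Determinant.det (Matrix.mat n n (\<lambda>(i, j). F (h i) (h j)))"
  proof -
    have "(\<Prod>i=0..<n. F (h i) (h (p i))) = (\<Prod>i=0..<n. Matrix.mat n n (\<lambda>(i, j). F (h i) (h j)) $$ (i, p i))"
      if "p permutes {0..<n}" for p
      using permutes_in_image[OF that] by (intro prod.cong refl) auto
    then show ?thesis by (auto simp: Determinant.det_def intro!: sum.cong)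
  qed
  finally show ?thesis .
qed

abbreviation gram_mat :: "nat \<Rightarrow> (nat \<Rightarrow> 'a::real_inner) \<Rightarrow> real mat" where
  "gram_mat k b \<equiv> Matrix.mat k k (\<lambda>(i, j). b i \<bullet> b j)"

lemma det_inner_products:
  fixes u v :: "nat \<Rightarrow> real^'n"
  assumes h: "bij_betw h {0..<n} (UNIV :: 'n set)"
  shows "Determinant.det (Matrix.mat n n (\<lambda>(i, j). u i \<bullet> v j)) =
    Determinant.det (Matrix.mat n n (\<lambda>(i, j). u i $ h j)) * Determinant.det (Matrix.mat n n (\<lambda>(i, j). v i $ h j))"
proof -
  let ?A = "Matrix.mat n n (\<lambda>(i, j). u i $ h j)" and ?B = "Matrix.mat n n (\<lambda>(i, j). v i $ h j)"
  have "Matrix.mat n n (\<lambda>(i, j). u i \<bullet> v j) = ?A * transpose_mat ?B"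
  proof (rule eq_matI)
    fix i j assume "i < dim_row (?A * transpose_mat ?B)" "j < dim_col (?A * transpose_mat ?B)"
    then have ij: "i < n" "j < n" by auto
    have "u i \<bullet> v j = (\<Sum>l=0..<n. u i $ h l * v j $ h l)"
      by (simp add: inner_vec_def sum.reindex_bij_betw[OF h, of "\<lambda>l. u i $ l * v j $ l"])
    then show "Matrix.mat n n (\<lambda>(i, j). u i \<bullet> v j) $$ (i, j) = (?A * transpose_mat ?B) $$ (i, j)"
      using ij by (simp add: scalar_prod_def)
  qed auto
  then show ?thesis by (simp add: det_mult[of _ n] Determinant.det_transpose[of _ n])
qed

text \<open>The coefficients \<open>x \<bullet> b i\<close> are integers, and the pairing of
  \<open>b\<close> with \<open>t\<close> makes the remainder orthogonal to every \<open>b j\<close>.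
  So the vectors \<open>t i\<close> complete generators of the orthogonal part to generators of
  \<Lambda>.\<close>

lemma (in self_dual) int_comb_complement:
  fixes b t :: "nat \<Rightarrow> 'a"
  assumes bt: "\<And>i. i < k \<Longrightarrow> b i \<in> \<Lambda>" "\<And>i. i < k \<Longrightarrow> t i \<in> \<Lambda>"
    "\<And>i j. i < k \<Longrightarrow> j < k \<Longrightarrow> b i \<bullet> t j = (if i = j then 1 else 0)"
    and x: "x \<in> \<Lambda>"
  shows "x - (\<Sum>i<k. (x \<bullet> b i) *\<^sub>R t i) \<in> \<Lambda> \<inter> (span (b ` {..<k}))\<^sup>\<bottom>"
proof
  let ?y = "x - (\<Sum>i<k. (x \<bullet> b i) *\<^sub>R t i)"
  show "?y \<in> \<Lambda>" using bt x by (intro diff sum scale inner_Ints) auto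
  have "orthogonal ?y v" if v: "v \<in> b ` {..<k}" for v
  proof -
    obtain j where j: "j < k" "v = b j" using v by auto
    have "(\<Sum>i<k. (x \<bullet> b i) * (t i \<bullet> b j)) = (\<Sum>i<k. if i = j then x \<bullet> b i else 0)"
      using j bt(3)[of j] by (intro sum.cong refl) (auto simp: inner_commute)
    also have "\<dots> = x \<bullet> b j" using j by simp
    finally show ?thesis by (simp add: Linear_Algebra.orthogonal_def j inner_diff_left inner_sum_left)
  qed
  then have "orthogonal ?y v" if "v \<in> span (b ` {..<k})" for v
    using orthogonal_to_span[OF that] by blast
  then show "?y \<in> (span (b ` {..<k}))\<^sup>\<bottom>"
    unfolding orthogonal_comp_def using orthogonal_commute by blast
qed

text \<open>Pairing the bases (L, t) and (L, b) of the ambient space in the three possible ways gives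
  block triangular Gram matrices, whence the determinants of L and of its complement agree.\<close>

lemma cross_section_gram_det:
  fixes \<Lambda> :: "(real^'n) set" and f :: "real^'d \<Rightarrow> real^'n" and b t :: "nat \<Rightarrow> real^'n"
    and c :: "'d \<Rightarrow> real^'d"
  assumes sd: "self_dual \<Lambda>" and k: "k + CARD('d) = CARD('n)"
    and bt: "\<And>i. i < k \<Longrightarrow> b i \<in> \<Lambda>" "\<And>i. i < k \<Longrightarrow> t i \<in> \<Lambda>"
    "\<And>i j. i < k \<Longrightarrow> j < k \<Longrightarrow> b i \<bullet> t j = (if i = j then 1 else 0)"
    and f: "linear f" "\<And>x. norm (f x) = norm x" "range f = (span (b ` {..<k}))\<^sup>\<bottom>"
    and c: "inj c" "lattice_basis (f -` \<Lambda>) (range c)"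
  shows "det (gram_matrix c) = Determinant.det (gram_mat k b)"
proof -
  interpret self_dual \<Lambda> by fact
  define d n where "d = CARD('d)" and "n = CARD('n)"
  have n: "n = d + k" using k by (simp add: d_def n_def)
  have inner_f: "f x \<bullet> f y = x \<bullet> y" for x y
    using f(1,2) by (simp add: orthogonal_transformation_def dot_norm linear_add[symmetric])
  obtain g where g: "bij_betw g {0..<d} (UNIV::'d set)" using ex_bij_betw_nat_finite[of "UNIV::'d set"] by (auto simp: d_def)
  obtain h where h: "bij_betw h {0..<n} (UNIV::'n set)" using ex_bij_betw_nat_finite[of "UNIV::'n set"] by (auto simp: n_def)
  have fb: "f x \<bullet> b j = 0" "b j \<bullet> f x = 0" if "j < k" for x j
  proof -
    have "f x \<in> (span (b ` {..<k}))\<^sup>\<bottom>" using f(3) by blast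
    then show "f x \<bullet> b j = 0" "b j \<bullet> f x = 0"
      using that by (auto simp: orthogonal_comp_def Linear_Algebra.orthogonal_def inner_commute span_base)
  qed
  have finI: "finite (range c)" by simp
  have cmem: "f (c i) \<in> \<Lambda>" for i
  proof -
    have "c i = (\<Sum>y\<in>range c. of_int (if y = c i then 1 else 0) *\<^sub>R y)"
      by (simp add: if_distrib[of "\<lambda>c. of_int c *\<^sub>R _"] sum.delta cong: if_cong)
    then have "c i \<in> int_span (range c)" unfolding int_span_def
      by (intro CollectI exI[of _ "\<lambda>y. if y = c i then 1 else 0"]) auto
    then show ?thesis using c(2) by (auto simp: lattice_basis_def)
  qed
  define W where "W i = (if i < d then f (c (g i)) else t (i - d))" for i
  define W' where "W' i = (if i < d then f (c (g i)) else b (i - d))" for i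
  let ?M = "\<lambda>u. Matrix.mat n n (\<lambda>(i, j). u i $ h j)" and ?G = "\<lambda>u v. Matrix.mat n n (\<lambda>(i, j). u i \<bullet> v j)"
  let ?Gc = "gram_mat d (\<lambda>i. c (g i))" and ?Gb = "gram_mat k b"
  have Gc: "det (gram_matrix c) = Determinant.det ?Gc"
    unfolding gram_matrix_def by (rule det_conv_mat_det[OF g])
  have "?G W' W' = four_block_mat ?Gc (0\<^sub>m d k) (0\<^sub>m k d) ?Gb"
    by (rule eq_matI) (auto simp: n W'_def inner_f fb)
  then have 1: "Determinant.det (?M W') * Determinant.det (?M W') = Determinant.det ?Gc * Determinant.det ?Gb"
    using det_inner_products[OF h, of W' W']
    by (simp add: det_four_block_mat_upper_right_zero[of _ d _ k])
  have "?G W W' = four_block_mat ?Gc (0\<^sub>m d k) (Matrix.mat k d (\<lambda>(i,j). t i \<bullet> f (c (g j)))) (1\<^sub>m k)"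
    by (rule eq_matI) (auto simp: n W_def W'_def inner_f fb bt(3) inner_commute[of "t _"])
  then have 2: "Determinant.det (?M W) * Determinant.det (?M W') = Determinant.det ?Gc"
    using det_inner_products[OF h, of W W']
    by (simp add: det_four_block_mat_upper_right_zero[of _ d _ k])
  define hi where "hi = inv_into {0..<n} h"
  have hi: "hi (h i) = i" if "i < n" for i using h that by (simp add: hi_def bij_betw_def)
  define Wm :: "real^'n^'n" where "Wm = (\<chi> l. W (hi l))"
  have "(det Wm)\<^sup>2 = 1"
  proof (rule self_dual_generators_det[OF sd])
    have hil: "hi l < n" for l using bij_betw_inv_into[OF h] by (auto simp: hi_def bij_betw_def)
    show "Wm $ l \<in> \<Lambda>" for l using hil[of l] cmem bt(2) n by (auto simp: Wm_def W_def)
    fix x assume x: "x \<in> \<Lambda>"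
    define y where "y = x - (\<Sum>i<k. (x \<bullet> b i) *\<^sub>R t i)"
    have y: "y \<in> \<Lambda>" "y \<in> range f" using int_comb_complement[where b=b and t=t and k=k, OF bt x] f(3) by (auto simp: y_def)
    then obtain z where z: "y = f z" "z \<in> f -` \<Lambda>" by auto
    then obtain q where q: "z = (\<Sum>y\<in>range c. of_int (q y) *\<^sub>R y)"
      using c(2) by (auto simp: lattice_basis_def int_span_def)
    have "z = (\<Sum>i\<in>UNIV. of_int (q (c i)) *\<^sub>R c i)" using q by (simp add: sum.reindex[OF c(1)])
    also have "\<dots> = (\<Sum>i=0..<d. of_int (q (c (g i))) *\<^sub>R c (g i))"
      by (rule sum.reindex_bij_betw[OF g, symmetric])
    finally have yq: "y = (\<Sum>i=0..<d. of_int (q (c (g i))) *\<^sub>R f (c (g i)))"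
      using z f(1) by (simp add: linear_sum linear_scale)
    have "\<exists>m. x \<bullet> b i = of_int m" if "i < k" for i using inner_Ints[OF x bt(1)[OF that]] by (auto elim: Ints_cases)
    then obtain m where m: "\<And>i. i < k \<Longrightarrow> x \<bullet> b i = of_int (m i)" by metis
    define r where "r i = (if i < d then q (c (g i)) else m (i - d))" for i
    have "x = y + (\<Sum>i<k. of_int (m i) *\<^sub>R t i)" by (simp add: y_def m)
    also have "(\<Sum>i<k. of_int (m i) *\<^sub>R t i) = (\<Sum>i=d..<n. of_int (r i) *\<^sub>R W i)"
      by (rule sum.reindex_bij_witness[of _ "\<lambda>i. i - d" "\<lambda>i. i + d"]) (auto simp: n r_def W_def)
    also have "y = (\<Sum>i=0..<d. of_int (r i) *\<^sub>R W i)" by (simp add: yq r_def W_def)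
    also have "(\<Sum>i=0..<d. of_int (r i) *\<^sub>R W i) + (\<Sum>i=d..<n. of_int (r i) *\<^sub>R W i) = (\<Sum>i=0..<n. of_int (r i) *\<^sub>R W i)"
      by (rule sum.atLeastLessThan_concat) (auto simp: n)
    also have "\<dots> = (\<Sum>i=0..<n. of_int (r (hi (h i))) *\<^sub>R Wm $ h i)"
      by (simp add: hi Wm_def)
    also have "\<dots> = (\<Sum>l\<in>UNIV. of_int (r (hi l)) *\<^sub>R Wm $ l)"
      by (rule sum.reindex_bij_betw[OF h])
    finally show "\<exists>k::'n \<Rightarrow> int. x = (\<Sum>i\<in>UNIV. of_int (k i) *\<^sub>R Wm $ i)"
      by (rule exI[of _ "\<lambda>l. r (hi l)"])
  qed
  moreover have "det Wm = Determinant.det (?M W)"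
  proof -
    have "det (\<chi> i j. W (hi i) $ j) = Determinant.det (Matrix.mat n n (\<lambda>(i, j). W (hi (h i)) $ h j))"
      by (rule det_conv_mat_det[OF h])
    moreover have "Matrix.mat n n (\<lambda>(i, j). W (hi (h i)) $ h j) = ?M W" by (rule eq_matI) (auto simp: hi)
    moreover have "Wm = (\<chi> i j. W (hi i) $ j)" by (simp add: Wm_def vec_eq_iff)
    ultimately show ?thesis by simp
  qed
  ultimately have 3: "Determinant.det (?M W) * Determinant.det (?M W) = 1" by (simp add: power2_eq_square)
  let ?w = "Determinant.det (?M W)" and ?w' = "Determinant.det (?M W')"
  \<comment> \<open>With g and g' the determinants of \<open>?Gc\<close> and \<open>?Gb\<close>, the
    facts so far read \<open>?w' * ?w' = g g'\<close>, \<open>?w * ?w' = g\<close> and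
    \<open>?w * ?w = 1\<close>. Squaring the second gives g g = g g', and g is not 0.\<close>
  have "Determinant.det ?Gc * Determinant.det ?Gc = (?w * ?w) * (?w' * ?w')" using 2 by (simp add: algebra_simps)
  then have "Determinant.det ?Gc * Determinant.det ?Gc = Determinant.det ?Gc * Determinant.det ?Gb" using 1 3 by simp
  moreover have "Determinant.det ?Gc \<noteq> 0"
  proof -
    have "lattice_has_det (f -` \<Lambda>) (det (gram_matrix c))" using c unfolding lattice_has_det_def by blast
    then show ?thesis using lattice_has_det_pos Gc by fastforce
  qed
  ultimately show ?thesis using Gc by simp
qed

lemma cross_section_lattice:
  fixes \<Lambda> :: "(real^'n) set" and b t :: "nat \<Rightarrow> real^'n"
  assumes sd: "self_dual \<Lambda>" and k: "k + CARD('d) = CARD('n)"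
    and bt: "\<And>i. i < k \<Longrightarrow> b i \<in> \<Lambda>" "\<And>i. i < k \<Longrightarrow> t i \<in> \<Lambda>"
    "\<And>i j. i < k \<Longrightarrow> j < k \<Longrightarrow> b i \<bullet> t j = (if i = j then 1 else 0)"
  obtains f :: "real^'d \<Rightarrow> real^'n" where "linear f" "\<And>x. norm (f x) = norm x"
    "range f = (span (b ` {..<k}))\<^sup>\<bottom>" "cuts_cross_section \<Lambda> (span (b ` {..<k}))"
    "full_lattice (f -` \<Lambda>)" "lattice_has_det (f -` \<Lambda>) (Determinant.det (gram_mat k b))"
proof -
  interpret self_dual \<Lambda> by fact
  let ?I = "b ` {..<k}"
  define U where "U = span ?I"
  have injb: "inj_on b {..<k}"
  proof (rule inj_onI)
    fix i j assume ij: "i \<in> {..<k}" "j \<in> {..<k}" "b i = b j"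
    then have "b j \<bullet> t i = 1" using bt(3)[of i i] by simp
    then show "i = j" using bt(3)[of j i] ij(1,2) by (metis lessThan_iff zero_neq_one)
  qed
  have coeff: "(\<Sum>v\<in>?I. u v *\<^sub>R v) \<bullet> t j = u (b j)" if j: "j < k" for u j
  proof -
    have "(\<Sum>v\<in>?I. u v *\<^sub>R v) \<bullet> t j = (\<Sum>i<k. u (b i) * (b i \<bullet> t j))"
      by (simp add: sum.reindex[OF injb] inner_sum_left)
    also have "\<dots> = (\<Sum>i<k. if i = j then u (b i) else 0)" using j by (intro sum.cong refl) (auto simp: bt(3))
    finally show ?thesis using j by simp
  qed
  have indb: "independent ?I"
  proof (rule independent_if_scalars_zero)
    fix u v assume "(\<Sum>x\<in>?I. u x *\<^sub>R x) = 0" "v \<in> ?I"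
    then show "u v = 0" using coeff[of _ u] by auto
  qed simp
  have dimU: "dim U = k" unfolding U_def using indb injb by (simp add: dim_eq_card_independent card_image)
  have "\<Lambda> \<inter> U = int_span ?I"
  proof (intro subset_antisym subsetI)
    fix x assume x: "x \<in> \<Lambda> \<inter> U"
    then obtain u where u: "x = (\<Sum>v\<in>?I. u v *\<^sub>R v)" unfolding U_def by (auto simp: span_finite)
    \<comment> \<open>Primitivity: the coordinates of \<open>x\<close> in the basis \<open>b\<close>
      are its inner products with the lattice vectors \<open>t j\<close>, so a real combination of
      the \<open>b j\<close> that lies in \<Lambda> is an integral one.\<close>
    have "u v = of_int \<lfloor>u v\<rfloor>" if v: "v \<in> ?I" for v
    proof -
      obtain j where j: "j < k" "v = b j" using v by auto
      have "u v = x \<bullet> t j" using coeff[OF j(1), of u] u j by simp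
      also have "\<dots> \<in> \<int>" using x j bt(2) by (intro inner_Ints) auto
      finally show ?thesis by (auto elim: Ints_cases)
    qed
    then have "x = (\<Sum>v\<in>?I. of_int \<lfloor>u v\<rfloor> *\<^sub>R v)" unfolding u by (intro sum.cong refl) metis
    then show "x \<in> int_span ?I" unfolding int_span_def by (intro CollectI exI[of _ "\<lambda>v. \<lfloor>u v\<rfloor>"]) auto
  next
    fix x assume "x \<in> int_span ?I"
    then obtain u where u: "x = (\<Sum>v\<in>?I. of_int (u v) *\<^sub>R v)" unfolding int_span_def by blast
    have "x \<in> \<Lambda>" unfolding u using bt(1) by (intro sum scale) auto
    moreover have "x \<in> U" unfolding u U_def by (intro span_sum span_scale span_base)
    ultimately show "x \<in> \<Lambda> \<inter> U" by blast
  qed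
  then have "lattice_basis (\<Lambda> \<inter> U) ?I" using indb by (simp add: lattice_basis_def)
  moreover have "card ?I = k" using injb by (simp add: card_image)
  ultimately have cuts: "cuts_cross_section \<Lambda> U"
    unfolding cuts_cross_section_def lattice_of_rank_def dimU by (auto simp: U_def)
  have "dim (U\<^sup>\<bottom>) + dim U = CARD('n)"
    using dim_subspace_orthogonal_to_vectors[of U UNIV] by (simp add: U_def orthogonal_comp_def)
  then have "dim (UNIV :: (real^'d) set) = dim (U\<^sup>\<bottom>)" using dimU k by simp
  then obtain f :: "real^'d \<Rightarrow> real^'n" where f: "linear f" "range f = U\<^sup>\<bottom>" "\<And>x. norm (f x) = norm x"
    using isometry_subspaces[OF subspace_UNIV subspace_orthogonal_comp] by (metis UNIV_I)
  have injf: "inj f" using f(1,3) by (simp add: linear_injective_0) (metis norm_eq_zero)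
  obtain B where B: "lattice_basis (f -` \<Lambda>) B"
    using subgroup_has_basis[OF f(1) injf, of "f -` \<Lambda>"] f(1) zero diff by (auto simp: linear_0 linear_diff)
  have finB: "finite B" and indB: "independent B" using B independent_imp_finite by (auto simp: lattice_basis_def)
  have cardB: "card B = CARD('d)"
  proof (rule antisym)
    show "card B \<le> CARD('d)" using independent_card_le_dim[of B UNIV] indB by simp
    \<comment> \<open>Together with the \<open>k\<close> vectors \<open>t i\<close> the images of
      \<open>B\<close> span the whole space, which bounds the rank of the complement from
      below.\<close>
    have "\<Lambda> \<subseteq> span (f ` B \<union> t ` {..<k})"
    proof
      fix x assume x: "x \<in> \<Lambda>"
      define y where "y = x - (\<Sum>i<k. (x \<bullet> b i) *\<^sub>R t i)"
      have "y \<in> \<Lambda>" "y \<in> range f" using int_comb_complement[where b=b and t=t and k=k, OF bt x] f(2) by (auto simp: y_def U_def)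
      then obtain z where z: "y = f z" "z \<in> f -` \<Lambda>" by auto
      then obtain q where q: "z = (\<Sum>y\<in>B. of_int (q y) *\<^sub>R y)"
        using B by (auto simp: lattice_basis_def int_span_def)
      have "y = (\<Sum>v\<in>B. of_int (q v) *\<^sub>R f v)" using z q f(1) by (simp add: linear_sum linear_scale)
      moreover have "(\<Sum>v\<in>B. of_int (q v) *\<^sub>R f v) \<in> span (f ` B \<union> t ` {..<k})"
        by (intro span_sum span_scale span_base) auto
      ultimately have "y \<in> span (f ` B \<union> t ` {..<k})" by simp
      moreover have "(\<Sum>i<k. (x \<bullet> b i) *\<^sub>R t i) \<in> span (f ` B \<union> t ` {..<k})"
        by (intro span_sum span_scale span_base) auto
      moreover have "x = y + (\<Sum>i<k. (x \<bullet> b i) *\<^sub>R t i)" by (simp add: y_def)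
      ultimately show "x \<in> span (f ` B \<union> t ` {..<k})" by (metis span_add)
    qed
    then have "UNIV \<subseteq> span (f ` B \<union> t ` {..<k})" using span_UNIV span_minimal subspace_span by metis
    then have "CARD('n) \<le> card (f ` B \<union> t ` {..<k})"
      using dim_le_card[of UNIV "f ` B \<union> t ` {..<k}"] finB by simp
    also have "\<dots> \<le> card (f ` B) + card (t ` {..<k})" by (rule card_Un_le)
    also have "\<dots> \<le> card B + k" using card_image_le[OF finB, of f] card_image_le[of "{..<k}" t] by simp
    finally show "CARD('d) \<le> card B" using k by simp
  qed
  obtain c where c: "bij_betw c (UNIV::'d set) B"
    using finB cardB by (metis finite_class.finite_UNIV finite_same_card_bij)
  have cB: "inj c" "lattice_basis (f -` \<Lambda>) (range c)" using c B by (auto simp: bij_betw_def)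
  have "det (gram_matrix c) = Determinant.det (gram_mat k b)"
    using cross_section_gram_det[OF sd k bt f(1,3) _ cB] f(2) by (simp add: U_def)
  then have "lattice_has_det (f -` \<Lambda>) (Determinant.det (gram_mat k b))"
    using cB unfolding lattice_has_det_def by metis
  moreover have "full_lattice (f -` \<Lambda>)"
    using B cardB unfolding full_lattice_def lattice_of_rank_def by auto
  ultimately show ?thesis using that f cuts by (simp add: U_def)
qed

lemma self_dual_unimodular:
  fixes \<Lambda> :: "(real^'n) set"
  assumes sd: "self_dual \<Lambda>" shows "unimodular_lattice \<Lambda>"
proof -
  interpret self_dual \<Lambda> by fact
  obtain B where B: "lattice_basis \<Lambda> B"
    using subgroup_has_basis[of id \<Lambda>] zero diff linear_id by auto
  have finB: "finite B" and indB: "independent B" using B independent_imp_finite by (auto simp: lattice_basis_def)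
  have "\<Lambda> \<subseteq> span B" using B by (auto simp: lattice_basis_def int_span_def intro: span_sum span_scale span_base)
  then have "span B = UNIV" using span_UNIV span_mono by (metis span_span top.extremum_uniqueI)
  then have cardB: "card B = CARD('n)" using indB by (metis dim_UNIV dim_span_eq_card_independent DIM_cart DIM_real mult_1_right)
  obtain c where c: "bij_betw c (UNIV::'n set) B"
    using finB cardB by (metis finite_class.finite_UNIV finite_same_card_bij)
  have cB: "inj c" "lattice_basis \<Lambda> (range c)" using c B by (auto simp: bij_betw_def)
  define W :: "real^'n^'n" where "W = (\<chi> i. c i)"
  have "(det W)\<^sup>2 = 1"
  proof (rule self_dual_generators_det[OF sd])
    fix i
    have "c i = (\<Sum>y\<in>range c. of_int (if y = c i then 1 else 0) *\<^sub>R y)"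
      by (simp add: if_distrib[of "\<lambda>c. of_int c *\<^sub>R _"] sum.delta cong: if_cong)
    then have "c i \<in> int_span (range c)" unfolding int_span_def
      by (intro CollectI exI[of _ "\<lambda>y. if y = c i then 1 else 0"]) auto
    then show "W $ i \<in> \<Lambda>" using cB(2) by (simp add: lattice_basis_def W_def)
  next
    fix x assume "x \<in> \<Lambda>"
    then obtain q where "x = (\<Sum>y\<in>range c. of_int (q y) *\<^sub>R y)"
      using cB(2) by (auto simp: lattice_basis_def int_span_def)
    then have "x = (\<Sum>i\<in>UNIV. of_int (q (c i)) *\<^sub>R W $ i)" by (simp add: sum.reindex[OF cB(1)] W_def)
    then show "\<exists>k::'n \<Rightarrow> int. x = (\<Sum>i\<in>UNIV. of_int (k i) *\<^sub>R W $ i)" by (rule exI[of _ "\<lambda>i. q (c i)"])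
  qed
  moreover have "gram_matrix c = W ** transpose W"
    by (simp add: gram_matrix_def W_def transpose_def matrix_matrix_mult_def inner_vec_def vec_eq_iff)
  then have "det (gram_matrix c) = (det W)\<^sup>2" by (simp add: det_mul power2_eq_square)
  ultimately have "lattice_has_det \<Lambda> 1" using cB unfolding lattice_has_det_def by metis
  moreover have "full_lattice \<Lambda>"
    using B cardB unfolding full_lattice_def lattice_of_rank_def by auto
  ultimately show ?thesis by (simp add: unimodular_lattice_def integral_lattice_def inner_Ints)
qed

section \<open>The Pless symmetry code of length 48\<close>

text \<open>The skew Paley conference matrix of order 24; its index 0 is the point at infinity of the
  projective line over the field with 23 elements. The rows \<open>(e\<^sub>i | S\<^sub>i)\<close> generate the code.\<close>

definition chi :: "int \<Rightarrow> int" where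
  "chi x = (let r = x mod 23 in if r = 0 then 0
     else if r \<in> set [1, 2, 3, 4, 6, 8, 9, 12, 13, 16, 18] then 1 else - 1)"

definition S :: "nat \<Rightarrow> nat \<Rightarrow> int" where
  "S i j = (if i = 0 then (if j = 0 then 0 else 1) else if j = 0 then - 1 else chi (int j - int i))"

section \<open>A pruned search for light codewords\<close>

datatype trit = Z | P | M

fun tadd :: "trit \<Rightarrow> trit \<Rightarrow> trit" where
  "tadd Z y = y" | "tadd P Z = P" | "tadd P P = M" | "tadd P M = Z"
| "tadd M Z = M" | "tadd M P = Z" | "tadd M M = P"

fun tneg :: "trit \<Rightarrow> trit" where "tneg Z = Z" | "tneg P = M" | "tneg M = P"

fun vadd :: "trit list \<Rightarrow> trit list \<Rightarrow> trit list" where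
  "vadd (x # xs) (y # ys) = tadd x y # vadd xs ys" | "vadd [] ys = []" | "vadd xs [] = []"

fun vsub :: "trit list \<Rightarrow> trit list \<Rightarrow> trit list" where
  "vsub (x # xs) (y # ys) = tadd x (tneg y) # vsub xs ys" | "vsub [] ys = []" | "vsub xs [] = []"

fun wt_ge :: "nat \<Rightarrow> trit list \<Rightarrow> bool" where
  "wt_ge 0 xs = True" | "wt_ge (Suc n) [] = False"
| "wt_ge (Suc n) (Z # xs) = wt_ge (Suc n) xs"
| "wt_ge (Suc n) (P # xs) = wt_ge n xs"
| "wt_ge (Suc n) (M # xs) = wt_ge n xs"

text \<open>Adding and counting are fused: the sum is never built, and evaluation stops at the
  \<open>n\<close>-th nonzero symbol. Symbols are constructors rather than integers, so the search
  proceeds by pattern matching without arithmetic.\<close>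

fun add_ge :: "nat \<Rightarrow> trit list \<Rightarrow> trit list \<Rightarrow> bool" where
  "add_ge 0 xs ys = True"
| "add_ge (Suc n) (Z # xs) (Z # ys) = add_ge (Suc n) xs ys"
| "add_ge (Suc n) (Z # xs) (P # ys) = add_ge n xs ys"
| "add_ge (Suc n) (Z # xs) (M # ys) = add_ge n xs ys"
| "add_ge (Suc n) (P # xs) (Z # ys) = add_ge n xs ys"
| "add_ge (Suc n) (P # xs) (P # ys) = add_ge n xs ys"
| "add_ge (Suc n) (P # xs) (M # ys) = add_ge (Suc n) xs ys"
| "add_ge (Suc n) (M # xs) (Z # ys) = add_ge n xs ys"
| "add_ge (Suc n) (M # xs) (P # ys) = add_ge (Suc n) xs ys"
| "add_ge (Suc n) (M # xs) (M # ys) = add_ge n xs ys"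
| "add_ge (Suc n) [] ys = False"
| "add_ge (Suc n) xs [] = False"

fun sub_ge :: "nat \<Rightarrow> trit list \<Rightarrow> trit list \<Rightarrow> bool" where
  "sub_ge 0 xs ys = True"
| "sub_ge (Suc n) (Z # xs) (Z # ys) = sub_ge (Suc n) xs ys"
| "sub_ge (Suc n) (Z # xs) (P # ys) = sub_ge n xs ys"
| "sub_ge (Suc n) (Z # xs) (M # ys) = sub_ge n xs ys"
| "sub_ge (Suc n) (P # xs) (Z # ys) = sub_ge n xs ys"
| "sub_ge (Suc n) (P # xs) (P # ys) = sub_ge (Suc n) xs ys"
| "sub_ge (Suc n) (P # xs) (M # ys) = sub_ge n xs ys"
| "sub_ge (Suc n) (M # xs) (Z # ys) = sub_ge n xs ys"
| "sub_ge (Suc n) (M # xs) (P # ys) = sub_ge n xs ys"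
| "sub_ge (Suc n) (M # xs) (M # ys) = sub_ge (Suc n) xs ys"
| "sub_ge (Suc n) [] ys = False"
| "sub_ge (Suc n) xs [] = False"

fun all_far :: "nat \<Rightarrow> trit list \<Rightarrow> trit list list \<Rightarrow> bool" where
  "all_far n y [] = True"
| "all_far n y (r # rs) = (if add_ge n y r then if sub_ge n y r then all_far n y rs else False else False)"

text \<open>Rows have weight 23, so adding a row to a vector of weight less than 17 leaves a weight of at
  least 7: this is why the last row needs no search then.\<close>

fun heavy_combs :: "nat \<Rightarrow> trit list list \<Rightarrow> trit list \<Rightarrow> bool" where
  "heavy_combs k [] y = wt_ge (k + 7) y"
| "heavy_combs 0 (r # rs) y = wt_ge 7 y"
| "heavy_combs (Suc 0) (r # rs) y =
    (if wt_ge 8 y then if wt_ge 17 y then all_far 7 y (r # rs) else True else False)"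
| "heavy_combs (Suc (Suc k)) (r # rs) y =
    (if heavy_combs (Suc (Suc k)) rs y then
       if heavy_combs (Suc k) rs (vadd y r) then heavy_combs (Suc k) rs (vsub y r) else False
     else False)"

definition trit_of :: "int \<Rightarrow> trit" where
  "trit_of x = (let r = x mod 3 in if r = 0 then Z else if r = 1 then P else M)"

definition tvec :: "(nat \<Rightarrow> int) \<Rightarrow> trit list" where
  "tvec f = map (\<lambda>j. trit_of (f j)) [0..<24]"

text \<open>Left half of a codeword of full weight: the sum \<open>e_i + s S_i\<close>, up to the
  sign \<open>e\<close>. As the square of \<open>S\<close> is 1 mod 3, the right half is
  \<open>e (S_i + s e_i)\<close> mod 3. In both halves the single zero of the row \<open>S_i\<close>
  is filled by the unit vector, so no coordinate vanishes.\<close>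

definition full_word :: "nat \<Rightarrow> int \<Rightarrow> int \<Rightarrow> nat \<Rightarrow> int" where
  "full_word i s e l = e * ((if l = i then 1 else 0) + s * S i l)"

definition twt :: "trit list \<Rightarrow> nat" where "twt xs = length (filter (\<lambda>x. x \<noteq> Z) xs)"

lemma twt_simps [simp]: "twt [] = 0" "twt (Z # xs) = twt xs" "twt (P # xs) = Suc (twt xs)" "twt (M # xs) = Suc (twt xs)"
  by (simp_all add: twt_def)

lemma wt_ge_iff: "wt_ge n xs \<longleftrightarrow> n \<le> twt xs"
  by (induction n xs rule: wt_ge.induct) auto

lemma add_ge_imp: "add_ge n xs ys \<Longrightarrow> n \<le> twt (vadd xs ys)"
  by (induction n xs ys rule: add_ge.induct) auto

lemma sub_ge_imp: "sub_ge n xs ys \<Longrightarrow> n \<le> twt (vsub xs ys)"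
  by (induction n xs ys rule: sub_ge.induct) auto

lemma all_far_imp:
  "all_far n y rs \<Longrightarrow> r \<in> set rs \<Longrightarrow> n \<le> twt (vadd y r) \<and> n \<le> twt (vsub y r)"
  by (induction n y rs rule: all_far.induct) (auto simp: add_ge_imp sub_ge_imp split: if_splits)

lemma twt_vadd_ge: "length xs = length ys \<Longrightarrow> twt ys \<le> twt xs + twt (vadd xs ys)"
proof (induction xs ys rule: vadd.induct)
  case (1 x xs y ys) then show ?case by (cases x; cases y) auto
qed auto

lemma twt_vsub_ge: "length xs = length ys \<Longrightarrow> twt ys \<le> twt xs + twt (vsub xs ys)"
proof (induction xs ys rule: vsub.induct)
  case (1 x xs y ys) then show ?case by (cases x; cases y) auto
qed auto

fun tlin :: "trit list \<Rightarrow> trit list list \<Rightarrow> trit list \<Rightarrow> trit list" where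
  "tlin (c # cs) (r # rs) y = tlin cs rs (case c of Z \<Rightarrow> y | P \<Rightarrow> vadd y r | M \<Rightarrow> vsub y r)"
| "tlin cs rs y = y"

lemma tlin_zero: "twt cs = 0 \<Longrightarrow> tlin cs rs y = y"
proof (induction cs rs y rule: tlin.induct)
  case (1 c cs r rs y) then show ?case by (cases c) auto
qed auto

lemma tlin_single:
  "twt cs = Suc 0 \<Longrightarrow> length cs = length rs \<Longrightarrow> \<exists>r\<in>set rs. tlin cs rs y = vadd y r \<or> tlin cs rs y = vsub y r"
proof (induction cs rs y rule: tlin.induct)
  case (1 c cs r rs y) then show ?case by (cases c) (auto simp: tlin_zero)
qed auto

lemma length_vadd [simp]: "length (vadd xs ys) = min (length xs) (length ys)"
  by (induction xs ys rule: vadd.induct) auto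

lemma length_vsub [simp]: "length (vsub xs ys) = min (length xs) (length ys)"
  by (induction xs ys rule: vsub.induct) auto

text \<open>The number \<open>k\<close> is the budget of rows still to be added to \<open>y\<close>.
  With six rows allowed in all, the rows spent earlier number \<open>6 - k\<close>; added to the
  bound \<open>k + 7\<close> they give total weight 13 at every stage of the search.\<close>

lemma heavy_combs_imp:
  assumes "heavy_combs k rs y" "length cs = length rs" "twt cs \<le> k"
    "\<And>r. r \<in> set rs \<Longrightarrow> length r = length y \<and> 23 \<le> twt r"
  shows "k + 7 \<le> twt (tlin cs rs y) + twt cs"
  using assms
proof (induction k rs y arbitrary: cs rule: heavy_combs.induct)
  case (1 k y)
  then show ?case by (simp add: wt_ge_iff)
next
  case (2 r rs y)
  then show ?case by (simp add: wt_ge_iff tlin_zero)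
next
  case (3 r rs y)
  from "3.prems"(1) have y: "8 \<le> twt y" "17 \<le> twt y \<Longrightarrow> all_far 7 y (r # rs)"
    by (auto simp: wt_ge_iff split: if_splits)
  show ?case
  proof (cases "twt cs = 0")
    case True then show ?thesis using y by (simp add: tlin_zero)
  next
    case False
    then have cs: "twt cs = Suc 0" using "3.prems"(3) by simp
    obtain r' where r': "r' \<in> set (r # rs)"
      "tlin cs (r # rs) y = vadd y r' \<or> tlin cs (r # rs) y = vsub y r'"
      using tlin_single[OF cs "3.prems"(2)] by blast
    have len: "length y = length r'" and w: "23 \<le> twt r'" using "3.prems"(4)[OF r'(1)] by auto
    have "7 \<le> twt (vadd y r') \<and> 7 \<le> twt (vsub y r')"
    proof (cases "17 \<le> twt y")
      case True then show ?thesis using all_far_imp[OF y(2) r'(1)] by simp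
    next
      case False then show ?thesis using twt_vadd_ge[OF len] twt_vsub_ge[OF len] w by simp
    qed
    then show ?thesis using r'(2) cs by auto
  qed
next
  case (4 k r rs y)
  from "4.prems"(1) have h: "heavy_combs (Suc (Suc k)) rs y" "heavy_combs (Suc k) rs (vadd y r)"
    "heavy_combs (Suc k) rs (vsub y r)" by (auto split: if_splits)
  obtain c cs' where cs: "cs = c # cs'" "length cs' = length rs" using "4.prems"(2) by (cases cs) auto
  have len: "length r = length y" using "4.prems"(4) by auto
  show ?case
  proof (cases c)
    case Z
    then show ?thesis using "4.IH"(1)[of cs'] h cs "4.prems"(3,4) by auto
  next
    case P
    then show ?thesis using "4.IH"(2)[of cs'] h cs "4.prems"(3,4) len by auto
  next
    case M
    then show ?thesis using "4.IH"(3)[of cs'] h cs "4.prems"(3,4) len by auto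
  qed
qed

lemma trit_of_eq_Z: "trit_of x = Z \<longleftrightarrow> 3 dvd x"
  by (auto simp: trit_of_def Let_def dvd_eq_mod_eq_0)

lemma trit_of_cong: "x mod 3 = y mod 3 \<Longrightarrow> trit_of x = trit_of y"
  by (simp add: trit_of_def)

lemma trit_of_lin:
  "trit_of (y + c * r) = (case trit_of c of Z \<Rightarrow> trit_of y | P \<Rightarrow> tadd (trit_of y) (trit_of r)
     | M \<Rightarrow> tadd (trit_of y) (tneg (trit_of r)))"
proof -
  have *: "(y + c * r) mod 3 = (y mod 3 + (c mod 3) * (r mod 3)) mod 3"
    by (intro mod_add_cong mod_mult_cong) simp_all
  have m: "x mod 3 \<in> {0, 1, 2::int}" for x by (simp add: insert_iff) presburger
  have "\<forall>y\<in>{0,1,2}. \<forall>c\<in>{0,1,2}. \<forall>r\<in>{0,1,2}. trit_of (y + c * r) = (case trit_of c of Z \<Rightarrow> trit_of y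
     | P \<Rightarrow> tadd (trit_of y) (trit_of r) | M \<Rightarrow> tadd (trit_of y) (tneg (trit_of r)))"
    by (simp add: trit_of_def)
  then have "trit_of (y mod 3 + (c mod 3) * (r mod 3)) = (case trit_of (c mod 3) of Z \<Rightarrow> trit_of (y mod 3)
     | P \<Rightarrow> tadd (trit_of (y mod 3)) (trit_of (r mod 3)) | M \<Rightarrow> tadd (trit_of (y mod 3)) (tneg (trit_of (r mod 3))))"
    using m by blast
  moreover have "trit_of (y + c * r) = trit_of (y mod 3 + (c mod 3) * (r mod 3))"
    by (rule trit_of_cong) (rule *)
  moreover have "trit_of (x mod 3) = trit_of x" for x by (rule trit_of_cong) simp
  ultimately show ?thesis by (simp only:)
qed

lemma vadd_map: "vadd (map f xs) (map g xs) = map (\<lambda>x. tadd (f x) (g x)) xs"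
  by (induction xs) auto

lemma vsub_map: "vsub (map f xs) (map g xs) = map (\<lambda>x. tadd (f x) (tneg (g x))) xs"
  by (induction xs) auto

lemma tlin_tvec:
  "tlin (map (\<lambda>i. trit_of (a i)) is) (map (\<lambda>i. tvec (R i)) is) (tvec Y) =
     tvec (\<lambda>j. Y j + (\<Sum>i\<leftarrow>is. a i * R i j))"
proof (induction "is" arbitrary: Y)
  case Nil then show ?case by simp
next
  case (Cons i "is")
  have "(case trit_of (a i) of Z \<Rightarrow> tvec Y | P \<Rightarrow> vadd (tvec Y) (tvec (R i)) | M \<Rightarrow> vsub (tvec Y) (tvec (R i)))
      = tvec (\<lambda>j. Y j + a i * R i j)"
    by (cases "trit_of (a i)") (simp_all add: tvec_def vadd_map vsub_map trit_of_lin)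
  then show ?case using Cons.IH[of "\<lambda>j. Y j + a i * R i j"] by (simp add: add.assoc)
qed

definition supp3 :: "nat \<Rightarrow> (nat \<Rightarrow> int) \<Rightarrow> nat set" where
  "supp3 n f = {j. j < n \<and> \<not> 3 dvd f j}"

lemma finite_supp3 [simp]: "finite (supp3 n f)" by (simp add: supp3_def)

lemma twt_tvec: "twt (tvec f) = card (supp3 24 f)"
proof -
  have "twt (tvec f) = card (set (filter (\<lambda>j. \<not> 3 dvd f j) [0..<24]))"
    by (subst distinct_card) (simp_all add: twt_def tvec_def filter_map o_def trit_of_eq_Z)
  also have "set (filter (\<lambda>j. \<not> 3 dvd f j) [0..<24]) = supp3 24 f" by (auto simp: supp3_def)
  finally show ?thesis .
qed

lemma twt_map_trit_of: "distinct is \<Longrightarrow> twt (map (\<lambda>i. trit_of (a i)) is) = card {i \<in> set is. \<not> 3 dvd a i}"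
proof -
  assume d: "distinct is"
  have "twt (map (\<lambda>i. trit_of (a i)) is) = card (set (filter (\<lambda>j. \<not> 3 dvd a j) is))"
    using d by (subst distinct_card) (simp_all add: twt_def filter_map o_def trit_of_eq_Z)
  also have "set (filter (\<lambda>j. \<not> 3 dvd a j) is) = {i \<in> set is. \<not> 3 dvd a i}" by auto
  finally show ?thesis .
qed

lemma heavy_combs_row01: "heavy_combs 5 [tvec (S 0)] (tvec (S 1))" "heavy_combs 5 [] (tvec (S 0))"
  by code_simp+

text \<open>The main computation. Rows 1 and 2 are present, row 1 with coefficient 1 after a change
  of sign; up to four of the other 22 rows are added. Some 12000 signed triples of rows are visited,
  and a fourth row is tried only on sums of weight at least 17.\<close>

lemma heavy_combs_rows_add:
  "heavy_combs 4 (map (\<lambda>i. tvec (S i)) (0 # [3..<24])) (vadd (tvec (S 1)) (tvec (S 2)))"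
  by code_simp

lemma heavy_combs_rows_sub:
  "heavy_combs 4 (map (\<lambda>i. tvec (S i)) (0 # [3..<24])) (vsub (tvec (S 1)) (tvec (S 2)))"
  by code_simp

text \<open>Skewness reflects that -1 is not a square mod 23. The product identity gives the rows
  \<open>(e_i | S_i)\<close> squared length 24 and mutual inner products 0, so the code is
  self-orthogonal mod 3.\<close>

lemma S_table:
  "list_all (\<lambda>i. list_all (\<lambda>j. S i j = - S j i \<and> (\<Sum>k\<leftarrow>[0..<24]. S i k * S k j) = (if i = j then - 23 else 0)) [0..<24]) [0..<24]"
  by code_simp

text \<open>The residues listed in \<open>chi\<close> are the nonzero squares mod 23, so
  \<open>chi\<close> is the quadratic character; only its invariance under multiplication by squares
  is needed, for the affine symmetries.\<close>

lemma chi_square_table: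
  "list_all (\<lambda>r. chi r = 1 \<longrightarrow> list_all (\<lambda>x. chi (r * x) = chi x) [0..22]) [0..22]"
  by code_simp

lemma S_off_diagonal:
  "list_all (\<lambda>i. list_all (\<lambda>j. S i j = 0 \<and> i = j \<or> i \<noteq> j \<and> (S i j = 1 \<or> S i j = -1)) [0..<24]) [0..<24]"
  by code_simp

lemma S_skew: "S j i = - S i j"
  and S_square: "(\<Sum>k<24. S i k * S k j) = (if i = j then - 23 else 0)" if "i < 24" "j < 24"
proof -
  have "i \<in> set [0..<24]" "j \<in> set [0..<24]" using that by auto
  then have *: "S j i = - S i j \<and> (\<Sum>k\<leftarrow>[0..<24]. S j k * S k i) = (if j = i then - 23 else 0) \<and>
      (\<Sum>k\<leftarrow>[0..<24]. S i k * S k j) = (if i = j then - 23 else 0)"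
    using S_table unfolding list_all_iff by blast
  then show "S j i = - S i j" by blast
  from * show "(\<Sum>k<24. S i k * S k j) = (if i = j then - 23 else 0)"
    by (simp add: interv_sum_list_conv_sum_set_nat atLeast0LessThan)
qed

lemma S_entries:
  assumes "i < 24" "j < 24" shows "S i j = 0 \<and> i = j \<or> i \<noteq> j \<and> (S i j = 1 \<or> S i j = - 1)"
proof -
  have "i \<in> set [0..<24]" "j \<in> set [0..<24]" using assms by auto
  then show ?thesis using S_off_diagonal unfolding list_all_iff by blast
qed

lemma S_diag: "i < 24 \<Longrightarrow> S i i = 0"
  and S_offdiag: "i < 24 \<Longrightarrow> j < 24 \<Longrightarrow> i \<noteq> j \<Longrightarrow> S i j = 1 \<or> S i j = - 1"
  using S_entries by blast+

section \<open>Symmetries of the code and its minimum weight\<close>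

lemma chi_mod: "chi (x mod 23) = chi x" by (simp add: chi_def)

lemma chi_mult_square: assumes "chi r = 1" shows "chi (r * x) = chi x"
proof -
  have r: "r mod 23 \<in> set [0..22]" and x: "x mod 23 \<in> set [0..22]" by auto
  have "chi ((r mod 23) * (x mod 23)) = chi (x mod 23)"
  proof -
    have "chi (r mod 23) = 1" using assms chi_mod by simp
    then show ?thesis using chi_square_table r x unfolding list_all_iff by blast
  qed
  moreover have "chi ((r mod 23) * (x mod 23)) = chi (r * x)" by (metis chi_mod mod_mult_eq)
  ultimately show ?thesis by (simp add: chi_mod)
qed

text \<open>The right half of the codeword with left half \<open>a\<close>. Integers stand for
  residues mod 3, so that the same function applies to lattice coordinates.\<close>

definition aS :: "(nat \<Rightarrow> int) \<Rightarrow> nat \<Rightarrow> int" where "aS a j = (\<Sum>i<24. a i * S i j)"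

lemma aS_aS: assumes "j < 24" shows "aS (aS a) j = - 23 * a j"
proof -
  have "aS (aS a) j = (\<Sum>k<24. \<Sum>i<24. a i * (S i k * S k j))"
    by (simp add: aS_def sum_distrib_right mult.assoc)
  also have "\<dots> = (\<Sum>i<24. \<Sum>k<24. a i * (S i k * S k j))" by (rule sum.swap)
  also have "\<dots> = (\<Sum>i<24. a i * (if i = j then - 23 else 0))"
    using assms by (intro sum.cong refl) (simp add: sum_distrib_left[symmetric] S_square)
  also have "\<dots> = - 23 * a j" using assms by (simp add: if_distrib sum.delta cong: if_cong)
  finally show ?thesis .
qed

definition code_wt :: "(nat \<Rightarrow> int) \<Rightarrow> nat" where
  "code_wt a = card (supp3 24 a) + card (supp3 24 (aS a))"

lemma supp3_cong: "(\<And>j. j < n \<Longrightarrow> f j mod 3 = g j mod 3) \<Longrightarrow> supp3 n f = supp3 n g"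
  unfolding supp3_def by (auto simp: dvd_eq_mod_eq_0)

lemma aS_cong3:
  assumes "\<And>i. i < 24 \<Longrightarrow> a i mod 3 = b i mod 3" shows "aS a j mod 3 = aS b j mod 3"
proof -
  have "aS a j mod 3 = (\<Sum>i<24. (a i * S i j) mod 3) mod 3" by (simp add: aS_def mod_sum_eq)
  also have "\<dots> = (\<Sum>i<24. (b i * S i j) mod 3) mod 3"
  proof -
    have "(a i * S i j) mod 3 = (b i * S i j) mod 3" if "i < 24" for i
      using assms[OF that] by (rule mod_mult_cong) simp
    then show ?thesis by (metis (no_types, lifting) lessThan_iff sum.cong)
  qed
  also have "\<dots> = aS b j mod 3" by (simp add: aS_def mod_sum_eq)
  finally show ?thesis .
qed

lemma code_wt_cong3: "(\<And>i. i < 24 \<Longrightarrow> a i mod 3 = b i mod 3) \<Longrightarrow> code_wt a = code_wt b"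
  unfolding code_wt_def by (metis supp3_cong aS_cong3)

text \<open>Since -23 is 1 mod 3, \<open>S\<close> maps the right half back to the left half: the
  halves of a codeword can be exchanged. Hence a word of weight at most 12 may be assumed to have at
  most six nonzero symbols on the left.\<close>

lemma code_wt_swap: "code_wt (aS a) = code_wt a"
proof -
  have "aS (aS a) j mod 3 = a j mod 3" if "j < 24" for j
  proof -
    have "- 23 * a j mod 3 = a j mod 3" by presburger
    then show ?thesis using aS_aS[OF that] by simp
  qed
  then show ?thesis unfolding code_wt_def using supp3_cong by (metis add.commute)
qed

lemma code_wt_uminus: "code_wt (\<lambda>i. - a i) = code_wt a"
  by (simp add: code_wt_def supp3_def aS_def sum_negf)

lemma card_supp3_reindex:
  assumes p: "bij_betw p {..<n} {..<n}" shows "card (supp3 n (\<lambda>i. f (p i))) = card (supp3 n f)"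
proof -
  have "supp3 n f = p ` supp3 n (\<lambda>i. f (p i))"
  proof (intro subset_antisym subsetI)
    fix j assume j: "j \<in> supp3 n f"
    then obtain i where "i < n" "j = p i" using p by (auto simp: supp3_def bij_betw_def)
    then show "j \<in> p ` supp3 n (\<lambda>i. f (p i))" using j by (auto simp: supp3_def)
  qed (use p in \<open>auto simp: supp3_def bij_betw_def\<close>)
  moreover have "inj_on p (supp3 n (\<lambda>i. f (p i)))"
    using p by (auto simp: supp3_def bij_betw_def intro: inj_on_subset)
  ultimately show ?thesis by (simp add: card_image)
qed

lemma code_wt_reindex:
  assumes p: "bij_betw p {..<24} {..<24}"
    and S: "\<And>i j. i < 24 \<Longrightarrow> j < 24 \<Longrightarrow> S (p i) (p j) = S i j"
  shows "code_wt (\<lambda>i. a (p i)) = code_wt a"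
proof -
  have "aS (\<lambda>i. a (p i)) j = aS a (p j)" if "j < 24" for j
  proof -
    have "aS (\<lambda>i. a (p i)) j = (\<Sum>i<24. a (p i) * S (p i) (p j))"
      unfolding aS_def using S that by (intro sum.cong) auto
    also have "\<dots> = (\<Sum>i<24. a i * S i (p j))" by (rule sum.reindex_bij_betw[OF p])
    finally show ?thesis by (simp add: aS_def)
  qed
  then have "supp3 24 (aS (\<lambda>i. a (p i))) = supp3 24 (\<lambda>j. aS a (p j))" by (intro supp3_cong) auto
  then show ?thesis unfolding code_wt_def by (simp add: card_supp3_reindex[OF p])
qed

text \<open>An index \<open>i > 0\<close> stands for the field element \<open>i - 1\<close>, and 0
  for the point at infinity, which stays fixed. This is the map x to u + r x; it sends the indices 1
  and 2 to the elements u and u + r.\<close>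

definition affine_perm :: "int \<Rightarrow> int \<Rightarrow> nat \<Rightarrow> nat" where
  "affine_perm u r i = (if i = 0 then 0 else nat ((u + r * (int i - 1)) mod 23) + 1)"

lemma affine_perm:
  assumes "chi r = 1"
  shows "bij_betw (affine_perm u r) {..<24} {..<24}"
    and "\<And>i j. i < 24 \<Longrightarrow> j < 24 \<Longrightarrow> S (affine_perm u r i) (affine_perm u r j) = S i j"
proof -
  let ?z = "\<lambda>i. (u + r * (int i - 1)) mod 23"
  have z: "0 \<le> ?z i" "?z i < 23" for i by simp_all
  have r0: "\<not> 23 dvd r" using assms by (auto simp: chi_def dvd_eq_mod_eq_0)
  have lt: "affine_perm u r i < 24" for i
    using z[of i] by (auto simp: affine_perm_def)
  have "inj_on (affine_perm u r) {..<24}"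
  proof (rule inj_onI)
    fix i j assume ij: "i \<in> {..<24}" "j \<in> {..<24}" and eq: "affine_perm u r i = affine_perm u r j"
    show "i = j"
    proof (cases "i = 0 \<or> j = 0")
      case True then show ?thesis using eq by (auto simp: affine_perm_def split: if_splits)
    next
      case False
      then have "nat (?z i) = nat (?z j)" using eq by (simp add: affine_perm_def)
      then have "?z i = ?z j" using z(1) by (metis nat_0_le)
      then have "23 dvd (u + r * (int i - 1)) - (u + r * (int j - 1))" by (rule mod_eq_dvd_iff[THEN iffD1])
      then have "23 dvd r * (int i - int j)" by (simp add: algebra_simps)
      moreover have "prime (23::int)" by simp
      ultimately have "23 dvd int i - int j" using r0 prime_dvd_mult_iff by blast
      moreover have "\<bar>int i - int j\<bar> < 23" using ij False by auto
      ultimately have "int i - int j = 0" using dvd_imp_le_int[of "int i - int j" 23] by fastforce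
      then show ?thesis by simp
    qed
  qed
  then show "bij_betw (affine_perm u r) {..<24} {..<24}"
    using lt endo_inj_surj[of "{..<24}" "affine_perm u r"] by (auto simp: bij_betw_def)
  fix i j :: nat
  show "S (affine_perm u r i) (affine_perm u r j) = S i j"
  proof (cases "i = 0 \<or> j = 0")
    case True then show ?thesis by (auto simp: S_def affine_perm_def)
  next
    case False
    have "S (affine_perm u r i) (affine_perm u r j) = chi (?z j - ?z i)"
      using False z by (simp add: S_def affine_perm_def)
    also have "\<dots> = chi (r * (int j - int i))"
      by (rule trans[OF chi_mod[symmetric]], rule trans[OF _ chi_mod])
         (simp add: mod_diff_eq algebra_simps)
    also have "\<dots> = S i j" using False assms by (simp add: chi_mult_square S_def)
    finally show ?thesis .
  qed
qed

lemma sum_list_rows: "(\<Sum>i<24. f i) = f 1 + f 2 + (\<Sum>i\<leftarrow>0 # [3..<24]. f i)" for f :: "nat \<Rightarrow> int"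
proof -
  have "(\<Sum>i<24. f i) = (\<Sum>i\<leftarrow>[0..<24]. f i)"
    by (simp add: interv_sum_list_conv_sum_set_nat atLeast0LessThan)
  also have "[0..<24] = [0, 1, 2] @ [3..<24]" by (simp add: upt_conv_Cons)
  finally show ?thesis by simp
qed

lemma row_weight: "i < 24 \<Longrightarrow> twt (tvec (S i)) = 23"
proof -
  assume i: "i < 24"
  have "supp3 24 (S i) = {..<24} - {i}"
    unfolding supp3_def using i S_diag[OF i] S_offdiag[OF i] by fastforce
  then show ?thesis using i by (simp add: twt_tvec)
qed

text \<open>Two of at most six left symbols are spent on rows 1 and 2, so the search runs with
  budget 4; its bound \<open>4 + 7\<close> and the two spent symbols make 13.\<close>

lemma code_wt_ge_aux:
  assumes a: "a 1 mod 3 = 1" "\<not> 3 dvd a 2" and six: "card (supp3 24 a) \<le> 6"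
  shows "13 \<le> code_wt a"
proof -
  let ?is = "0 # [3..<24]"
  let ?Y = "\<lambda>j. S 1 j + a 2 * S 2 j"
  let ?cs = "map (\<lambda>i. trit_of (a i)) ?is" and ?rs = "map (\<lambda>i. tvec (S i)) ?is"
  have d: "distinct ?is" by auto
  have supp: "supp3 24 a = {1, 2} \<union> {i \<in> set ?is. \<not> 3 dvd a i}"
    using a by (auto simp: supp3_def not_less) presburger+
  have card: "card (supp3 24 a) = 2 + twt ?cs"
    unfolding twt_map_trit_of[OF d] supp by (subst card_Un_disjoint) auto
  have lin: "tlin ?cs ?rs (tvec ?Y) = tvec (\<lambda>j. ?Y j + (\<Sum>i\<leftarrow>?is. a i * S i j))" by (rule tlin_tvec)
  have "twt (tlin ?cs ?rs (tvec ?Y)) = card (supp3 24 (aS a))"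
  proof -
    have "supp3 24 (\<lambda>j. ?Y j + (\<Sum>i\<leftarrow>?is. a i * S i j)) = supp3 24 (aS a)"
    proof (rule supp3_cong)
      fix j
      have "aS a j = a 1 * S 1 j + a 2 * S 2 j + (\<Sum>i\<leftarrow>?is. a i * S i j)"
        unfolding aS_def by (rule sum_list_rows)
      moreover have "(S 1 j) mod 3 = (a 1 * S 1 j) mod 3" using a(1) by (metis mod_mult_left_eq mult_1)
      ultimately show "(?Y j + (\<Sum>i\<leftarrow>?is. a i * S i j)) mod 3 = aS a j mod 3"
        by (metis (no_types, lifting) mod_add_cong)
    qed
    then show ?thesis unfolding lin twt_tvec by simp
  qed
  moreover have "4 + 7 \<le> twt (tlin ?cs ?rs (tvec ?Y)) + twt ?cs"
  proof (rule heavy_combs_imp)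
    have "trit_of (a 2) = P \<or> trit_of (a 2) = M" using a(2) trit_of_eq_Z by (cases "trit_of (a 2)") auto
    moreover have "tvec ?Y = (case trit_of (a 2) of Z \<Rightarrow> tvec (S 1) | P \<Rightarrow> vadd (tvec (S 1)) (tvec (S 2))
        | M \<Rightarrow> vsub (tvec (S 1)) (tvec (S 2)))"
      by (cases "trit_of (a 2)") (simp_all add: tvec_def vadd_map vsub_map trit_of_lin)
    ultimately show "heavy_combs 4 ?rs (tvec ?Y)" using heavy_combs_rows_add heavy_combs_rows_sub by auto
    show "twt ?cs \<le> 4" using card six by simp
    fix r assume "r \<in> set ?rs"
    then obtain i where i: "i \<in> set ?is" "r = tvec (S i)" unfolding set_map by blast
    then have "i < 24" by auto
    with i(2) show "length r = length (tvec ?Y) \<and> 23 \<le> twt r" by (simp add: row_weight) (simp add: tvec_def)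
  qed simp
  ultimately show ?thesis unfolding code_wt_def using card by linarith
qed

text \<open>The case beyond the reach of the affine maps: they fix infinity, so a support with at
  most one finite point offers no pair to be moved. One finite point can still be brought to index
  1.\<close>

lemma code_wt_ge_aux0:
  assumes a: "\<And>i. 2 \<le> i \<Longrightarrow> i < 24 \<Longrightarrow> 3 dvd a i" "\<not> (3 dvd a 0 \<and> 3 dvd a 1)"
  shows "13 \<le> code_wt a"
proof -
  have main: "13 \<le> code_wt b"
    if b: "\<And>i. 2 \<le> i \<Longrightarrow> i < 24 \<Longrightarrow> 3 dvd b i" "b 1 mod 3 = 1 \<or> 3 dvd b 1 \<and> b 0 mod 3 = 1" for b
  proof -
    have z: "b i * S i j mod 3 = 0" if "2 \<le> i" "i < 24" for i j
      using b(1)[OF that] by (simp add: dvd_eq_mod_eq_0[symmetric])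
    have aSb: "aS b j mod 3 = (b 1 * S 1 j + b 0 * S 0 j) mod 3" for j
    proof -
      have "(\<Sum>i<24. b i * S i j) = b 0 * S 0 j + b 1 * S 1 j + (\<Sum>i\<in>{2..<24}. b i * S i j)"
      proof -
        have "{..<24::nat} = {0, 1} \<union> {2..<24}" by auto
        then show ?thesis by (simp add: sum.union_disjoint)
      qed
      moreover have "3 dvd (\<Sum>i\<in>{2..<24}. b i * S i j)"
        by (rule dvd_sum) (use z in \<open>auto simp: dvd_eq_mod_eq_0\<close>)
      ultimately show ?thesis unfolding aS_def by (simp add: dvd_eq_mod_eq_0) presburger
    qed
    from b(2) show ?thesis
    proof
      assume b1: "b 1 mod 3 = 1"
      let ?cs = "[trit_of (b 0)]"
      have sup: "supp3 24 b = {1} \<union> {i\<in>set [0]. \<not> 3 dvd b i}"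
      proof -
        have "\<not> 3 dvd b 1" using b1 by presburger
        moreover have "i = 0 \<or> i = 1" if "i < 24" "\<not> 3 dvd b i" for i using b(1)[of i] that by linarith
        ultimately show ?thesis by (auto simp: supp3_def)
      qed
      have c: "card (supp3 24 b) = 1 + twt ?cs"
        using twt_map_trit_of[of "[0]" b] unfolding sup by (simp add: card_insert_if)
      have "tlin ?cs [tvec (S 0)] (tvec (S 1)) = tvec (\<lambda>j. S 1 j + b 0 * S 0 j)"
        using tlin_tvec[of b "[0]" S "S 1"] by simp
      moreover have "supp3 24 (\<lambda>j. S 1 j + b 0 * S 0 j) = supp3 24 (aS b)"
      proof (rule supp3_cong)
        fix j
        have "(S 1 j) mod 3 = (b 1 * S 1 j) mod 3" using b1 by (metis mod_mult_left_eq mult_1)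
        then show "(S 1 j + b 0 * S 0 j) mod 3 = aS b j mod 3" unfolding aSb by (rule mod_add_cong) simp
      qed
      ultimately have "twt (tlin ?cs [tvec (S 0)] (tvec (S 1))) = card (supp3 24 (aS b))"
        by (simp add: twt_tvec)
      moreover have "5 + 7 \<le> twt (tlin ?cs [tvec (S 0)] (tvec (S 1))) + twt ?cs"
      proof (rule heavy_combs_imp[OF heavy_combs_row01(1)])
        show "twt ?cs \<le> 5" by (cases "trit_of (b 0)") auto
      qed (auto simp: row_weight, auto simp: tvec_def)
      ultimately show ?thesis unfolding code_wt_def using c by linarith
    next
      assume b0: "3 dvd b 1 \<and> b 0 mod 3 = 1"
      have "supp3 24 (S 0) = supp3 24 (aS b)"
      proof (rule supp3_cong)
        fix j
        have "(b 0 * S 0 j) mod 3 = S 0 j mod 3" using b0 by (metis mod_mult_left_eq mult_1)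
        moreover have "(b 1 * S 1 j) mod 3 = 0" using b0 by (simp add: dvd_eq_mod_eq_0[symmetric])
        ultimately show "S 0 j mod 3 = aS b j mod 3" unfolding aSb by presburger
      qed
      then have "card (supp3 24 (aS b)) = 23" using row_weight[of 0] by (simp add: twt_tvec)
      then show ?thesis by (simp add: code_wt_def)
    qed
  qed
  show ?thesis
  proof (cases "a 1 mod 3 = 1 \<or> 3 dvd a 1 \<and> a 0 mod 3 = 1")
    case True then show ?thesis using main a(1) by blast
  next
    case False
    then have "(- a 1) mod 3 = 1 \<or> 3 dvd - a 1 \<and> (- a 0) mod 3 = 1"
      using a(2) by presburger
    then have "13 \<le> code_wt (\<lambda>i. - a i)" using a(1) by (intro main) auto
    then show ?thesis by (simp add: code_wt_uminus)
  qed
qed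

text \<open>By affine symmetry two nonzero coordinates at finite points can be moved to the points 0 and 1.\<close>

lemma code_wt_ge_small:
  assumes "card (supp3 24 a) \<le> 6" "supp3 24 a \<noteq> {}" shows "13 \<le> code_wt a"
proof -
  have move: "\<exists>b. code_wt b = code_wt a \<and> card (supp3 24 b) = card (supp3 24 a) \<and> (\<forall>i<24. b i = a (affine_perm u r i))"
    if "chi r = 1" for u r
  proof -
    let ?p = "affine_perm u r"
    have "card (supp3 24 (\<lambda>i. a (?p i))) = card (supp3 24 a)"
      by (rule card_supp3_reindex[OF affine_perm(1)[OF that]])
    then show ?thesis using code_wt_reindex[OF affine_perm[OF that, where u=u], of a]
      by (intro exI[of _ "\<lambda>i. a (?p i)"]) auto
  qed
  show ?thesis
  proof (cases "\<exists>p q. p \<noteq> q \<and> p \<noteq> 0 \<and> q \<noteq> 0 \<and> p \<in> supp3 24 a \<and> q \<in> supp3 24 a")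
    case True
    then obtain p q where pq: "p \<noteq> q" "p \<noteq> 0" "q \<noteq> 0" "p \<in> supp3 24 a" "q \<in> supp3 24 a" by blast
    have "p < 24" "q < 24" using pq by (auto simp: supp3_def)
    \<comment> \<open>Skewness: exactly one of the two differences of \<open>p\<close> and
      \<open>q\<close> is a square. Ordering the pair accordingly makes the multiplier of the affine
      map a square, as the symmetry of \<open>S\<close> requires.\<close>
    then have "S p q = 1 \<or> S q p = 1" using S_offdiag[of p q] S_skew[of p q] pq(1) by auto
    then obtain p q where pq: "p \<noteq> 0" "q \<noteq> 0" "p \<in> supp3 24 a" "q \<in> supp3 24 a" "S p q = 1"
      using pq by metis
    let ?p = "affine_perm (int p - 1) (int q - int p)"
    have chi: "chi (int q - int p) = 1" using pq by (simp add: S_def)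
    obtain b where b: "code_wt b = code_wt a" "card (supp3 24 b) = card (supp3 24 a)"
      "\<And>i. i < 24 \<Longrightarrow> b i = a (?p i)" using move[OF chi] by blast
    have "?p 1 = p" "?p 2 = q" using pq by (auto simp: affine_perm_def supp3_def)
    then have b12: "\<not> 3 dvd b 1" "\<not> 3 dvd b 2" using b(3)[of 1] b(3)[of 2] pq by (auto simp: supp3_def)
    have "13 \<le> code_wt b"
    proof (cases "b 1 mod 3 = 1")
      case True then show ?thesis using code_wt_ge_aux b12 b(2) assms(1) by simp
    next
      case False
      then have "(- b 1) mod 3 = 1" using b12 by presburger
      moreover have "supp3 24 (\<lambda>i. - b i) = supp3 24 b" by (simp add: supp3_def)
      ultimately have "13 \<le> code_wt (\<lambda>i. - b i)" using b12 b(2) assms(1) by (intro code_wt_ge_aux) auto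
      then show ?thesis by (simp add: code_wt_uminus)
    qed
    then show ?thesis using b by simp
  next
    case False
    show ?thesis
    proof (cases "\<exists>p. p \<noteq> 0 \<and> p \<in> supp3 24 a")
      case True
      then obtain p where p: "p \<noteq> 0" "p \<in> supp3 24 a" by blast
      let ?p = "affine_perm (int p - 1) 1"
      have chi1: "chi 1 = 1" by (simp add: chi_def)
      obtain b where b: "code_wt b = code_wt a" "card (supp3 24 b) = card (supp3 24 a)"
        "\<And>i. i < 24 \<Longrightarrow> b i = a (?p i)" using move[OF chi1] by blast
      have p1: "?p 1 = p" using p by (auto simp: affine_perm_def supp3_def)
      have inj: "inj_on ?p {..<24}" "?p ` {..<24} = {..<24}" using affine_perm(1)[OF chi1] by (auto simp: bij_betw_def)
      have "3 dvd b i" if "2 \<le> i" "i < 24" for i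
      proof (rule ccontr)
        assume "\<not> 3 dvd b i"
        moreover have "?p i < 24" using inj(2) that by auto
        ultimately have "?p i \<in> supp3 24 a" using b(3)[of i] that by (simp add: supp3_def)
        moreover have "?p i \<noteq> 0" using that by (simp add: affine_perm_def)
        moreover have "?p i \<noteq> p" using inj_onD[OF inj(1), of i 1] that p1 by auto
        ultimately show False using \<open>\<not> (\<exists>p q. _ p q)\<close> p by blast
      qed
      moreover have "\<not> 3 dvd b 1" using b(3)[of 1] p1 p by (simp add: supp3_def)
      ultimately have "13 \<le> code_wt b" by (intro code_wt_ge_aux0) auto
      then show ?thesis using b by simp
    next
      case False
      then have "supp3 24 a \<subseteq> {0}" by blast
      then show ?thesis using assms(2) by (intro code_wt_ge_aux0) (auto simp: supp3_def)
    qed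
  qed
qed

lemma code_wt_ge_13:
  assumes "i < 24" "\<not> 3 dvd a i" shows "13 \<le> code_wt a"
proof (rule ccontr)
  assume small: "\<not> 13 \<le> code_wt a"
  have ne: "supp3 24 a \<noteq> {}" using assms by (auto simp: supp3_def)
  show False
  proof (cases "card (supp3 24 a) \<le> 6")
    case True then show False using code_wt_ge_small ne small by blast
  next
    case False
    then have s: "card (supp3 24 (aS a)) \<le> 6" using small by (simp add: code_wt_def)
    have "supp3 24 (aS a) \<noteq> {}"
    proof
      assume "supp3 24 (aS a) = {}"
      then have "aS a j mod 3 = 0 mod 3" if "j < 24" for j using that by (auto simp: supp3_def dvd_eq_mod_eq_0)
      then have "aS (aS a) i mod 3 = aS (\<lambda>_. 0) i mod 3" by (intro aS_cong3) auto
      then have "- 23 * a i mod 3 = 0" using aS_aS[OF assms(1)] by (simp add: aS_def)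
      then show False using assms(2) by presburger
    qed
    then show False using code_wt_ge_small[OF s] small by (simp add: code_wt_swap)
  qed
qed

lemma dvd3_square_mod: "(x::int)\<^sup>2 mod 3 = (if 3 dvd x then 0 else 1)"
proof -
  have "x mod 3 = 0 \<or> x mod 3 = 1 \<or> x mod 3 = 2" by presburger
  moreover have e: "x\<^sup>2 mod 3 = (x mod 3) * (x mod 3) mod 3" by (simp add: power2_eq_square mod_mult_eq)
  have "x\<^sup>2 mod 3 = r * r mod 3" if "x mod 3 = r" for r using e unfolding that .
  moreover note this[of 0] this[of 1] this[of 2]
  ultimately show ?thesis by (elim disjE) (simp_all add: dvd_eq_mod_eq_0)
qed

lemma sum_squares_mod3: "(\<Sum>i<n. (f i)\<^sup>2) mod 3 = int (card (supp3 n f)) mod 3"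
proof -
  have "(\<Sum>i<n. (f i)\<^sup>2) mod 3 = (\<Sum>i<n. (f i)\<^sup>2 mod 3) mod 3" by (simp add: mod_sum_eq)
  also have "(\<Sum>i<n. (f i)\<^sup>2 mod 3) = (\<Sum>i<n. if \<not> 3 dvd f i then 1 else 0)"
    by (intro sum.cong refl) (simp add: dvd3_square_mod)
  also have "\<dots> = int (card (supp3 n f))"
  proof -
    have "{..<n} \<inter> {i. \<not> 3 dvd f i} = supp3 n f" by (auto simp: supp3_def)
    then show ?thesis by (simp add: sum.If_cases)
  qed
  finally show ?thesis .
qed

lemma aS_adjoint: "(\<Sum>j<24. aS a j * b j) = - (\<Sum>i<24. a i * aS b i)"
proof -
  have "(\<Sum>j<24. aS a j * b j) = (\<Sum>j<24. \<Sum>i<24. a i * S i j * b j)" by (simp add: aS_def sum_distrib_right)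
  also have "\<dots> = (\<Sum>i<24. \<Sum>j<24. a i * S i j * b j)" by (rule sum.swap)
  also have "\<dots> = (\<Sum>i<24. \<Sum>j<24. - (a i * (b j * S j i)))"
  proof (intro sum.cong refl)
    fix i j :: nat assume "i \<in> {..<24}" "j \<in> {..<24}"
    then show "a i * S i j * b j = - (a i * (b j * S j i))" using S_skew[of j i] by (simp add: algebra_simps)
  qed
  also have "\<dots> = - (\<Sum>i<24. a i * aS b i)" by (simp add: aS_def sum_distrib_left sum_negf)
  finally show ?thesis .
qed

text \<open>Mod 3 the weight is the sum of the squares of the coordinates. Multiplication by
  \<open>S\<close> scales squared length by 23, so the word \<open>(a | aS a)\<close> has 24 times
  the squared length of \<open>a\<close>.\<close>

lemma three_dvd_code_wt: "3 dvd code_wt a"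
proof -
  have "(\<Sum>j<24. (aS a j)\<^sup>2) = - (\<Sum>i<24. a i * aS (aS a) i)"
    using aS_adjoint[of a "aS a"] by (simp add: power2_eq_square)
  also have "\<dots> = 23 * (\<Sum>i<24. (a i)\<^sup>2)"
    by (simp add: aS_aS sum_distrib_left sum_negf power2_eq_square algebra_simps)
  finally have e: "(\<Sum>j<24. (aS a j)\<^sup>2) = 23 * (\<Sum>i<24. (a i)\<^sup>2)" .
  have "int (code_wt a) mod 3 = ((\<Sum>i<24. (a i)\<^sup>2) mod 3 + (\<Sum>j<24. (aS a j)\<^sup>2) mod 3) mod 3"
    unfolding code_wt_def sum_squares_mod3 by (simp add: mod_add_eq)
  also have "\<dots> = 0" unfolding e by presburger
  finally have "int 3 dvd int (code_wt a)" by (simp add: dvd_eq_mod_eq_0)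
  then show ?thesis by (simp only: int_dvd_int_iff)
qed

definition coord :: "(nat \<Rightarrow> int) \<Rightarrow> nat \<Rightarrow> int" where
  "coord a j = (if j < 24 then a j else aS a (j - 24))"

lemma code_wt_eq: "code_wt a = card (supp3 48 (coord a))"
proof -
  have "supp3 48 (coord a) = supp3 24 a \<union> (+) 24 ` supp3 24 (aS a)"
  proof (intro subset_antisym subsetI)
    fix j assume j: "j \<in> supp3 48 (coord a)"
    show "j \<in> supp3 24 a \<union> (+) 24 ` supp3 24 (aS a)"
    proof (cases "j < 24")
      case True then show ?thesis using j by (auto simp: supp3_def coord_def)
    next
      case False
      then have "j - 24 \<in> supp3 24 (aS a)" "j = 24 + (j - 24)" using j by (auto simp: supp3_def coord_def)
      then show ?thesis by blast
    qed
  qed (auto simp: supp3_def coord_def)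
  moreover have "supp3 24 a \<inter> (+) 24 ` supp3 24 (aS a) = {}" by (auto simp: supp3_def)
  ultimately show ?thesis by (simp add: card_Un_disjoint card_image code_wt_def)
qed

section \<open>Characters mod 3 and moments of the weight distribution\<close>

definition char3 :: "int \<Rightarrow> complex" where "char3 n = cis (2 * pi / 3 * of_int n)"

lemma char3_add: "char3 (m + n) = char3 m * char3 n" 
  unfolding char3_def cis_mult by (simp add: algebra_simps add_divide_distrib)
lemma char3_0 [simp]: "char3 0 = 1" by (simp add: char3_def)
lemma char3_sum: "finite I \<Longrightarrow> char3 (\<Sum>i\<in>I. f i) = (\<Prod>i\<in>I. char3 (f i))"
  by (induction I rule: finite_induct) (simp_all add: char3_add)

lemma char3_1: "char3 1 = Complex (- 1 / 2) (sqrt 3 / 2)"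
  by (simp add: char3_def complex_eq_iff cos_120 sin_120)
lemma char3_2: "char3 2 = Complex (- 1 / 2) (- sqrt 3 / 2)"
proof -
  have "char3 2 = char3 1 * char3 1" using char3_add[of 1 1] by simp
  then show ?thesis by (simp add: char3_1 complex_eq_iff)
qed
lemma char3_mod: "char3 n = char3 (n mod 3)"
proof -
  have *: "char3 (3 * k) = 1" for k
  proof -
    have "2 * pi / 3 * of_int (3 * k) = 2 * pi * of_int k" by simp
    moreover have "cis (2 * pi * of_int k) = 1" by (rule cis_multiple_2pi) simp
    ultimately show ?thesis unfolding char3_def by (simp only:)
  qed
  have "char3 (3 * (n div 3) + n mod 3) = char3 (n mod 3)" by (simp only: char3_add * mult_1_left)
  then show ?thesis by simp
qed

lemma mod3: "(n::int) mod 3 = 0 \<or> n mod 3 = 1 \<or> n mod 3 = 2" by presburger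

text \<open>Fourier expansion of the indicator of nonzero residues; the constant term 2/3 is their
  proportion.\<close>

lemma indicator_char3: "(if 3 dvd n then 0 else 1) = (\<Sum>s\<in>{0,1,2}. (if s = 0 then 2/3 else - 1/3) * char3 (s * n))"
proof -
  have "char3 (2 * n) = char3 (2 * (n mod 3))" by (metis char3_mod mod_mult_right_eq)
  then show ?thesis using mod3[of n] char3_mod[of n]
    by (auto simp: dvd_eq_mod_eq_0 char3_1 char3_2 complex_eq_iff char3_mod[of 4])
qed

lemma sum_char3: "(\<Sum>x\<in>{0,1,2}. char3 (x * n)) = (if 3 dvd n then 3 else 0)"
proof -
  have "char3 (2 * n) = char3 (2 * (n mod 3))" by (metis char3_mod mod_mult_right_eq)
  then show ?thesis using mod3[of n] char3_mod[of n]
    by (auto simp: dvd_eq_mod_eq_0 char3_1 char3_2 complex_eq_iff char3_mod[of 4])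
qed

definition words :: "(nat \<Rightarrow> int) set" where "words = PiE {..<24} (\<lambda>_. {0, 1, 2})"

lemma finite_words [simp]: "finite words" unfolding words_def by (intro finite_PiE) auto

lemma card_words: "card words = 3 ^ 24"
proof -
  have "card {0, 1, 2::int} = 3" by simp
  moreover have "card words = (\<Prod>i<24::nat. card {0, 1, 2::int})" unfolding words_def by (rule card_PiE) simp
  ultimately show ?thesis by (simp only: prod_constant card_lessThan)
qed

text \<open>The adjoint of \<open>coord\<close>, that is the syndrome: \<open>s\<close> is
  orthogonal to the code exactly if all these values vanish mod 3.\<close>

definition coordT :: "(nat \<Rightarrow> int) \<Rightarrow> nat \<Rightarrow> int" where
  "coordT s i = s i + (\<Sum>j<24. S i j * s (24 + j))"

lemma coord_pairing: "(\<Sum>j<48. s j * coord a j) = (\<Sum>i<24. a i * coordT s i)"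
proof -
  have "(\<Sum>j<48. s j * coord a j) = (\<Sum>j<24. s j * a j) + (\<Sum>j<24. s (24 + j) * aS a j)"
  proof -
    have "{..<48::nat} = {..<24} \<union> {24..<48}" by auto
    then have "(\<Sum>j<48. s j * coord a j) = (\<Sum>j<24. s j * coord a j) + (\<Sum>j\<in>{24..<48}. s j * coord a j)"
      by (simp add: sum.union_disjoint ivl_disj_int)
    moreover have "(\<Sum>j\<in>{24..<48}. s j * coord a j) = (\<Sum>j<24. s (24 + j) * aS a j)"
      by (rule sum.reindex_bij_witness[of _ "\<lambda>j. 24 + j" "\<lambda>j. j - 24"]) (auto simp: coord_def)
    ultimately show ?thesis by (simp add: coord_def)
  qed
  also have "(\<Sum>j<24. s (24 + j) * aS a j) = (\<Sum>j<24. \<Sum>i<24. a i * (S i j * s (24 + j)))"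
    by (simp add: aS_def sum_distrib_left algebra_simps)
  also have "\<dots> = (\<Sum>i<24. \<Sum>j<24. a i * (S i j * s (24 + j)))" by (rule sum.swap)
  finally show ?thesis by (simp add: coordT_def algebra_simps sum.distrib sum_distrib_left)
qed

text \<open>A vector orthogonal to the code mod 3 is itself a codeword, so it cannot be too light.\<close>

lemma coordT_nonzero:
  assumes "j < 48" "\<not> 3 dvd s j" "card (supp3 48 s) \<le> 12"
  shows "\<exists>i<24. \<not> 3 dvd coordT s i"
proof (rule ccontr)
  assume "\<not> ?thesis"
  then have z: "3 dvd coordT s i" if "i < 24" for i using that by blast
  define q where "q j = s (24 + j)" for j
  have sk: "(\<Sum>j<24. S i j * s (24 + j)) = - aS q i" if "i < 24" for i
  proof -
    have "(\<Sum>j<24. S i j * s (24 + j)) = (\<Sum>j<24. - (q j * S j i))"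
    proof (rule sum.cong[OF refl])
      fix j :: nat assume "j \<in> {..<24}"
      then show "S i j * s (24 + j) = - (q j * S j i)" using S_skew[of j i] that by (simp add: q_def)
    qed
    then show ?thesis by (simp add: aS_def sum_negf)
  qed
  have sq: "s i mod 3 = aS q i mod 3" if "i < 24" for i
    using z[OF that] unfolding coordT_def sk[OF that] by presburger
  have "supp3 24 s = supp3 24 (aS q)" by (rule supp3_cong) (rule sq)
  moreover have "supp3 48 s = supp3 24 s \<union> (+) 24 ` supp3 24 q"
  proof (intro subset_antisym subsetI)
    fix j assume j: "j \<in> supp3 48 s"
    show "j \<in> supp3 24 s \<union> (+) 24 ` supp3 24 q"
    proof (cases "j < 24")
      case True then show ?thesis using j by (auto simp: supp3_def)
    next
      case False
      then have "j - 24 \<in> supp3 24 q" "j = 24 + (j - 24)" using j by (auto simp: supp3_def q_def)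
      then show ?thesis by blast
    qed
  qed (auto simp: supp3_def q_def)
  moreover have "supp3 24 s \<inter> (+) 24 ` supp3 24 q = {}" by (auto simp: supp3_def)
  ultimately have c: "card (supp3 48 s) = code_wt q"
    by (simp add: card_Un_disjoint card_image code_wt_def)
  show False
  proof (cases "\<exists>i<24. \<not> 3 dvd q i")
    case True then show False using code_wt_ge_13 c assms(3) by fastforce
  next
    case False
    then have q0: "q i mod 3 = 0 mod 3" if "i < 24" for i using that by (auto simp: dvd_eq_mod_eq_0)
    then have "aS q i mod 3 = aS (\<lambda>_. 0) i mod 3" for i by (intro aS_cong3) auto
    then have "aS q i mod 3 = 0" for i by (simp add: aS_def)
    then have "s j mod 3 = 0" using sq[of j] q0[of "j - 24"] assms(1) by (cases "j < 24") (auto simp: q_def)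
    then show False using assms(2) by (simp add: dvd_eq_mod_eq_0)
  qed
qed

lemma sum_words_char3:
  "(\<Sum>a\<in>words. char3 (\<Sum>j<48. s j * coord a j)) = (if \<forall>i<24. 3 dvd coordT s i then 3 ^ 24 else 0)"
proof -
  have "(\<Sum>a\<in>words. char3 (\<Sum>j<48. s j * coord a j)) = (\<Sum>a\<in>words. \<Prod>i<24. char3 (a i * coordT s i))"
    by (simp add: coord_pairing char3_sum)
  also have "\<dots> = (\<Prod>i<24. \<Sum>x\<in>{0,1,2}. char3 (x * coordT s i))"
    unfolding words_def by (rule prod_sum_PiE[symmetric]) auto
  also have "\<dots> = (\<Prod>i<24. if 3 dvd coordT s i then 3 else 0)" by (simp only: sum_char3)
  also have "\<dots> = (if \<forall>i<24. 3 dvd coordT s i then 3 ^ 24 else 0)"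
    by (auto simp: prod_zero_iff intro!: prod_zero)
  finally show ?thesis .
qed

text \<open>Any 12 coordinates of a uniformly random codeword behave as independent uniform symbols.
  In the Fourier expansion a frequency \<open>s\<close> contributes only if it is orthogonal to the
  code; a nonzero one supported on \<open>J\<close> would be a codeword of weight at most 12, so the
  zero frequency alone survives.\<close>

lemma card_words_nonzero_on:
  assumes J: "J \<subseteq> {..<48}" "card J \<le> 12"
  shows "real (card {a\<in>words. J \<subseteq> supp3 48 (coord a)}) = (2/3) ^ card J * 3 ^ 24"
proof -
  have finJ: "finite J" using J(1) finite_subset by blast
  let ?k = "\<lambda>s::int. if s = 0 then 2/3 else - 1/3 :: complex"
  define ext where "ext s j = (if j \<in> J then s j else (0::int))" for s j
  have "of_nat (card {a\<in>words. J \<subseteq> supp3 48 (coord a)}) = (\<Sum>a\<in>words. \<Prod>j\<in>J. if 3 dvd coord a j then 0 else (1::complex))"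
  proof -
    have "(\<Prod>j\<in>J. if 3 dvd coord a j then 0 else (1::complex)) = (if J \<subseteq> supp3 48 (coord a) then 1 else 0)" for a
    proof (cases "J \<subseteq> supp3 48 (coord a)")
      case True
      then show ?thesis by (auto simp: supp3_def intro!: prod.neutral)
    next
      case False
      then have "\<exists>j\<in>J. 3 dvd coord a j" using J(1) by (auto simp: supp3_def)
      then show ?thesis using False finJ by (auto intro!: prod_zero)
    qed
    then show ?thesis by (simp add: sum.If_cases Int_def)
  qed
  also have "\<dots> = (\<Sum>a\<in>words. \<Prod>j\<in>J. \<Sum>s\<in>{0,1,2}. ?k s * char3 (s * coord a j))"
    by (simp only: indicator_char3)
  also have "\<dots> = (\<Sum>a\<in>words. \<Sum>s\<in>PiE J (\<lambda>_. {0,1,2}). \<Prod>j\<in>J. ?k (s j) * char3 (s j * coord a j))"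
    by (intro sum.cong refl prod_sum_PiE finJ) auto
  also have "\<dots> = (\<Sum>s\<in>PiE J (\<lambda>_. {0,1,2}). \<Sum>a\<in>words. \<Prod>j\<in>J. ?k (s j) * char3 (s j * coord a j))"
    by (rule sum.swap)
  also have "\<dots> = (\<Sum>s\<in>PiE J (\<lambda>_. {0,1,2}). (\<Prod>j\<in>J. ?k (s j)) * (\<Sum>a\<in>words. char3 (\<Sum>j<48. ext s j * coord a j)))"
  proof (intro sum.cong refl)
    fix s
    have "(\<Sum>j<48. ext s j * coord a j) = (\<Sum>j\<in>J. s j * coord a j)" for a
    proof -
      have "(\<Sum>j\<in>J. s j * coord a j) = (\<Sum>j\<in>J. ext s j * coord a j)" by (simp add: ext_def)
      also have "\<dots> = (\<Sum>j<48. ext s j * coord a j)" by (rule sum.mono_neutral_left) (use J(1) in \<open>auto simp: ext_def\<close>)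
      finally show ?thesis by simp
    qed
    then show "(\<Sum>a\<in>words. \<Prod>j\<in>J. ?k (s j) * char3 (s j * coord a j)) =
      (\<Prod>j\<in>J. ?k (s j)) * (\<Sum>a\<in>words. char3 (\<Sum>j<48. ext s j * coord a j))"
      by (simp add: prod.distrib char3_sum finJ sum_distrib_left)
  qed
  also have "\<dots> = (\<Sum>s\<in>PiE J (\<lambda>_. {0,1,2::int}). if s = restrict (\<lambda>_. 0) J then (2/3) ^ card J * 3 ^ 24 else 0)"
  proof (intro sum.cong refl)
    fix s assume s: "s \<in> PiE J (\<lambda>_. {0,1,2::int})"
    show "(\<Prod>j\<in>J. ?k (s j)) * (\<Sum>a\<in>words. char3 (\<Sum>j<48. ext s j * coord a j)) =
      (if s = restrict (\<lambda>_. 0) J then (2/3) ^ card J * 3 ^ 24 else 0)"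
    proof (cases "s = restrict (\<lambda>_. 0) J")
      case True
      then have "ext s = (\<lambda>_. 0)" by (auto simp: ext_def)
      then show ?thesis using True by (simp add: card_words)
    next
      case False
      have "\<exists>j\<in>J. s j \<noteq> 0"
      proof (rule ccontr)
        assume "\<not> (\<exists>j\<in>J. s j \<noteq> 0)"
        then have "s = restrict (\<lambda>_. 0) J" using PiE_arb[OF s] by (intro ext) (simp add: restrict_def)
        then show False using False by blast
      qed
      then obtain j where j: "j \<in> J" "s j \<noteq> 0" by blast
      have "s j \<in> {0,1,2}" using s j(1) by blast
      then have "\<not> 3 dvd ext s j" using j by (auto simp: ext_def)
      moreover have "card (supp3 48 (ext s)) \<le> 12"
        using card_mono[OF finJ, of "supp3 48 (ext s)"] J(2) by (force simp: supp3_def ext_def split: if_splits)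
      ultimately have "\<exists>i<24. \<not> 3 dvd coordT (ext s) i" using coordT_nonzero j(1) J(1) by blast
      then have "(\<Sum>a\<in>words. char3 (\<Sum>j<48. ext s j * coord a j)) = 0" by (auto simp: sum_words_char3)
      then show ?thesis using False by simp
    qed
  qed
  also have "\<dots> = (2/3) ^ card J * 3 ^ 24"
  proof -
    have "restrict (\<lambda>_. 0) J \<in> PiE J (\<lambda>_. {0,1,2::int})" by auto
    moreover have "finite (PiE J (\<lambda>_. {0,1,2::int}))" using finJ by (intro finite_PiE) auto
    ultimately show ?thesis by simp
  qed
  finally have "complex_of_real (real (card {a\<in>words. J \<subseteq> supp3 48 (coord a)})) = complex_of_real ((2/3) ^ card J * 3 ^ 24)"
    by simp
  then show ?thesis using of_real_eq_iff by blast
qed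

text \<open>Double counting of pairs of a codeword and a set of \<open>k\<close> coordinates at
  which it is nonzero.\<close>

lemma weight_moment:
  assumes "k \<le> 12"
  shows "(\<Sum>a\<in>words. real (code_wt a choose k)) = real (48 choose k) * (2/3) ^ k * 3 ^ 24"
proof -
  let ?J = "{J. J \<subseteq> {..<48::nat} \<and> card J = k}"
  have finJ: "finite ?J" by simp
  have "real (code_wt a choose k) = (\<Sum>J\<in>?J. if J \<subseteq> supp3 48 (coord a) then 1 else 0)" for a
  proof -
    have "{J. J \<subseteq> supp3 48 (coord a) \<and> card J = k} = ?J \<inter> {J. J \<subseteq> supp3 48 (coord a)}"
      by (auto simp: supp3_def)
    then have "code_wt a choose k = card (?J \<inter> {J. J \<subseteq> supp3 48 (coord a)})"
      unfolding code_wt_eq by (metis n_subsets finite_supp3)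
    then show ?thesis using finJ by (simp add: sum.If_cases)
  qed
  then have "(\<Sum>a\<in>words. real (code_wt a choose k)) = (\<Sum>a\<in>words. \<Sum>J\<in>?J. if J \<subseteq> supp3 48 (coord a) then 1 else 0)"
    by simp
  also have "\<dots> = (\<Sum>J\<in>?J. \<Sum>a\<in>words. if J \<subseteq> supp3 48 (coord a) then 1 else 0)" by (rule sum.swap)
  also have "\<dots> = (\<Sum>J\<in>?J. real (card {a\<in>words. J \<subseteq> supp3 48 (coord a)}))"
    by (simp add: sum.If_cases Int_def)
  also have "\<dots> = (\<Sum>J\<in>?J. (2/3) ^ k * 3 ^ 24)"
    using assms by (intro sum.cong refl) (auto simp: card_words_nonzero_on)
  also have "\<dots> = real (48 choose k) * (2/3) ^ k * 3 ^ 24"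
    by (simp add: n_subsets)
  finally show ?thesis .
qed

section \<open>Codewords of full weight\<close>

lemma distinct_full_words:
  "distinct (map (\<lambda>(i, s, e). tvec (full_word i s e)) (List.product [0..<24] (List.product [1, - 1] [1, - 1])))"
  by code_simp

text \<open>Coefficients, in the binomial basis, of a multiple of \<open>(w - 15) (w - 18) \<cdots> (w - 45)\<close>. Up to degree 11
  the binomial moments of the weights of codewords are those of uniformly random words, so
  averaging this polynomial over the code counts the words of weight 48.\<close>

definition test_coeffs :: "(nat \<times> int) list" where
  "test_coeffs = [(0, - 19586258055), (1, 6725292119), (2, - 2148281343), (3, 632223579), (4, - 169358163), (5, 40664715), (6, - 8576685), (7, 1545453), (8, - 228501), (9, 26001), (10, - 2025), (11, 81)]"

definition test_poly :: "nat \<Rightarrow> int" where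
  "test_poly w = (\<Sum>(k, c)\<leftarrow>test_coeffs. c * int (w choose k))"

lemmas binomial_eval = binomial_code fold_atLeastAtMost_nat.simps fact_numeral

text \<open>By its degree and these values, \<open>test_poly w\<close> is \<open>3 ^ 15\<close>
  times the binomial coefficient of \<open>w / 3 - 5\<close> over 11. So its value is
  \<open>3 ^ 15\<close> at 48, and \<open>- 1365 * 3 ^ 15\<close> at 0, where 1365 is 15 choose
  4.\<close>

lemma test_poly_values:
  "test_poly 0 = - 19586258055" "test_poly 48 = 14348907"
  "list_all (\<lambda>w. test_poly w = 0) [15, 18, 21, 24, 27, 30, 33, 36, 39, 42, 45]"
  by (simp_all add: test_poly_def test_coeffs_def binomial_eval)

lemma code_wt_cases:
  assumes "a \<in> words"
  shows "a = restrict (\<lambda>_. 0) {..<24} \<and> code_wt a = 0 \<or> code_wt a = 48 \<or>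
    code_wt a \<in> set [15, 18, 21, 24, 27, 30, 33, 36, 39, 42, 45]"
proof (cases "\<exists>i<24. \<not> 3 dvd a i")
  case True
  then have "13 \<le> code_wt a" using code_wt_ge_13 by blast
  moreover have "code_wt a \<le> 48"
    using card_mono[of "{..<48}" "supp3 48 (coord a)"] by (auto simp: code_wt_eq supp3_def)
  moreover obtain k where "code_wt a = 3 * k" using three_dvd_code_wt by (auto elim: dvdE)
  ultimately have k: "5 \<le> k" "k \<le> 16" "code_wt a = 3 * k" by auto
  then have "k = 5 \<or> k = 6 \<or> k = 7 \<or> k = 8 \<or> k = 9 \<or> k = 10 \<or> k = 11 \<or> k = 12 \<or> k = 13
      \<or> k = 14 \<or> k = 15 \<or> k = 16" by presburger
  then show ?thesis using k(3) by auto
next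
  case False
  have "a i = 0" if "i < 24" for i
  proof -
    have "a i \<in> {0, 1, 2}" using assms that by (auto simp: words_def)
    moreover have "3 dvd a i" using False that by blast
    ultimately show ?thesis by auto
  qed
  then have "a = restrict (\<lambda>_. 0) {..<24}" using assms by (auto simp: words_def PiE_iff extensional_def)
  moreover from this have "code_wt a = 0" by (simp add: code_wt_def supp3_def aS_def)
  ultimately show ?thesis by blast
qed

lemma card_weight_48: "card {a \<in> words. code_wt a = 48} = 96"
proof -
  let ?F = "{a \<in> words. code_wt a = 48}" and ?o = "restrict (\<lambda>_. 0) {..<24} :: nat \<Rightarrow> int"
  have o: "?o \<in> words" "?o \<notin> ?F" by (auto simp: words_def code_wt_def supp3_def aS_def)
  have "(\<Sum>a\<in>words. real_of_int (test_poly (code_wt a))) =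
      (\<Sum>(k, c)\<leftarrow>test_coeffs. of_int c * (\<Sum>a\<in>words. real (code_wt a choose k)))"
  proof -
    have "real_of_int (\<Sum>(k, c)\<leftarrow>L. c * int (w choose k)) = (\<Sum>(k, c)\<leftarrow>L. of_int c * real (w choose k))"
      for L and w :: nat by (induction L) auto
    moreover have "(\<Sum>a\<in>words. \<Sum>(k, c)\<leftarrow>L. of_int c * real (code_wt a choose k)) =
        (\<Sum>(k, c)\<leftarrow>L. of_int c * (\<Sum>a\<in>words. real (code_wt a choose k)))" for L :: "(nat \<times> int) list"
      by (induction L) (auto simp: sum.distrib sum_distrib_left)
    ultimately show ?thesis by (simp add: test_poly_def)
  qed
  also have "\<dots> = (\<Sum>(k, c)\<leftarrow>test_coeffs. of_int c * (real (48 choose k) * (2/3) ^ k * 3 ^ 24))"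
  proof (intro arg_cong[where f=sum_list] map_cong refl)
    fix x assume x: "x \<in> set test_coeffs"
    obtain k c where kc: "x = (k, c)" by (cases x)
    have "\<forall>(k, c)\<in>set test_coeffs. k \<le> 12" by (simp add: test_coeffs_def)
    then have "k \<le> 12" using x kc by blast
    then show "(case x of (k, c) \<Rightarrow> of_int c * (\<Sum>a\<in>words. real (code_wt a choose k))) =
        (case x of (k, c) \<Rightarrow> of_int c * (real (48 choose k) * (2/3) ^ k * 3 ^ 24))"
      unfolding kc case_prod_conv by (subst weight_moment) simp_all
  qed
  \<comment> \<open>This is \<open>3 ^ 15 * (96 - 1365)\<close>: in units of \<open>3 ^ 15\<close>
    the zero word contributes -1365 and each word of weight 48 contributes 1.\<close>
  also have "\<dots> = - 18208762983"
    by (simp add: test_coeffs_def binomial_eval power_divide)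
  finally have total: "(\<Sum>a\<in>words. real_of_int (test_poly (code_wt a))) = - 18208762983" .
  have "(\<Sum>a\<in>words. real_of_int (test_poly (code_wt a))) =
      (\<Sum>a\<in>insert ?o ?F. real_of_int (test_poly (code_wt a)))"
  proof (rule sum.mono_neutral_right)
    show "\<forall>a\<in>words - insert ?o ?F. real_of_int (test_poly (code_wt a)) = 0"
    proof
      fix a assume a: "a \<in> words - insert ?o ?F"
      then have "code_wt a \<in> set [15, 18, 21, 24, 27, 30, 33, 36, 39, 42, 45]" using code_wt_cases[of a] by blast
      then have "test_poly (code_wt a) = 0" using test_poly_values(3) unfolding list_all_iff by blast
      then show "real_of_int (test_poly (code_wt a)) = 0" by simp
    qed
  qed (use o in auto)
  also have "\<dots> = of_int (test_poly 0) + real (card ?F) * of_int (test_poly 48)"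
  proof -
    have "code_wt ?o = 0" by (simp add: code_wt_def supp3_def aS_def)
    then show ?thesis using o by (subst sum.insert) auto
  qed
  finally have "real (card ?F) = 96" unfolding total test_poly_values(1,2) by simp
  then show ?thesis by simp
qed

lemma aS_full_word:
  assumes "i < 24" "j < 24"
  shows "aS (full_word i s e) j = e * (S i j + s * (if i = j then - 23 else 0))"
proof -
  have "aS (full_word i s e) j = (\<Sum>l<24. e * ((if l = i then S l j else 0) + s * (S i l * S l j)))"
    unfolding aS_def full_word_def by (intro sum.cong refl) (simp add: algebra_simps)
  also have "\<dots> = e * ((\<Sum>l<24. if l = i then S l j else 0) + s * (\<Sum>l<24. S i l * S l j))"
    by (simp only: sum_distrib_left[symmetric] sum.distrib)
  also have "\<dots> = e * (S i j + s * (if i = j then - 23 else 0))"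
  proof -
    have "(\<Sum>l<24. if l = i then S l j else 0) = S i j" using assms(1) by simp
    then show ?thesis by (simp only: S_square[OF assms])
  qed
  finally show ?thesis .
qed

lemma sum_lessThan_add: "(\<Sum>j<m + n. f j) = (\<Sum>j<m. f j) + (\<Sum>j<n. f (m + j :: nat))"
  by (induction n) (simp_all add: add.assoc)

lemma supp3_full: "(\<And>j. j < n \<Longrightarrow> \<not> 3 dvd f j) \<Longrightarrow> supp3 n f = {..<n}"
  by (auto simp: supp3_def)

lemma pm1_not_dvd3: "x \<in> {1, - 1::int} \<Longrightarrow> \<not> 3 dvd x" by auto

lemma pm1_mod3: "x \<in> {1, - 1} \<Longrightarrow> y \<in> {1, - 1::int} \<Longrightarrow> x mod 3 = y mod 3 \<Longrightarrow> x = y" by auto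

lemma full_word_pm1:
  assumes "i < 24" "l < 24" "s \<in> {1, - 1}" "e \<in> {1, - 1}"
  shows "full_word i s e l \<in> {1, - 1}" "e * (S i l + s * (if i = l then 1 else 0)) \<in> {1, - 1}"
  using S_entries[OF assms(1,2)] assms(3,4) by (auto simp: full_word_def)

text \<open>The 24 * 2 * 2 explicit words have full weight and are pairwise distinct; as there are
  only 96 words of weight 48, the inclusion is an equality.\<close>

lemma weight_48_words:
  "{a \<in> words. code_wt a = 48} =
     (\<lambda>(i, s, e). restrict (\<lambda>l. full_word i s e l mod 3) {..<24}) ` ({..<24} \<times> {1, - 1} \<times> {1, - 1})"
  (is "?F = ?w ` ?I")
proof (rule card_subset_eq[symmetric])
  show "finite ?F" by simp
  show "?w ` ?I \<subseteq> ?F"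
  proof (rule image_subsetI)
    fix x assume "x \<in> ?I"
    then obtain i s e where x: "x = (i, s, e)" and ise: "i < 24" "s \<in> {1, - 1::int}" "e \<in> {1, - 1::int}" by auto
    have fw: "full_word i s e l mod 3 \<in> {1, 2}" if "l < 24" for l
      using full_word_pm1(1)[of i l s e] ise that by auto
    let ?a = "restrict (\<lambda>l. full_word i s e l mod 3) {..<24}"
    have "?a \<in> words" using fw by (auto simp: words_def PiE_iff)
    moreover have "code_wt ?a = code_wt (full_word i s e)" by (rule code_wt_cong3) simp
    moreover have "supp3 24 (full_word i s e) = {..<24}"
      using full_word_pm1(1)[of i _ s e] ise pm1_not_dvd3 by (intro supp3_full) blast
    moreover have "supp3 24 (aS (full_word i s e)) = {..<24}"
    proof -
      have "\<not> 3 dvd aS (full_word i s e) j" if j: "j < 24" for j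
      proof -
        \<comment> \<open>The diagonal value -23 is split as 1 - 24, and 24 is displayed as a
          multiple of 3.\<close>
        have "aS (full_word i s e) j = e * (S i j + s * (if i = j then 1 else 0)) - 3 * (8 * (e * s * (if i = j then 1 else 0)))"
          using ise j by (simp add: aS_full_word algebra_simps)
        moreover have "\<not> 3 dvd e * (S i j + s * (if i = j then 1 else 0))"
          using full_word_pm1(2)[of i j s e] ise j pm1_not_dvd3 by blast
        ultimately show ?thesis by presburger
      qed
      then show ?thesis by (rule supp3_full)
    qed
    ultimately have "?a \<in> words" "code_wt ?a = 48" by (simp_all add: code_wt_def[of "full_word i s e"])
    then show "?w x \<in> ?F" by (simp add: x)
  qed
  show "card (?w ` ?I) = card ?F"
  proof -
    have "inj_on (\<lambda>(i, s, e). tvec (full_word i s e)) ?I"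
    proof -
      have "set (List.product [0..<24] (List.product [1, - 1::int] [1, - 1::int])) = ?I"
        unfolding set_product by (simp add: atLeast0LessThan)
      then show ?thesis using distinct_full_words unfolding distinct_map by simp
    qed
    moreover have "tvec (full_word i s e) = tvec (?w (i, s, e))" for i s e
      unfolding tvec_def by (intro map_cong refl trit_of_cong) simp
    then have "(\<lambda>(i, s, e). tvec (full_word i s e)) = tvec \<circ> ?w" by (simp add: fun_eq_iff)
    ultimately have "inj_on (tvec \<circ> ?w) ?I" by (simp only:)
    then have "inj_on ?w ?I" by (rule inj_on_imageI2)
    then have "card (?w ` ?I) = card ?I" by (rule card_image)
    also have "\<dots> = 96" by (simp add: card_cartesian_product)
    finally show ?thesis by (simp add: card_weight_48)
  qed
qed

lemma odd_row_sum:
  assumes "i < 24" shows "odd (\<Sum>j<24. S i j)"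
proof -
  have "even (\<Sum>j<24. S i j - (if j = i then 0 else 1))"
    by (rule dvd_sum) (use S_entries[OF assms] in fastforce)
  moreover have "(\<Sum>j<24. (if j = i then 0 else 1::int)) = 23"
  proof -
    have "(\<Sum>j<24. (if j = i then 0 else 1::int)) = (\<Sum>j\<in>{..<24} - {i}. 1)"
      by (subst sum.If_cases) (auto intro!: arg_cong[where f=card])
    also have "\<dots> = 23" using assms by simp
    finally show ?thesis .
  qed
  ultimately show ?thesis unfolding sum_subtractf by simp
qed

text \<open>The lattice vectors with odd coordinates have coordinate sum 2 mod 4, so this excludes those
  with all coordinates \<open>\<plusminus>1\<close>.\<close>

lemma full_codeword_sum:
  assumes pm: "\<And>j. j < 48 \<Longrightarrow> c j \<in> {1, - 1::int}"
    and code: "\<And>j. j < 24 \<Longrightarrow> 3 dvd aS c j - c (24 + j)"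
  shows "4 dvd (\<Sum>j<48. c j)"
proof -
  let ?a = "restrict (\<lambda>l. c l mod 3) {..<24}"
  have cm: "c j mod 3 \<in> {1, 2}" if "j < 48" for j using pm[OF that] by auto
  have "?a \<in> words" using cm by (auto simp: words_def PiE_iff)
  moreover have "code_wt ?a = 48"
  proof -
    have "code_wt ?a = code_wt c" by (rule code_wt_cong3) simp
    moreover have "supp3 24 c = {..<24}" using pm pm1_not_dvd3 by (intro supp3_full) simp
    moreover have "supp3 24 (aS c) = supp3 24 (\<lambda>j. c (24 + j))"
      by (rule supp3_cong) (metis code mod_eq_dvd_iff)
    moreover have "supp3 24 (\<lambda>j. c (24 + j)) = {..<24}" using pm pm1_not_dvd3 by (intro supp3_full) simp
    ultimately show ?thesis by (simp add: code_wt_def)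
  qed
  ultimately have "?a \<in> {a \<in> words. code_wt a = 48}" by blast
  then obtain i s e where ise: "i < 24" "s \<in> {1, - 1}" "e \<in> {1, - 1}"
    and eq: "?a = restrict (\<lambda>l. full_word i s e l mod 3) {..<24}"
    unfolding weight_48_words by auto
  have c1: "c l = full_word i s e l" if l: "l < 24" for l
  proof (rule pm1_mod3)
    show "c l mod 3 = full_word i s e l mod 3" using fun_cong[OF eq, of l] l by simp
    show "full_word i s e l \<in> {1, - 1}" using full_word_pm1(1) ise l by blast
    show "c l \<in> {1, - 1}" using pm l by simp
  qed
  have c2: "c (24 + j) = e * (S i j + s * (if i = j then 1 else 0))" if j: "j < 24" for j
  proof (rule pm1_mod3)
    have "aS c j = aS (full_word i s e) j" unfolding aS_def using c1 by simp
    then have "aS c j = e * (S i j + s * (if i = j then 1 else 0)) - 3 * (8 * (e * s * (if i = j then 1 else 0)))"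
      using ise(1) j by (simp add: aS_full_word algebra_simps)
    then show "c (24 + j) mod 3 = e * (S i j + s * (if i = j then 1 else 0)) mod 3"
      using code[OF j] by presburger
    show "e * (S i j + s * (if i = j then 1 else 0)) \<in> {1, - 1}" using full_word_pm1(2) ise j by blast
    show "c (24 + j) \<in> {1, - 1}" using pm j by simp
  qed
  define T where "T = (\<Sum>j<24. S i j)"
  have "(\<Sum>j<48. c j) = (\<Sum>j<24. c j) + (\<Sum>j<24. c (24 + j))"
    using sum_lessThan_add[of c 24 24] by simp
  also have "(\<Sum>j<24. c j) = e * (1 + s * T)"
    using ise(1) by (simp add: c1 full_word_def T_def sum.distrib flip: sum_distrib_left)
  also have "(\<Sum>j<24. c (24 + j)) = e * (T + s)"
    using ise(1) by (simp add: c2 T_def sum.distrib flip: sum_distrib_left)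
  finally have sum: "(\<Sum>j<48. c j) = e * (1 + s * T) + e * (T + s)" .
  \<comment> \<open>The sum equals \<open>e (1 + s) (1 + T)\<close>, a product with two even factors
    once \<open>T\<close> is odd.\<close>
  have "odd T" unfolding T_def by (rule odd_row_sum) (rule ise(1))
  then obtain m where "T = 2 * m + 1" by (auto elim: oddE)
  then show ?thesis unfolding sum using ise(2,3) by auto
qed

section \<open>The lattice\<close>

lemma S_column_sum_table: "list_all (\<lambda>j. (\<Sum>i\<leftarrow>[0..<24]. S i j) mod 3 = 1) [0..<24]"
  by code_simp

text \<open>The all-ones word is a codeword: the column at infinity sums to -23, and in any other
  column the values of \<open>chi\<close> cancel and the entry 1 at infinity remains. This is what
  provides odd vectors of the lattice.\<close>

lemma aS_ones: assumes "j < 24" shows "aS (\<lambda>_. 1) j mod 3 = 1"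
proof -
  have "j \<in> set [0..<24]" using assms by auto
  then have "(\<Sum>i\<leftarrow>[0..<24]. S i j) mod 3 = 1" using S_column_sum_table unfolding list_all_iff by blast
  then show ?thesis by (simp add: aS_def interv_sum_list_conv_sum_set_nat atLeast0LessThan)
qed

definition coord_idx :: "nat \<Rightarrow> 48" where "coord_idx = (SOME f. bij_betw f {..<48} UNIV)"

lemma bij_coord_idx: "bij_betw coord_idx {..<48} UNIV"
proof -
  have "\<exists>f. bij_betw f {..<48::nat} (UNIV :: 48 set)"
    using finite_same_card_bij[of "{..<48::nat}" "UNIV :: 48 set"] by simp
  then show ?thesis unfolding coord_idx_def by (rule someI_ex)
qed

definition lattice_vec :: "(nat \<Rightarrow> int) \<Rightarrow> real^48" where
  "lattice_vec m = (\<chi> l. of_int (m (inv_into {..<48} coord_idx l)) / sqrt 12)"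

lemma lattice_vec_nth: "i < 48 \<Longrightarrow> lattice_vec m $ coord_idx i = of_int (m i) / sqrt 12"
  using bij_coord_idx by (simp add: lattice_vec_def bij_betw_def)

lemma inner_coord: "x \<bullet> y = (\<Sum>i<48. x $ coord_idx i * y $ coord_idx i)"
  unfolding inner_vec_def inner_real_def
  by (rule sum.reindex_bij_betw[OF bij_coord_idx, of "\<lambda>l. x $ l * y $ l", symmetric])

lemma inner_lattice_vec: "lattice_vec m \<bullet> lattice_vec n = of_int (\<Sum>i<48. m i * n i) / 12"
proof -
  have "lattice_vec m \<bullet> lattice_vec n = (\<Sum>i<48. of_int (m i * n i) / 12)"
    unfolding inner_coord by (intro sum.cong refl) (simp add: lattice_vec_nth)
  then show ?thesis by (simp only: of_int_sum sum_divide_distrib)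
qed

text \<open>The last condition covers both parities at once: for an even vector \<open>2 p\<close>
  it says that \<open>p\<close> has even sum, for an odd vector that the sum is 2 mod 4.\<close>

definition in_P48 :: "(nat \<Rightarrow> int) \<Rightarrow> bool" where
  "in_P48 m \<longleftrightarrow> (\<forall>i<48. even (m i - m 0)) \<and> (\<forall>j<24. 3 dvd aS m j - m (24 + j)) \<and>
     4 dvd (\<Sum>i<48. m i) - 2 * m 0"

definition P48 :: "(real^48) set" where "P48 = lattice_vec ` {m. in_P48 m}"

lemma in_P48_parity: assumes "in_P48 m" "i < 48" shows "even (m i) \<longleftrightarrow> even (m 0)"
proof -
  have "even (m i - m 0)" using assms unfolding in_P48_def by blast
  then show ?thesis by simp
qed

lemma in_P48_code: "in_P48 m \<Longrightarrow> j < 24 \<Longrightarrow> 3 dvd aS m j - m (24 + j)"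
  unfolding in_P48_def by blast

lemma in_P48_sum: "in_P48 m \<Longrightarrow> 4 dvd (\<Sum>i<48. m i) - 2 * m 0"
  unfolding in_P48_def by blast

text \<open>Self-orthogonality of the code: mod 3 the right halves contribute 23 times what the left
  halves do, 24 times in all.\<close>

lemma in_P48_inner_3:
  assumes "in_P48 m" "in_P48 n" shows "3 dvd (\<Sum>i<48. m i * n i)"
proof -
  have "(\<Sum>i<48. m i * n i) = (\<Sum>i<24. m i * n i) + (\<Sum>j<24. m (24 + j) * n (24 + j))"
    using sum_lessThan_add[of "\<lambda>i. m i * n i" 24 24] by simp
  moreover have "3 dvd (\<Sum>j<24. aS m j * aS n j - m (24 + j) * n (24 + j))"
  proof (rule dvd_sum)
    fix j :: nat assume "j \<in> {..<24}"
    then have "3 dvd aS m j - m (24 + j)" "3 dvd aS n j - n (24 + j)" using assms in_P48_code by auto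
    then have "3 dvd (aS m j - m (24 + j)) * aS n j + m (24 + j) * (aS n j - n (24 + j))" by simp
    then show "3 dvd aS m j * aS n j - m (24 + j) * n (24 + j)" by (simp add: algebra_simps)
  qed
  moreover have "(\<Sum>j<24. aS m j * aS n j) = 23 * (\<Sum>i<24. m i * n i)"
    unfolding aS_adjoint by (simp add: aS_aS sum_negf sum_distrib_left algebra_simps)
  ultimately show ?thesis unfolding sum_subtractf by presburger
qed

lemma in_P48_inner_4_even:
  assumes m: "in_P48 m" "even (m 0)" and n: "in_P48 n" shows "4 dvd (\<Sum>i<48. m i * n i)"
proof -
  have ev: "even (m i)" if "i < 48" for i using in_P48_parity[OF m(1) that] m(2) by simp
  define p where "p i = m i div 2" for i
  have p: "m i = 2 * p i" if "i < 48" for i using ev[OF that] by (simp add: p_def)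
  have sp: "even (\<Sum>i<48. p i)"
  proof -
    have "4 dvd (\<Sum>i<48. 2 * p i) - 2 * (2 * p 0)" using in_P48_sum[OF m(1)] p by simp
    then show ?thesis unfolding sum_distrib_left[symmetric] by presburger
  qed
  have "even (\<Sum>i<48. p i * n i)"
  proof (cases "even (n 0)")
    case True
    then have "even (n i)" if "i < 48" for i using in_P48_parity[OF n that] True by simp
    then show ?thesis by (intro dvd_sum) auto
  next
    case False
    then have "odd (n i)" if "i < 48" for i using in_P48_parity[OF n that] False by simp
    then have "even (\<Sum>i<48. p i * n i - p i)" by (intro dvd_sum) auto
    then show ?thesis using sp unfolding sum_subtractf by simp
  qed
  moreover have "(\<Sum>i<48. m i * n i) = 2 * (\<Sum>i<48. p i * n i)" by (simp add: p sum_distrib_left mult.assoc)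
  ultimately show ?thesis by presburger
qed

lemma in_P48_inner_4:
  assumes m: "in_P48 m" and n: "in_P48 n" shows "4 dvd (\<Sum>i<48. m i * n i)"
proof (cases "even (m 0) \<or> even (n 0)")
  case True
  then show ?thesis using in_P48_inner_4_even[OF m _ n] in_P48_inner_4_even[OF n _ m] by (auto simp: mult.commute)
next
  case False
  \<comment> \<open>For two odd vectors the shifted coordinates are even. Expanding the product
    leaves the two coordinate sums, each 2 mod 4, so they cancel mod 4.\<close>
  have "4 dvd (\<Sum>i<48. (m i - 1) * (n i - 1))"
  proof (rule dvd_sum)
    fix i :: nat assume "i \<in> {..<48}"
    then have "even (m i - 1)" "even (n i - 1)" using False in_P48_parity[OF m, of i] in_P48_parity[OF n, of i] by auto
    then have "2 * 2 dvd (m i - 1) * (n i - 1)" by (rule mult_dvd_mono)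
    then show "4 dvd (m i - 1) * (n i - 1)" by simp
  qed
  moreover have "(\<Sum>i<48. (m i - 1) * (n i - 1)) = (\<Sum>i<48. m i * n i) - (\<Sum>i<48. m i) - (\<Sum>i<48. n i) + 48"
    by (simp add: algebra_simps sum.distrib sum_subtractf)
  moreover have "4 dvd (\<Sum>i<48. m i) - 2 * m 0" "4 dvd (\<Sum>i<48. n i) - 2 * n 0" using m n in_P48_sum by auto
  ultimately show ?thesis using False by presburger
qed

lemma in_P48_inner: "in_P48 m \<Longrightarrow> in_P48 n \<Longrightarrow> 12 dvd (\<Sum>i<48. m i * n i)"
  using in_P48_inner_3[of m n] in_P48_inner_4[of m n] by presburger

lemma in_P48_multiples_of_6:
  assumes "\<And>i. i < 48 \<Longrightarrow> 6 dvd m i" "4 dvd (\<Sum>i<48. m i)" shows "in_P48 m"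
  unfolding in_P48_def
proof (intro conjI allI impI)
  have m3: "3 dvd m i" "even (m i)" if "i < 48" for i
    using assms(1)[OF that] by presburger+
  show "even (m i - m 0)" if "i < 48" for i using m3[OF that] m3[of 0] by simp
  show "3 dvd aS m j - m (24 + j)" if "j < 24" for j
    unfolding aS_def using m3 that by (intro dvd_diff dvd_sum) auto
  show "4 dvd (\<Sum>i<48. m i) - 2 * m 0" using assms(2) m3[of 0] by presburger
qed

lemma aS_diff: "aS (\<lambda>i. f i - g i) j = aS f j - aS g j"
  by (simp add: aS_def sum_subtractf left_diff_distrib)

lemma sum_upd: "(\<Sum>i<n. (if i = a then x else 0) * f i) = (if a < n then x * f a else (0::'a::comm_ring_1))" for a n :: nat
proof -
  have "(\<Sum>i<n. (if i = a then x else 0) * f i) = (\<Sum>i<n. if i = a then x * f a else 0)" by (intro sum.cong) auto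
  then show ?thesis by simp
qed

text \<open>Each defining condition is read off from its own test vectors: integrality from
  \<open>12 e_i\<close>, equal parity from \<open>6 (e_i - e_0)\<close>, the code condition from
  doubled codewords, and the condition on the sum from one odd vector.\<close>

lemma dual_P48_subset:
  assumes dual: "\<And>x. x \<in> P48 \<Longrightarrow> x \<bullet> y \<in> \<int>" shows "y \<in> P48"
proof -
  define r where "r i = y $ coord_idx i * sqrt 12" for i
  have ip: "(\<Sum>i<48. of_int (m i) * r i) / 12 \<in> \<int>" if "in_P48 m" for m
  proof -
    have "lattice_vec m \<bullet> y = (\<Sum>i<48. of_int (m i) * r i / 12)"
      unfolding inner_coord
    proof (intro sum.cong refl)
      fix i :: nat assume "i \<in> {..<48}"
      moreover have "sqrt 12 * sqrt 12 = (12::real)" by simp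
      ultimately show "lattice_vec m $ coord_idx i * y $ coord_idx i = of_int (m i) * r i / 12"
        by (simp add: lattice_vec_nth r_def field_simps)
    qed
    then show ?thesis using dual[of "lattice_vec m"] that by (auto simp: P48_def sum_divide_distrib)
  qed
  have single: "\<exists>k. r i = of_int k" if i: "i < 48" for i
  proof -
    have "in_P48 (\<lambda>l. if l = i then 12 else 0)"
      using i by (intro in_P48_multiples_of_6) auto
    from ip[OF this] have "r i \<in> \<int>" using i by (simp add: if_distrib[of of_int] sum_upd cong: if_cong)
    then show ?thesis by (auto elim: Ints_cases)
  qed
  then obtain \<rho> where \<rho>: "\<And>i. i < 48 \<Longrightarrow> r i = of_int (\<rho> i)" by metis
  have ip': "12 dvd (\<Sum>i<48. m i * \<rho> i)" if "in_P48 m" for m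
  proof -
    have "(\<Sum>i<48. of_int (m i) * r i) = of_int (\<Sum>i<48. m i * \<rho> i)" by (simp add: \<rho>)
    then have "of_int (\<Sum>i<48. m i * \<rho> i) / 12 \<in> (\<int> :: real set)" using ip[OF that] by (simp only:)
    then obtain k where "of_int (\<Sum>i<48. m i * \<rho> i) / 12 = (of_int k :: real)" by (elim Ints_cases)
    then have "of_int (\<Sum>i<48. m i * \<rho> i) = (of_int (12 * k) :: real)" by simp
    then have "(\<Sum>i<48. m i * \<rho> i) = 12 * k" by (simp only: of_int_eq_iff)
    then show ?thesis by simp
  qed
  have "in_P48 \<rho>"
    unfolding in_P48_def
  proof (intro conjI allI impI)
    fix i :: nat assume i: "i < 48"
    show "even (\<rho> i - \<rho> 0)"
    proof (cases "i = 0")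
      case False
      have "(\<Sum>l<48. (if l = i then 6 else 0) - (if l = 0 then 6 else 0)) = (0::int)"
        using i by (simp add: sum_subtractf)
      then have "in_P48 (\<lambda>l. (if l = i then 6 else 0) - (if l = 0 then 6 else 0))"
        using i by (intro in_P48_multiples_of_6) auto
      from ip'[OF this] have "12 dvd 6 * \<rho> i - 6 * \<rho> 0"
        using i by (simp add: left_diff_distrib sum_subtractf sum_upd)
      then show ?thesis by presburger
    qed simp
  next
    fix j :: nat assume j: "j < 24"
    \<comment> \<open>The codeword \<open>(S_j | e_j)\<close>, whose left half is sent by
      \<open>S\<close> to -23 times the unit vector. Doubling makes all coordinates even, and the
      odd row sum of \<open>S\<close> plus 1 gives the required sum mod 4.\<close>
    define k where "k l = (if l < 24 then S j l else if l = 24 + j then 1 else 0)" for l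
    have kS: "aS k l = (if j = l then - 23 else 0)" if "l < 24" for l
      using S_square[OF j that] by (simp add: aS_def k_def)
    have "in_P48 (\<lambda>l. 2 * k l)"
      unfolding in_P48_def
    proof (intro conjI allI impI)
      show "3 dvd aS (\<lambda>l. 2 * k l) i - 2 * k (24 + i)" if "i < 24" for i
      proof -
        have "aS (\<lambda>l. 2 * k l) i = 2 * aS k i" by (simp add: aS_def sum_distrib_left mult.assoc)
        then show ?thesis using kS[OF that] by (auto simp: k_def)
      qed
      have "(\<Sum>l<48. k l) = (\<Sum>l<24. S j l) + 1"
        using sum_lessThan_add[of k 24 24] j by (simp add: k_def)
      moreover have "odd (\<Sum>l<24. S j l)" by (rule odd_row_sum[OF j])
      ultimately have "even (\<Sum>l<48. k l)" by simp
      then show "4 dvd (\<Sum>i<48. 2 * k i) - 2 * (2 * k 0)" unfolding sum_distrib_left[symmetric] by presburger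
    qed simp
    from ip'[OF this] have "12 dvd 2 * (\<Sum>l<48. k l * \<rho> l)" by (simp add: sum_distrib_left mult.assoc)
    moreover have "(\<Sum>l<48. k l * \<rho> l) = (\<Sum>l<24. S j l * \<rho> l) + \<rho> (24 + j)"
      using sum_lessThan_add[of "\<lambda>l. k l * \<rho> l" 24 24] j sum_upd[of j 1 "\<lambda>l. \<rho> (24 + l)" 24] by (simp add: k_def)
    moreover have "(\<Sum>l<24. S j l * \<rho> l) = - aS \<rho> j"
    proof -
      have "(\<Sum>l<24. S j l * \<rho> l) = (\<Sum>l<24. - (\<rho> l * S l j))"
      proof (intro sum.cong refl)
        fix l :: nat assume "l \<in> {..<24}"
        then show "S j l * \<rho> l = - (\<rho> l * S l j)" using S_skew[of l j] j by simp
      qed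
      then show ?thesis by (simp add: aS_def sum_negf)
    qed
    ultimately show "3 dvd aS \<rho> j - \<rho> (24 + j)" by presburger
  next
    \<comment> \<open>The all-ones word has coordinate sum 48, which is 0 mod 4; lowering one entry
      by 6 keeps the word mod 3 and the parity, and makes the sum 42, which is 2 mod 4.\<close>
    define m where "m l = (1 - (if l = 0 then 6 else 0) :: int)" for l :: nat
    have sm: "(\<Sum>l<48. m l) = 42" by (simp add: m_def sum_subtractf)
    have "in_P48 m"
      unfolding in_P48_def
    proof (intro conjI allI impI)
      show "3 dvd aS m j - m (24 + j)" if "j < 24" for j
      proof -
        have "aS m j = aS (\<lambda>_. 1) j - 6 * S 0 j"
          unfolding m_def aS_diff by (simp add: aS_def sum_upd)
        then show ?thesis using aS_ones[OF that] by (simp add: m_def) presburger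
      qed
      show "4 dvd (\<Sum>i<48. m i) - 2 * m 0" unfolding sm by (simp add: m_def)
    qed (simp add: m_def)
    from ip'[OF this] have "12 dvd (\<Sum>i<48. \<rho> i) - 6 * \<rho> 0"
      by (simp add: m_def left_diff_distrib sum_subtractf sum_upd)
    then show "4 dvd (\<Sum>i<48. \<rho> i) - 2 * \<rho> 0" by presburger
  qed
  moreover have "y = lattice_vec \<rho>"
  proof -
    have "y $ l = lattice_vec \<rho> $ l" for l
    proof -
      obtain i where i: "i < 48" "l = coord_idx i" using bij_coord_idx by (metis UNIV_I bij_betw_imp_surj_on imageE lessThan_iff)
      have "y $ l = r i / sqrt 12" by (simp add: r_def i(2))
      then show ?thesis using i by (simp add: lattice_vec_nth \<rho>)
    qed
    then show ?thesis by (simp add: Finite_Cartesian_Product.vec_eq_iff)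
  qed
  ultimately show ?thesis by (auto simp: P48_def)
qed

lemma self_dual_P48: "self_dual P48"
proof
  have "x \<bullet> y \<in> \<int>" if xy: "x \<in> P48" "y \<in> P48" for x y
  proof -
    obtain m n where mn: "x = lattice_vec m" "y = lattice_vec n" "in_P48 m" "in_P48 n" using xy by (auto simp: P48_def)
    then obtain k where "(\<Sum>i<48. m i * n i) = 12 * k" using in_P48_inner by (blast elim: dvdE)
    then show ?thesis unfolding mn inner_lattice_vec by simp
  qed
  then show "dual_lattice P48 = P48" unfolding dual_lattice_def using dual_P48_subset by blast
qed

text \<open>In integral coordinates norm 6 becomes 12 * 6 = 72. Congruences leave few values below
  it: only 48 for odd vectors, and for even vectors none that agrees with the minimum weight of the
  code.\<close>

lemma in_P48_norm_ge:
  assumes m: "in_P48 m" and small: "(\<Sum>i<48. (m i)\<^sup>2) < 72" and i: "i < 48" shows "m i = 0"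
proof (cases "even (m 0)")
  case False
  have od: "odd (m i)" if "i < 48" for i using in_P48_parity[OF m that] False by simp
  have sq: "\<exists>k. (m i)\<^sup>2 = 8 * k + 1 \<and> k \<ge> 0" if i48: "i < 48" for i
  proof -
    obtain q where q: "m i = 2 * q + 1" using od[OF i48] by (auto elim: oddE)
    have "even (q * (q + 1))" by simp
    then obtain k where k: "q * (q + 1) = 2 * k" unfolding dvd_def by blast
    have "0 \<le> q * (q + 1)" by (cases "q \<ge> 0") (auto simp: zero_le_mult_iff)
    then have "k \<ge> 0" using k by simp
    moreover have "(m i)\<^sup>2 = 4 * (q * (q + 1)) + 1" by (simp add: q power2_eq_square algebra_simps)
    ultimately show ?thesis using k by (intro exI[of _ k]) simp
  qed
  then obtain k where k: "\<And>i. i < 48 \<Longrightarrow> (m i)\<^sup>2 = 8 * k i + 1" "\<And>i. i < 48 \<Longrightarrow> k i \<ge> 0" by metis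
  have tot: "(\<Sum>i<48. (m i)\<^sup>2) = 8 * (\<Sum>i<48. k i) + 48" by (simp add: k(1) sum.distrib sum_distrib_left)
  have "12 dvd (\<Sum>i<48. (m i)\<^sup>2)" using in_P48_inner[OF m m] by (simp add: power2_eq_square)
  \<comment> \<open>Odd squares are 1 mod 8, so the sum is 8 t + 48; divisibility by 12 makes t a
    multiple of 3, and a total below 72 leaves t < 3. All coordinates are then 1 or -1.\<close>
  then have "(\<Sum>i<48. k i) \<le> 0" using small unfolding tot by presburger
  moreover have "(\<Sum>i<48. k i) \<ge> 0" using k(2) by (intro sum_nonneg) auto
  ultimately have "\<forall>i\<in>{..<48}. k i = 0" using k(2) by (subst sum_nonneg_eq_0_iff[symmetric]) auto
  then have "(m i)\<^sup>2 = 1" if "i < 48" for i using k(1) that by simp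
  then have "m i \<in> {1, - 1}" if "i < 48" for i using that by (auto simp: power2_eq_1_iff)
  then have "4 dvd (\<Sum>i<48. m i)" using in_P48_code[OF m] by (intro full_codeword_sum) auto
  moreover have "4 dvd (\<Sum>i<48. m i) - 2 * m 0" using m by (rule in_P48_sum)
  ultimately show ?thesis using False by presburger
next
  case True
  have ev: "even (m i)" if "i < 48" for i using in_P48_parity[OF m that] True by simp
  define p where "p i = m i div 2" for i
  have p: "m i = 2 * p i" if "i < 48" for i using ev[OF that] by (simp add: p_def)
  have small': "(\<Sum>i<48. (p i)\<^sup>2) < 18"
    using small by (simp add: p power_mult_distrib flip: sum_distrib_left)
  have "even (\<Sum>i<48. p i)"
  proof -
    have "4 dvd (\<Sum>i<48. 2 * p i) - 2 * (2 * p 0)" using in_P48_sum[OF m] p by simp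
    then show ?thesis unfolding sum_distrib_left[symmetric] by presburger
  qed
  moreover have "even (\<Sum>i<48. (p i)\<^sup>2 - p i)" by (rule dvd_sum) auto
  ultimately have evp: "even (\<Sum>i<48. (p i)\<^sup>2)" unfolding sum_subtractf by simp
  have pcode: "3 dvd aS p j - p (24 + j)" if j: "j < 24" for j
  proof -
    have "aS m j = 2 * aS p j" by (simp add: aS_def p sum_distrib_left mult.assoc)
    then have "3 dvd 2 * aS p j - 2 * p (24 + j)" using in_P48_code[OF m j] p[of "24 + j"] j by simp
    then show ?thesis by presburger
  qed
  have wt: "code_wt p = card (supp3 48 p)"
  proof -
    have "supp3 48 p = supp3 24 p \<union> (+) 24 ` supp3 24 (\<lambda>j. p (24 + j))"
    proof (intro subset_antisym subsetI)
      fix j assume j: "j \<in> supp3 48 p"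
      show "j \<in> supp3 24 p \<union> (+) 24 ` supp3 24 (\<lambda>j. p (24 + j))"
      proof (cases "j < 24")
        case True then show ?thesis using j by (auto simp: supp3_def)
      next
        case False
        then have "j - 24 \<in> supp3 24 (\<lambda>j. p (24 + j))" "j = 24 + (j - 24)" using j by (auto simp: supp3_def)
        then show ?thesis by blast
      qed
    qed (auto simp: supp3_def)
    moreover have "supp3 24 p \<inter> (+) 24 ` supp3 24 (\<lambda>j. p (24 + j)) = {}" by (auto simp: supp3_def)
    moreover have "supp3 24 (aS p) = supp3 24 (\<lambda>j. p (24 + j))"
      by (rule supp3_cong) (metis pcode mod_eq_dvd_iff)
    ultimately show ?thesis by (simp add: code_wt_def card_Un_disjoint card_image)
  qed
  have div: "3 dvd p i" if "i < 48" for i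
  proof (rule ccontr)
    assume nd: "\<not> 3 dvd p i"
    have "\<exists>i<24. \<not> 3 dvd p i"
    proof (rule ccontr)
      assume "\<not> ?thesis"
      then have z: "p i mod 3 = 0 mod 3" if "i < 24" for i using that by (simp add: dvd_eq_mod_eq_0)
      then have "aS p j mod 3 = aS (\<lambda>_. 0) j mod 3" for j by (intro aS_cong3) auto
      then have aS0: "aS p j mod 3 = 0" for j by (simp add: aS_def)
      have p24: "3 dvd p (24 + j)" if "j < 24" for j
      proof -
        have "3 dvd aS p j" using aS0[of j] by (simp add: dvd_eq_mod_eq_0)
        then have "3 dvd aS p j - (aS p j - p (24 + j))" using pcode[OF that] by (rule dvd_diff)
        then show ?thesis by simp
      qed
      show False
      proof (cases "i < 24")
        case True then show False using nd z[of i] by (simp add: dvd_eq_mod_eq_0)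
      next
        case False
        then have "i - 24 < 24" using that by arith
        then show False using nd p24[of "i - 24"] False by simp
      qed
    qed
    then have "13 \<le> card (supp3 48 p)" using code_wt_ge_13 wt by metis
    moreover have "int (card (supp3 48 p)) \<le> (\<Sum>i<48. (p i)\<^sup>2)"
    proof -
      have "int (card (supp3 48 p)) = (\<Sum>i\<in>supp3 48 p. 1)" by simp
      also have "\<dots> \<le> (\<Sum>i\<in>supp3 48 p. (p i)\<^sup>2)"
      proof (rule sum_mono)
        fix i assume "i \<in> supp3 48 p"
        then have "p i \<noteq> 0" by (auto simp: supp3_def)
        then show "1 \<le> (p i)\<^sup>2" by (metis int_one_le_iff_zero_less zero_less_power2)
      qed
      also have "\<dots> \<le> (\<Sum>i<48. (p i)\<^sup>2)" by (rule sum_mono2) (auto simp: supp3_def)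
      finally show ?thesis .
    qed
    moreover have "3 dvd (\<Sum>i<48. (p i)\<^sup>2)"
    proof -
      have "12 dvd (\<Sum>i<48. (m i)\<^sup>2)" using in_P48_inner[OF m m] by (simp add: power2_eq_square)
      then have "12 dvd 4 * (\<Sum>i<48. (p i)\<^sup>2)" by (simp add: p power_mult_distrib sum_distrib_left)
      then show ?thesis by presburger
    qed
    \<comment> \<open>The sum of squares of \<open>p\<close> would be at least 13, below 18 and
      divisible by both 2 and 3.\<close>
    ultimately show False using small' evp by presburger
  qed
  define q where "q i = p i div 3" for i
  have q: "p i = 3 * q i" if "i < 48" for i using div[OF that] by (simp add: q_def)
  have tot: "(\<Sum>i<48. (p i)\<^sup>2) = 9 * (\<Sum>i<48. (q i)\<^sup>2)" by (simp add: q power_mult_distrib sum_distrib_left)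
  \<comment> \<open>Nine times this sum is even and below 18, so the sum is even and less than
    2.\<close>
  have "(\<Sum>i<48. (q i)\<^sup>2) \<le> 0" using small' evp unfolding tot by presburger
  moreover have "(q i)\<^sup>2 \<le> (\<Sum>i<48. (q i)\<^sup>2)" using i by (intro member_le_sum) auto
  ultimately have "q i = 0" by (metis dual_order.trans power2_less_eq_zero_iff)
  then show ?thesis using p[OF i] q[OF i] by simp
qed

lemma P48_norm_ge: assumes "x \<in> P48" "x \<noteq> 0" shows "6 \<le> (norm x)\<^sup>2"
proof (rule ccontr)
  assume "\<not> ?thesis"
  then have lt: "x \<bullet> x < 6" by (simp add: power2_norm_eq_inner)
  obtain m where m: "x = lattice_vec m" "in_P48 m" using assms(1) by (auto simp: P48_def)
  have "real_of_int (\<Sum>i<48. m i * m i) < real_of_int 72" using lt unfolding m(1) inner_lattice_vec by simp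
  then have "(\<Sum>i<48. (m i)\<^sup>2) < 72" unfolding of_int_less_iff by (simp add: power2_eq_square)
  then have "m i = 0" if "i < 48" for i using in_P48_norm_ge[OF m(2)] that by blast
  then have "x \<bullet> x = 0" unfolding m(1) inner_lattice_vec by simp
  then show False using assms(2) by simp
qed

section \<open>Explicit cross-sections\<close>

text \<open>The first eight vectors generate a copy of \<open>\<surd>3 E\<^sub>8\<close> found in the sublattice fixed by an automorphism of
  order 3. The vectors of \<open>section_dual\<close> certify that initial segments of the basis span primitive
  sublattices, and the Gram matrix is \<open>R\<^sup>T diag(w) R / 36\<close>.\<close>

definition section_basis :: "int list list" where
  "section_basis = [
    [1, -1, 1, 1, -1, 1, 1, 1, 1, -1, -1, 1, -1, -1, 1, 1, 1, 1, 1, -1, 1, -1, 1, 1, -1, 1, -1, -1, -1, -3, -1, 1, -1, 1, -1, -1, -1, 1, -1, -1, -3, 1, -1, 3, -1, -1, -1, -1],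
    [-1, 1, -1, -1, 1, 3, 1, 1, -1, 1, -1, 1, 1, 1, -1, -1, 3, -1, 1, -3, -1, -1, -1, -1, -1, 1, -1, -1, 1, 1, -1, -1, -1, 1, 1, -1, 1, 1, -1, -1, 1, -1, -1, -1, -1, 1, -1, -1],
    [2, -2, 2, -2, 0, 0, -2, 0, 0, 0, 0, -2, 0, 2, 0, 0, 0, 0, -2, 0, 0, 0, 0, -2, 2, -2, 2, -2, 0, 0, -2, 0, 0, 0, 0, -2, 0, 2, 0, 0, 0, 0, -2, 0, 0, 0, 0, -2],
    [0, 0, 0, -2, 0, -2, -2, -2, 0, 0, 2, -2, 0, 2, 0, 0, -2, 0, -2, 2, 0, 2, 0, -2, 2, -2, 2, 0, 0, 0, 0, 0, 2, 0, 0, 0, 0, 0, 0, 2, 0, 0, 0, 0, 2, 0, 0, 0],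
    [1, -1, 1, 1, 1, 3, 1, -1, 1, -1, 1, 1, 1, -1, 1, 1, 3, -1, 1, -3, 1, 1, 1, 1, -1, 1, -1, -1, 1, -1, -1, -1, -1, 1, 1, -1, 1, 1, -1, -1, -1, -1, -1, 1, -1, 1, -1, -1],
    [-2, 2, -2, 0, 0, 0, 2, 2, 0, 2, -2, 2, 0, 0, -2, 0, 0, 0, 2, 0, 0, -2, -2, 0, -2, 2, -2, 0, 0, 0, 0, -2, 0, 0, 2, 0, 0, 0, 0, 0, 0, 0, 0, 0, 0, 2, 0, 0],
    [3, -3, 3, -1, -1, 1, -1, -1, 1, -1, 1, -1, -1, 1, 1, 1, 1, 1, -1, -1, 1, 1, 1, -1, -1, 1, -1, -1, 1, -1, -1, 1, -1, 1, -1, -1, 1, 1, -1, -1, -1, -1, -1, 1, -1, -1, -1, -1],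
    [-1, 1, -1, 1, -1, -1, 1, 1, 1, 1, -1, 1, -1, -1, -1, 1, -1, 1, 1, 1, 1, -1, -1, 1, -3, 3, -3, -1, -1, -1, 1, 1, -1, 1, -1, 1, -1, 1, -1, -1, -1, 1, 1, 1, -1, -1, -1, -1],
    [2, 2, 2, -2, 0, 0, 0, 2, 0, 0, 0, 0, 0, 0, 0, -2, 2, 0, -2, -2, 0, 0, 0, 0, 0, 0, 0, -2, 0, 2, 0, 0, -2, 0, -2, 0, 0, 0, 0, -2, 0, 0, -2, 0, 0, -2, -2, -2],
    [2, 2, 2, 2, 2, 0, 0, 0, 2, 0, 0, 0, 0, 0, -2, 0, 2, 0, 0, 0, 0, -2, 0, 0, -2, 0, 0, -2, 0, 2, 0, -2, -2, 0, 0, 0, 0, 2, 0, -2, 0, 0, -2, 0, 0, 0, 0, -2]]"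

definition section_dual :: "int list list" where
  "section_dual = [
    [0, 2, 0, 0, 0, 0, -2, 0, 2, 0, -2, 0, 0, 0, 2, 0, 2, 0, 2, 0, 2, -2, 0, -2, 2, 2, 2, 2, 0, -2, 0, 0, 0, 2, -2, 0, 0, 0, 0, 0, 0, 0, 0, 0, 2, 0, 0, 0],
    [-2, 0, -2, 2, 0, 0, 0, 0, -2, -2, -2, 0, 0, 2, 0, 0, 2, 0, -2, 0, 0, 0, 2, -2, -2, -2, -2, -2, 2, 0, 0, 0, 2, 0, 0, 0, 0, 0, 0, 0, 0, 0, 0, 0, 0, -2, 0, 0],
    [-2, -2, 0, 0, -2, 0, 2, 2, 2, 0, 0, -2, 0, -2, 0, 0, 0, -2, 0, 2, 0, 0, 0, 0, 2, 2, 2, -2, 0, 2, -2, 0, 0, 0, 0, 0, 0, 2, 0, 0, 0, -2, 0, 0, 0, 0, 0, 0],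
    [0, 2, -2, -2, 2, 0, -2, -2, 0, 0, 0, -2, -2, 0, 2, 0, 0, 0, 2, 0, 0, 0, 0, 0, -2, -2, -2, -2, 0, 0, 0, 0, 0, 0, 0, 0, 0, -2, 0, 2, 0, 0, -2, 2, 0, 0, 0, 0],
    [-2, 0, 2, 0, 0, 2, -2, 0, 0, 0, 0, 2, 2, 0, 2, 0, -2, -2, 0, 0, 2, 2, 0, 0, -2, -2, -2, -2, 0, 0, 0, -2, 0, 0, 0, 0, 0, 0, 2, 0, 0, 2, 0, 0, 0, 0, 0, 0],
    [2, 2, 2, -2, -2, 2, 0, 2, 0, 0, 0, 0, 2, 0, 0, 0, 0, 0, 0, 2, 0, 0, 0, 0, -2, 0, 0, 0, 0, -2, 0, 0, 0, 0, 2, 2, -2, 0, 2, 2, 0, -2, 0, 0, 0, 2, 0, 0],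
    [2, 2, 2, 2, -2, 0, 0, 0, 0, 0, 0, 0, 0, 2, 0, -2, 0, 0, 0, 0, 2, 0, 0, -2, 2, 2, -2, 0, 0, 0, 0, 2, 0, 0, 2, 0, 0, 0, -2, 0, 0, -2, 0, 0, 0, 0, 2, 2],
    [-2, -2, -2, -2, 2, 0, 0, 0, 0, 0, 0, -2, 0, -2, 0, 0, 0, 0, 0, 0, 2, 0, 0, 0, 0, 2, 0, 0, 2, 0, 2, 0, 0, 0, -2, 0, 0, 2, 0, -2, 0, 2, 0, 0, 2, 0, 2, -2],
    [0, 0, 0, -2, 0, 0, 0, 2, 0, -2, 2, 0, 0, 0, -2, 2, 0, 0, -2, -2, -2, 0, 0, 2, -2, -2, -2, -2, -2, 0, 0, 0, 2, 0, 0, 0, 0, -2, 2, 0, 0, 0, 0, 0, 0, 0, 0, 0],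
    [2, 2, 2, 2, 2, 0, 0, 0, -2, 0, 0, 0, -2, 0, -2, 0, 0, -2, 0, 0, 0, 0, 0, 0, 0, 2, 0, 0, 0, 2, -2, 2, 2, 2, 0, 0, 0, 0, 0, 2, -2, 0, 0, 0, 0, 0, 2, 0]]"

text \<open>Together with the origin, the projections of the vectors of \<open>simplex_dual\<close> to the span of the basis
  have mutual squared distances at most \<open>14/48\<close>. The Gram matrix is \<open>R\<^sup>T diag(w) R / 2310\<close>.\<close>

definition simplex_basis :: "int list list" where
  "simplex_basis = [
    [0, 0, 0, 0, 0, 0, 0, 0, 0, 0, 0, 0, 0, 0, 0, 0, 0, 0, 0, 0, 0, 0, 0, 0, 0, 0, 0, 0, 0, 0, 0, 0, 0, 0, 0, 0, 0, 0, 0, 0, 0, 0, 0, 0, 0, 0, 6, 6],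
    [0, 2, 0, 0, 0, -2, 0, 2, 2, 0, -2, 0, 0, 2, 2, 0, 0, 0, 0, 0, -2, 0, 0, 2, 0, 0, -2, 0, 0, 0, 0, 0, -2, 0, 0, 0, -2, 2, 0, 2, -2, 0, 0, 2, -2, 0, 0, -2],
    [0, 0, 0, -2, 0, 0, 2, 0, 0, 0, 2, -2, 0, -2, -2, 0, 0, 0, 0, -2, 0, 0, 2, -2, 0, 0, -2, 0, -2, 0, -2, 0, 2, 0, 0, 2, 2, 0, 0, -2, 0, -2, 0, 0, 0, 0, -2, 0],
    [-2, -2, 0, 2, -2, 0, 0, 2, 0, 0, 0, 2, 0, 0, -2, 0, 0, -2, 0, 0, 2, 0, 2, 0, -2, 0, 2, 0, 0, 0, 0, 2, 0, 0, -2, -2, 0, 0, 0, 0, 2, 2, 0, 0, 0, 0, 0, -2],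
    [0, 0, 0, 0, 2, 0, -2, -2, 0, 0, 0, 0, 0, 0, 2, 2, 0, 0, 0, 0, 0, 0, -2, -2, 2, 0, 2, -2, 2, 0, 0, 0, 0, 0, 2, 0, 0, -2, 0, 2, 0, -2, 2, -2, 0, 0, -2, 0]]"

definition simplex_dual :: "int list list" where
  "simplex_dual = [
    [-2, -2, -2, -2, -2, -2, -2, 0, 0, 0, 0, 0, 0, -2, 0, 0, 0, 0, 2, 0, 0, 0, 0, 0, 0, 2, 0, 0, 0, -2, 0, 0, 0, 0, 0, 2, -2, 0, 2, 0, -2, 0, 0, -2, 0, 2, 2, 0],
    [0, 2, -2, 0, -2, -2, 2, 2, 0, 2, 2, 2, 0, 0, 2, 2, 0, 0, 0, 2, 0, 0, -2, -2, -2, -2, -2, -2, 0, 0, 0, 0, 0, 0, 0, 0, 0, 0, 0, 0, 0, 0, 0, 0, 0, 0, 0, 0],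
    [-2, -2, -2, -2, -2, -2, 0, 0, 0, 0, -2, 0, 0, 0, 0, 0, 0, 0, 0, 0, -2, 0, 0, 0, 2, 0, 0, 0, -2, -2, -2, 2, 0, 2, 0, 2, 0, -2, 2, 0, 0, 0, 0, 0, 2, 0, 0, 0],
    [-2, -2, -2, -2, -2, -2, -2, 0, 0, 0, 0, -2, 0, 0, 0, 0, 0, 0, 0, 0, 0, 2, 0, 0, 0, -2, 2, 0, 2, -2, -2, 0, 0, 0, -2, 0, 0, 0, 0, 0, 0, 0, -2, 0, -2, -2, 0, 0],
    [-2, -2, -2, -2, -2, -2, 0, 0, -2, 0, 0, 0, 0, 0, 2, 0, 0, 0, 0, -2, 0, 0, 0, 0, 0, -2, 0, 0, 2, 0, 0, -2, -2, 0, 0, 0, 0, -2, -2, 0, 2, -2, 0, 0, -2, 0, 0, 0]]"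

definition section_gram :: "int list list" where
  "section_gram = [
    [6, 0, 0, -3, 3, 0, 3, 3, 1, 1],
    [0, 6, 0, -3, 3, 3, 0, 0, 2, 2],
    [0, 0, 6, 3, 0, -3, 3, -3, 2, 1],
    [-3, -3, 3, 6, -3, -3, 0, -3, -1, -2],
    [3, 3, 0, -3, 6, 0, 3, 0, 1, 2],
    [0, 3, -3, -3, 0, 6, -3, 3, -1, 1],
    [3, 0, 3, 0, 3, -3, 6, 0, 2, 1],
    [3, 0, -3, -3, 0, 3, 0, 6, 0, 1],
    [1, 2, 2, -1, 1, -1, 2, 0, 6, 3],
    [1, 2, 1, -2, 2, 1, 1, 1, 3, 6]]"

definition section_R :: "int list list" where
  "section_R = [
    [6, 0, 0, -3, 3, 0, 3, 3, 1, 1],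
    [0, 6, 0, -3, 3, 3, 0, 0, 2, 2],
    [0, 0, 6, 3, 0, -3, 3, -3, 2, 1],
    [0, 0, 0, 3, 0, 0, 0, 0, -1, -2],
    [0, 0, 0, 0, 6, -3, 3, -3, -1, 1],
    [0, 0, 0, 0, 0, 9, -3, 3, - 5, 3],
    [0, 0, 0, 0, 0, 0, 6, 3, 1, 0],
    [0, 0, 0, 0, 0, 0, 0, 3, 1, 2],
    [0, 0, 0, 0, 0, 0, 0, 0, 2, 1],
    [0, 0, 0, 0, 0, 0, 0, 0, 0, 1]]"

definition section_w :: "int list" where "section_w = [6, 6, 6, 6, 3, 1, 2, 6, 30, 90]"

definition simplex_gram :: "int list list" where
  "simplex_gram = [
    [6, -1, -1, -1, -1],
    [-1, 6, -2, -1, -1],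
    [-1, -2, 6, -1, -1],
    [-1, -1, -1, 6, -2],
    [-1, -1, -1, -2, 6]]"

definition simplex_R :: "int list list" where
  "simplex_R = [
    [6, -1, -1, -1, -1],
    [0, 35, -13, - 7, - 7],
    [0, 0, 22, - 7, - 7],
    [0, 0, 0, 7, - 4],
    [0, 0, 0, 0, 1]]"

definition simplex_w :: "int list" where "simplex_w = [385, 11, 24, 240, 7920]"

text \<open>48 times the inverse Gram matrix. The projections of the dual vectors form the dual
  basis of the span, whose Gram matrix is this inverse. With the origin they are nearly a regular
  simplex: in units of 1/48, three disjoint pairs have squared distance 12 and the other twelve
  pairs have 14.\<close>

definition simplex_gram_inv48 :: "int list list" where
  "simplex_gram_inv48 = [
    [12, 6, 6, 6, 6],
    [6, 14, 8, 7, 7],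
    [6, 8, 14, 7, 7],
    [6, 7, 7, 14, 8],
    [6, 7, 7, 8, 14]]"

definition P48_check :: "int list \<Rightarrow> bool" where
  "P48_check xs \<longleftrightarrow> list_all (\<lambda>i. even (xs ! i - xs ! 0)) [0..<48] \<and>
     list_all (\<lambda>j. 3 dvd (\<Sum>i\<leftarrow>[0..<24]. xs ! i * S i j) - xs ! (24 + j)) [0..<24] \<and>
     4 dvd (\<Sum>i\<leftarrow>[0..<48]. xs ! i) -2 * xs ! 0"

definition dot_list :: "int list \<Rightarrow> int list \<Rightarrow> int" where
  "dot_list xs ys = (\<Sum>i\<leftarrow>[0..<48]. xs ! i * ys ! i)"

lemma section_in_P48: "list_all P48_check section_basis" "list_all P48_check section_dual"
  by code_simp+

lemma simplex_in_P48: "list_all P48_check simplex_basis" "list_all P48_check simplex_dual"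
  by code_simp+

lemma section_products:
  "list_all (\<lambda>i. list_all (\<lambda>j. dot_list (section_basis ! i) (section_basis ! j) = 12 * section_gram ! i ! j \<and>
     dot_list (section_basis ! i) (section_dual ! j) = (if i = j then 12 else 0)) [0..<10]) [0..<10]"
  by code_simp

lemma simplex_products:
  "list_all (\<lambda>i. list_all (\<lambda>j. dot_list (simplex_basis ! i) (simplex_basis ! j) = 12 * simplex_gram ! i ! j \<and>
     dot_list (simplex_basis ! i) (simplex_dual ! j) = (if i = j then 12 else 0)) [0..<5]) [0..<5]"
  by code_simp

lemma section_gram_LDL:
  "list_all (\<lambda>i. list_all (\<lambda>j. 36 * section_gram ! i ! j =
     (\<Sum>l\<leftarrow>[0..<10]. section_w ! l * section_R ! l ! i * section_R ! l ! j) \<and> (i < j \<longrightarrow> section_R ! j ! i = 0)) [0..<10]) [0..<10]"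
  by code_simp

lemma simplex_gram_LDL:
  "list_all (\<lambda>i. list_all (\<lambda>j. 2310 * simplex_gram ! i ! j =
     (\<Sum>l\<leftarrow>[0..<5]. simplex_w ! l * simplex_R ! l ! i * simplex_R ! l ! j) \<and> (i < j \<longrightarrow> simplex_R ! j ! i = 0)) [0..<5]) [0..<5]"
  by code_simp

lemma simplex_gram_inverse:
  "list_all (\<lambda>i. list_all (\<lambda>j. (\<Sum>l\<leftarrow>[0..<5]. simplex_gram ! i ! l * simplex_gram_inv48 ! l ! j) = (if i = j then 48 else 0)) [0..<5]) [0..<5]"
  by code_simp

text \<open>Point 0 is the origin and point \<open>Suc l\<close> is the \<open>l\<close>-th element
  of the dual basis, so the difference of two points has differences of indicators as
  coordinates.\<close>

lemma simplex_distances: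
  "list_all (\<lambda>i. list_all (\<lambda>j. i \<noteq> j \<longrightarrow> (\<Sum>l\<leftarrow>[0..<5]. \<Sum>m\<leftarrow>[0..<5]. simplex_gram_inv48 ! l ! m *
     ((if i = Suc l then 1 else 0) - (if j = Suc l then 1 else 0)) *
     ((if i = Suc m then 1 else 0) - (if j = Suc m then 1 else 0))) \<le> 14) [0..<6]) [0..<6]"
  by code_simp

section \<open>Lattice vectors and determinants from the tables\<close>

lemma P48_checkD:
  assumes "P48_check xs" shows "lattice_vec ((!) xs) \<in> P48"
proof -
  have sums: "(\<Sum>i\<leftarrow>[0..<n]. f i) = (\<Sum>i<n. f i)" for n and f :: "nat \<Rightarrow> int"
    by (simp add: interv_sum_list_conv_sum_set_nat atLeast0LessThan)
  have "in_P48 ((!) xs)"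
    using assms unfolding P48_check_def in_P48_def sums aS_def list_all_iff set_upt by (metis atLeastLessThan_iff le0)
  then show ?thesis by (auto simp: P48_def)
qed

lemma inner_lattice_vec_dot_list: "lattice_vec ((!) xs) \<bullet> lattice_vec ((!) ys) = of_int (dot_list xs ys) / 12"
  unfolding inner_lattice_vec dot_list_def by (simp add: interv_sum_list_conv_sum_set_nat atLeast0LessThan)

lemma list_all_upt: "list_all Q [0..<n] \<Longrightarrow> i < n \<Longrightarrow> Q i" by (simp add: list_all_iff)

lemma list_all_nth: "list_all Q xs \<Longrightarrow> i < length xs \<Longrightarrow> Q (xs ! i)" by (simp add: list_all_length)

definition sec_b :: "nat \<Rightarrow> real^48" where "sec_b i = lattice_vec ((!) (section_basis ! i))"
definition sec_t :: "nat \<Rightarrow> real^48" where "sec_t i = lattice_vec ((!) (section_dual ! i))"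
definition sim_b :: "nat \<Rightarrow> real^48" where "sim_b i = lattice_vec ((!) (simplex_basis ! i))"
definition sim_t :: "nat \<Rightarrow> real^48" where "sim_t i = lattice_vec ((!) (simplex_dual ! i))"

lemma sec_mem: "i < 10 \<Longrightarrow> sec_b i \<in> P48" "i < 10 \<Longrightarrow> sec_t i \<in> P48"
  unfolding sec_b_def sec_t_def
  by (rule P48_checkD, rule list_all_nth[OF section_in_P48(1)], simp add: section_basis_def)
     (rule P48_checkD, rule list_all_nth[OF section_in_P48(2)], simp add: section_dual_def)

lemma sim_mem: "i < 5 \<Longrightarrow> sim_b i \<in> P48" "i < 5 \<Longrightarrow> sim_t i \<in> P48"
  unfolding sim_b_def sim_t_def
  by (rule P48_checkD, rule list_all_nth[OF simplex_in_P48(1)], simp add: simplex_basis_def)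
     (rule P48_checkD, rule list_all_nth[OF simplex_in_P48(2)], simp add: simplex_dual_def)

lemma sec_inner:
  assumes "i < 10" "j < 10"
  shows "sec_b i \<bullet> sec_b j = real_of_int (section_gram ! i ! j)" "sec_b i \<bullet> sec_t j = (if i = j then 1 else 0)"
  using list_all_upt[OF list_all_upt[OF section_products assms(1)] assms(2)]
  by (simp_all add: sec_b_def sec_t_def inner_lattice_vec_dot_list)

lemma sim_inner:
  assumes "i < 5" "j < 5"
  shows "sim_b i \<bullet> sim_b j = real_of_int (simplex_gram ! i ! j)" "sim_b i \<bullet> sim_t j = (if i = j then 1 else 0)"
  using list_all_upt[OF list_all_upt[OF simplex_products assms(1)] assms(2)]
  by (simp_all add: sim_b_def sim_t_def inner_lattice_vec_dot_list)

text \<open>Because \<open>R\<close> is upper triangular, truncating the factors to their leading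
  blocks factors the leading block of \<open>G\<close>. A single factorization thus yields the
  determinants of the whole chain of sections.\<close>

lemma det_LDL:
  fixes G :: "nat \<Rightarrow> nat \<Rightarrow> real" and R :: "nat \<Rightarrow> nat \<Rightarrow> real"
  assumes G: "\<And>i j. i < n \<Longrightarrow> j < n \<Longrightarrow> G i j = (\<Sum>l<n. w l * R l i * R l j)"
    and R: "\<And>i l. i < l \<Longrightarrow> l < n \<Longrightarrow> R l i = 0" and k: "k \<le> n"
  shows "Determinant.det (Matrix.mat k k (\<lambda>(i, j). G i j)) = (\<Prod>l<k. w l * (R l l)\<^sup>2)"
proof -
  let ?U = "Matrix.mat k k (\<lambda>(i, j). R i j)" and ?W = "Matrix.mat k k (\<lambda>(i, j). w i * R i j)"
  have "Matrix.mat k k (\<lambda>(i, j). G i j) = transpose_mat ?U * ?W"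
  proof (rule eq_matI)
    fix i j assume "i < dim_row (transpose_mat ?U * ?W)" "j < dim_col (transpose_mat ?U * ?W)"
    then have ij: "i < k" "j < k" by auto
    have "G i j = (\<Sum>l<n. w l * R l i * R l j)" using G ij k by simp
    also have "\<dots> = (\<Sum>l<k. w l * R l i * R l j)"
      by (rule sum.mono_neutral_right) (use ij k R in auto)
    finally show "Matrix.mat k k (\<lambda>(i, j). G i j) $$ (i, j) = (transpose_mat ?U * ?W) $$ (i, j)"
      using ij by (simp add: scalar_prod_def atLeast0LessThan algebra_simps)
  qed auto
  moreover have "Determinant.det ?U = (\<Prod>l<k. R l l)"
    using R k by (subst det_upper_triangular[of _ k]) (auto simp: upper_triangular_def prod_list_diag_prod atLeast0LessThan)
  moreover have "Determinant.det ?W = (\<Prod>l<k. w l * R l l)"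
    using R k by (subst det_upper_triangular[of _ k]) (auto simp: upper_triangular_def prod_list_diag_prod atLeast0LessThan)
  ultimately show ?thesis
    by (simp add: det_mult[of _ k] Determinant.det_transpose[of _ k] prod.distrib power2_eq_square algebra_simps)
qed

lemma sec_det:
  assumes "k \<le> 10"
  shows "Determinant.det (gram_mat k sec_b) =
    (\<Prod>l<k. real_of_int (section_w ! l) / 36 * (real_of_int (section_R ! l ! l))\<^sup>2)"
proof -
  have "Determinant.det (Matrix.mat k k (\<lambda>(i, j). real_of_int (section_gram ! i ! j))) =
    (\<Prod>l<k. real_of_int (section_w ! l) / 36 * (real_of_int (section_R ! l ! l))\<^sup>2)"
  proof (rule det_LDL[where n = 10 and G = "\<lambda>i j. real_of_int (section_gram ! i ! j)"
        and R = "\<lambda>l i. real_of_int (section_R ! l ! i)" and w = "\<lambda>l. real_of_int (section_w ! l) / 36"])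
    fix i j :: nat assume ij: "i < 10" "j < 10"
    have "36 * section_gram ! i ! j = (\<Sum>l<10. section_w ! l * section_R ! l ! i * section_R ! l ! j)"
      using list_all_upt[OF list_all_upt[OF section_gram_LDL ij(1)] ij(2)]
      by (simp add: interv_sum_list_conv_sum_set_nat atLeast0LessThan)
    then have "real_of_int (36 * section_gram ! i ! j) = real_of_int (\<Sum>l<10. section_w ! l * section_R ! l ! i * section_R ! l ! j)"
      by (simp only:)
    then have "36 * real_of_int (section_gram ! i ! j) = (\<Sum>l<10. real_of_int (section_w ! l) * real_of_int (section_R ! l ! i) * real_of_int (section_R ! l ! j))"
      by (simp only: of_int_sum of_int_mult of_int_numeral)
    then show "real_of_int (section_gram ! i ! j) =
        (\<Sum>l<10. real_of_int (section_w ! l) / 36 * real_of_int (section_R ! l ! i) * real_of_int (section_R ! l ! j))"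
      by (simp add: sum_divide_distrib[symmetric])
  next
    fix i l :: nat assume "i < l" "l < 10"
    then show "real_of_int (section_R ! l ! i) = 0"
      using list_all_upt[OF list_all_upt[OF section_gram_LDL, of i], of l] by simp
  qed (rule assms)
  moreover have "gram_mat k sec_b = Matrix.mat k k (\<lambda>(i, j). real_of_int (section_gram ! i ! j))"
    by (rule eq_matI) (use assms in \<open>auto simp: sec_inner\<close>)
  ultimately show ?thesis by simp
qed

lemma sim_det: "Determinant.det (gram_mat 5 sim_b) = 3072"
proof -
  have "Determinant.det (Matrix.mat 5 5 (\<lambda>(i, j). real_of_int (simplex_gram ! i ! j))) =
    (\<Prod>l<5. real_of_int (simplex_w ! l) / 2310 * (real_of_int (simplex_R ! l ! l))\<^sup>2)"
  proof (rule det_LDL[where n = 5 and G = "\<lambda>i j. real_of_int (simplex_gram ! i ! j)"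
        and R = "\<lambda>l i. real_of_int (simplex_R ! l ! i)" and w = "\<lambda>l. real_of_int (simplex_w ! l) / 2310"])
    fix i j :: nat assume ij: "i < 5" "j < 5"
    have "2310 * simplex_gram ! i ! j = (\<Sum>l<5. simplex_w ! l * simplex_R ! l ! i * simplex_R ! l ! j)"
      using list_all_upt[OF list_all_upt[OF simplex_gram_LDL ij(1)] ij(2)]
      by (simp add: interv_sum_list_conv_sum_set_nat atLeast0LessThan)
    then have "real_of_int (2310 * simplex_gram ! i ! j) = real_of_int (\<Sum>l<5. simplex_w ! l * simplex_R ! l ! i * simplex_R ! l ! j)"
      by (simp only:)
    then have "2310 * real_of_int (simplex_gram ! i ! j) = (\<Sum>l<5. real_of_int (simplex_w ! l) * real_of_int (simplex_R ! l ! i) * real_of_int (simplex_R ! l ! j))"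
      by (simp only: of_int_sum of_int_mult of_int_numeral)
    then show "real_of_int (simplex_gram ! i ! j) =
        (\<Sum>l<5. real_of_int (simplex_w ! l) / 2310 * real_of_int (simplex_R ! l ! i) * real_of_int (simplex_R ! l ! j))"
      by (simp add: sum_divide_distrib[symmetric])
  next
    fix i l :: nat assume "i < l" "l < 5"
    then show "real_of_int (simplex_R ! l ! i) = 0"
      using list_all_upt[OF list_all_upt[OF simplex_gram_LDL, of i], of l] by simp
  qed simp
  moreover have "gram_mat 5 sim_b = Matrix.mat 5 5 (\<lambda>(i, j). real_of_int (simplex_gram ! i ! j))"
    by (rule eq_matI) (auto simp: sim_inner)
  ultimately show ?thesis by (simp add: simplex_w_def simplex_R_def eval_nat_numeral)
qed

lemma sec_dets:
  "Determinant.det (gram_mat 6 sec_b) = 3 ^ 7" "Determinant.det (gram_mat 7 sec_b) = 2 * 3 ^ 7"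
  "Determinant.det (gram_mat 8 sec_b) = 3 ^ 8" "Determinant.det (gram_mat 9 sec_b) = 10 * 3 ^ 7"
  "Determinant.det (gram_mat 10 sec_b) = 25 * 3 ^ 7"
  by (simp_all add: sec_det section_w_def section_R_def eval_nat_numeral)

lemma P48_unimodular: "unimodular_lattice P48"
  by (rule self_dual_unimodular) (rule self_dual_P48)

lemma P48_minimum: "lattice_has_minimum P48 6"
proof -
  have "sec_b 0 \<bullet> sec_b 0 = 6" by (simp add: sec_inner section_gram_def)
  then have "(norm (sec_b 0))\<^sup>2 = 6" "sec_b 0 \<noteq> 0" by (auto simp: power2_norm_eq_inner)
  then show ?thesis unfolding lattice_has_minimum_def using sec_mem(1)[of 0] P48_norm_ge by auto
qed

section \<open>The packings\<close>

lemma sphere_packingI: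
  assumes "r > 0" "\<And>x y. x \<in> C \<Longrightarrow> y \<in> C \<Longrightarrow> x \<noteq> y \<Longrightarrow> 2 * r \<le> dist x y"
  shows "sphere_packing C r"
proof -
  have "ball x r \<inter> ball y r = {}" if "x \<in> C" "y \<in> C" "x \<noteq> y" for x y
    using assms(2)[OF that] by (intro disjoint_ballI) simp
  then show ?thesis using assms(1) by (simp add: sphere_packing_def disjoint_family_on_def interior_cball)
qed

lemma bare_section_packing:
  fixes b t :: "nat \<Rightarrow> real^48"
  assumes k: "k + CARD('d::{finite,wellorder}) = 48"
    and bt: "\<And>i. i < k \<Longrightarrow> b i \<in> P48" "\<And>i. i < k \<Longrightarrow> t i \<in> P48"
    "\<And>i j. i < k \<Longrightarrow> j < k \<Longrightarrow> b i \<bullet> t j = (if i = j then 1 else 0)"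
  shows "\<exists>(C :: (real,'d) vec set) r. lattice_packing C r \<and> bare_cross_section_packing P48 C r \<and>
    has_center_density C r ((sqrt 6 / 2) ^ CARD('d) / sqrt (Determinant.det (gram_mat k b)))"
proof -
  have k': "k + CARD('d) = CARD(48)" using k by simp
  obtain f :: "(real,'d) vec \<Rightarrow> real^48" where f: "linear f" "\<And>x. norm (f x) = norm x"
    "range f = (span (b ` {..<k}))\<^sup>\<bottom>" "cuts_cross_section P48 (span (b ` {..<k}))"
    "full_lattice (f -` P48)" "lattice_has_det (f -` P48) (Determinant.det (gram_mat k b))"
    using cross_section_lattice[OF self_dual_P48 k', where b=b and t=t, OF bt] by blast
  interpret self_dual P48 by (rule self_dual_P48)
  let ?C = "f -` P48"
  have pack: "sphere_packing ?C (sqrt 6 / 2)"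
  proof (rule sphere_packingI)
    fix x y assume "x \<in> ?C" "y \<in> ?C" "x \<noteq> y"
    then have "f (x - y) \<in> P48" using diff f(1) by (simp add: linear_diff)
    moreover have "f (x - y) \<noteq> 0" using f(2)[of "x - y"] \<open>x \<noteq> y\<close> by auto
    ultimately have "6 \<le> (norm (x - y))\<^sup>2" using P48_norm_ge f(2) by metis
    then show "2 * (sqrt 6 / 2) \<le> dist x y" using real_le_rsqrt real_sqrt_le_mono[of 6 "(norm (x - y))\<^sup>2"] by (simp add: dist_norm)
  qed simp
  have "has_center_density ?C (sqrt 6 / 2) (real (card {0::(real,'d) vec}) * (sqrt 6 / 2) ^ CARD('d) / sqrt (Determinant.det (gram_mat k b)))"
    by (rule periodic_packing_center_density[OF f(6) _ _ _ pack]) (auto simp: disjoint_family_on_def)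
  moreover have "bare_cross_section_packing P48 ?C (sqrt 6 / 2)"
    unfolding bare_cross_section_packing_def using f by (intro exI[of _ "span (b ` {..<k})"] exI[of _ f]) auto
  ultimately show ?thesis using pack f(5) unfolding lattice_packing_def by (intro exI[of _ ?C] exI[of _ "sqrt 6 / 2"]) auto
qed

text \<open>A vector in the span is determined by its inner products \<open>e\<close> with the
  \<open>b l\<close>. The combination of the \<open>b l\<close> with coefficient vector
  \<open>Q e\<close> has the same inner products, so it equals \<open>s\<close>, and pairing with
  \<open>s\<close> gives the quadratic form of \<open>Q\<close>.\<close>

lemma gram_inverse_norm:
  fixes b :: "nat \<Rightarrow> 'a::euclidean_space"
  assumes s: "s \<in> span (b ` {..<k})" "\<And>l. l < k \<Longrightarrow> s \<bullet> b l = e l"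
    and Q: "\<And>p m. p < k \<Longrightarrow> m < k \<Longrightarrow> (\<Sum>l<k. (b p \<bullet> b l) * Q l m) = (if p = m then 1 else 0)"
  shows "s \<bullet> s = (\<Sum>l<k. \<Sum>m<k. Q l m * e l * e m)"
proof -
  define s' where "s' = (\<Sum>l<k. (\<Sum>m<k. Q l m * e m) *\<^sub>R b l)"
  have "s' \<bullet> b p = e p" if p: "p < k" for p
  proof -
    have "s' \<bullet> b p = (\<Sum>l<k. \<Sum>m<k. (b p \<bullet> b l) * Q l m * e m)"
      by (simp add: s'_def inner_sum_left sum_distrib_left sum_distrib_right inner_commute[of "b p"] algebra_simps)
    also have "\<dots> = (\<Sum>m<k. \<Sum>l<k. (b p \<bullet> b l) * Q l m * e m)" by (rule sum.swap)
    also have "\<dots> = (\<Sum>m<k. (if p = m then 1 else 0) * e m)"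
      using p by (intro sum.cong refl) (simp add: sum_distrib_right[symmetric] Q)
    also have "\<dots> = e p" using p by (simp add: if_distrib[of "\<lambda>x. x * _"] cong: if_cong)
    finally show ?thesis .
  qed
  then have "orthogonal (s - s') v" if "v \<in> b ` {..<k}" for v
    using that s(2) by (auto simp: Linear_Algebra.orthogonal_def inner_diff_left)
  then have o: "orthogonal (s - s') v" if "v \<in> span (b ` {..<k})" for v
    using orthogonal_to_span[OF that] by blast
  have "s' \<in> span (b ` {..<k})" unfolding s'_def by (intro span_sum span_scale span_base) auto
  then have "s - s' \<in> span (b ` {..<k})" using s(1) by (rule span_diff[rotated])
  then have "s = s'" using o[of "s - s'"] by (simp add: Linear_Algebra.orthogonal_def)
  then have "s \<bullet> s = s \<bullet> s'" by simp
  also have "\<dots> = (\<Sum>l<k. (\<Sum>m<k. Q l m * e m) * e l)" by (simp add: s'_def inner_sum_right s(2))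
  finally show ?thesis by (simp add: sum_distrib_left algebra_simps)
qed

lemma packing_43:
  "\<exists>(C :: (real^43) set) r. sphere_packing C r \<and> union_of_translates 6 C \<and>
     has_center_density C r (6 * sqrt (137 / 96) ^ 43 / sqrt 3072)"
proof -
  interpret self_dual P48 by (rule self_dual_P48)
  let ?U = "span (sim_b ` {..<5})"
  have k: "5 + CARD(43) = CARD(48)" by simp
  obtain f :: "real^43 \<Rightarrow> real^48" where f: "linear f" "\<And>x. norm (f x) = norm x"
    "range f = ?U\<^sup>\<bottom>" "cuts_cross_section P48 ?U" "full_lattice (f -` P48)"
    and det: "lattice_has_det (f -` P48) (Determinant.det (gram_mat 5 sim_b))"
    using cross_section_lattice[OF self_dual_P48 k, where b=sim_b and t=sim_t, OF sim_mem sim_inner(2)] by blast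
  let ?L = "f -` P48"
  define u where "u i = (case i of 0 \<Rightarrow> 0 | Suc j \<Rightarrow> sim_t j)" for i
  have uP: "u i \<in> P48" if "i < 6" for i using that sim_mem(2) zero by (auto simp: u_def split: nat.split)
  have ub: "u i \<bullet> sim_b l = (if i = Suc l then 1 else 0)" if "i < 6" "l < 5" for i l
    using that sim_inner(2) by (auto simp: u_def inner_commute split: nat.split)
  have "\<exists>p. u i - f p \<in> ?U" for i
  proof -
    have "u i \<in> ?U + ?U\<^sup>\<bottom>" using subspace_sum_orthogonal_comp[of ?U] by simp
    then obtain v w where "v \<in> ?U" "w \<in> ?U\<^sup>\<bottom>" "u i = v + w" by (elim set_plus_elim)
    then obtain p where "w = f p" using f(3) by blast
    then show ?thesis using \<open>v \<in> ?U\<close> \<open>u i = v + w\<close> by (intro exI[of _ p]) simp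
  qed
  then obtain p where p: "\<And>i. u i - f (p i) \<in> ?U" by metis
  have fU: "f x \<bullet> v = 0" if "v \<in> ?U" for x v
  proof -
    have "f x \<in> ?U\<^sup>\<bottom>" using f(3) by blast
    then show ?thesis using that by (auto simp: orthogonal_comp_def Linear_Algebra.orthogonal_def inner_commute)
  qed
  have apart: "137 / 24 \<le> (norm ((x + p i) - (y + p j)))\<^sup>2"
    if xy: "x \<in> ?L" "y \<in> ?L" and ij: "i < 6" "j < 6" "i \<noteq> j" for x y i j
  proof -
    let ?z = "(x + p i) - (y + p j)"
    \<comment> \<open>The difference of two projections to the span of the section. Adding it to the
      orthogonal vector \<open>f ?z\<close> gives a lattice vector \<open>v\<close>, so by
      Pythagoras a long \<open>v\<close> and a short \<open>s\<close> force a long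
      \<open>f ?z\<close>.\<close>
    define s where "s = (u i - f (p i)) - (u j - f (p j))"
    define v where "v = f ?z + s"
    have v: "v = f x - f y + u i - u j" using f(1) by (simp add: v_def s_def linear_add linear_diff)
    then have vP: "v \<in> P48" using xy uP ij by (auto intro!: diff add)
    have sU: "s \<in> ?U" unfolding s_def by (rule span_diff[OF p p])
    define e where "e l = (if i = Suc l then 1 else 0) - (if j = Suc l then 1 else (0::int))" for l
    have bU: "sim_b l \<in> ?U" if "l < 5" for l using that by (auto intro: span_base)
    have sb: "s \<bullet> sim_b l = of_int (e l)" if "l < 5" for l
      using ub ij that fU[OF bU[OF that]] by (simp add: s_def inner_diff_left e_def)
    have vb: "v \<bullet> sim_b l = of_int (e l)" if "l < 5" for l
      using sb that fU[OF bU[OF that]] by (simp add: v_def inner_add_left)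
    \<comment> \<open>Distinct vertices of the simplex differ in some inner product with the basis,
      so \<open>v\<close> is nonzero whatever \<open>x\<close> and \<open>y\<close> are, and the
      minimum of the lattice applies to it.\<close>
    have "\<exists>l<5. e l \<noteq> 0"
    proof (cases i)
      case 0 then show ?thesis using ij by (intro exI[of _ "j - 1"]) (auto simp: e_def)
    next
      case (Suc l) then show ?thesis using ij by (intro exI[of _ l]) (auto simp: e_def)
    qed
    then obtain l where l: "l < 5" "e l \<noteq> 0" by blast
    have "v \<noteq> 0" using vb[OF l(1)] l(2) by auto
    then have v6: "6 \<le> v \<bullet> v" using P48_norm_ge[OF vP] by (simp add: power2_norm_eq_inner)
    have "s \<bullet> s = (\<Sum>l<5. \<Sum>m<5. real_of_int (simplex_gram_inv48 ! l ! m) / 48 * of_int (e l) * of_int (e m))"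
    proof (rule gram_inverse_norm[OF sU sb])
      fix q m :: nat assume qm: "q < 5" "m < 5"
      have "(\<Sum>l<5. simplex_gram ! q ! l * simplex_gram_inv48 ! l ! m) = (if q = m then 48 else 0)"
        using list_all_upt[OF list_all_upt[OF simplex_gram_inverse qm(1)] qm(2)]
        by (simp add: interv_sum_list_conv_sum_set_nat atLeast0LessThan)
      then have "real_of_int (\<Sum>l<5. simplex_gram ! q ! l * simplex_gram_inv48 ! l ! m) = (if q = m then 48 else 0)"
        by simp
      then have "(\<Sum>l<5. real_of_int (simplex_gram ! q ! l) * real_of_int (simplex_gram_inv48 ! l ! m)) = (if q = m then 48 else 0)"
        by simp
      then show "(\<Sum>l<5. sim_b q \<bullet> sim_b l * (real_of_int (simplex_gram_inv48 ! l ! m) / 48)) = (if q = m then 1 else 0)"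
        using qm by (simp add: sim_inner sum_divide_distrib[symmetric])
    qed
    also have "\<dots> = of_int (\<Sum>l<5. \<Sum>m<5. simplex_gram_inv48 ! l ! m * e l * e m) / 48"
      by (simp add: sum_divide_distrib)
    also have "\<dots> \<le> 14 / 48"
    proof -
      have "(\<Sum>l<5. \<Sum>m<5. simplex_gram_inv48 ! l ! m * e l * e m) \<le> 14"
        using list_all_upt[OF list_all_upt[OF simplex_distances ij(1)] ij(2)] ij(3)
        by (simp add: interv_sum_list_conv_sum_set_nat atLeast0LessThan e_def)
      then show ?thesis by (intro divide_right_mono) linarith+
    qed
    finally have "s \<bullet> s \<le> 14 / 48" .
    moreover have "v \<bullet> v = f ?z \<bullet> f ?z + s \<bullet> s"
      using fU[OF sU, of ?z] by (simp add: v_def inner_add_left inner_add_right inner_commute)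
    ultimately have "137 / 24 \<le> f ?z \<bullet> f ?z" using v6 by simp
    then show ?thesis using f(2)[of ?z] by (simp add: power2_norm_eq_inner[symmetric])
  qed
  define T where "T = p ` {..<6}"
  have inj: "inj_on p {..<6}"
  proof (rule inj_onI, rule ccontr)
    fix i j assume ij: "i \<in> {..<6::nat}" "j \<in> {..<6}" "i \<noteq> j" and eq: "p i = p j"
    have "0 \<in> ?L" using linear_0[OF f(1)] zero by simp
    from apart[OF this this _ _ ij(3)] ij(1,2) show False unfolding eq by simp
  qed
  define C where "C = (\<Union>t\<in>T. (+) t ` ?L)"
  have disj: "disjoint_family_on (\<lambda>t. (+) t ` ?L) T"
    unfolding disjoint_family_on_def
  proof (intro ballI impI, rule ccontr)
    fix t t' assume t: "t \<in> T" "t' \<in> T" "t \<noteq> t'" and ne: "(+) t ` ?L \<inter> (+) t' ` ?L \<noteq> {}"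
    obtain i j where ij: "i < 6" "j < 6" "t = p i" "t' = p j" using t unfolding T_def by blast
    obtain x y where xy: "x \<in> ?L" "y \<in> ?L" "p i + x = p j + y" using ne unfolding ij(3,4) by blast
    have "i \<noteq> j" using ij(3,4) t(3) by blast
    from apart[OF xy(1,2) ij(1,2) this] show False unfolding add.commute[of x] add.commute[of y] xy(3) by simp
  qed
  have pack: "sphere_packing C (sqrt (137 / 96))"
  proof (rule sphere_packingI)
    fix x y assume "x \<in> C" "y \<in> C" and ne: "x \<noteq> y"
    then obtain i j a b where ij: "i < 6" "j < 6" and ab: "a \<in> ?L" "b \<in> ?L" and xy: "x = p i + a" "y = p j + b"
      unfolding C_def T_def by blast
    have "137 / 24 \<le> (norm (x - y))\<^sup>2"
    proof (cases "i = j")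
      case True
      then have xyab: "x - y = a - b" using xy by simp
      have "f (a - b) \<in> P48" using ab diff f(1) by (simp add: linear_diff)
      moreover have "f (a - b) \<noteq> 0" using f(2)[of "a - b"] ne xyab by auto
      ultimately have "6 \<le> (norm (a - b))\<^sup>2" using P48_norm_ge f(2) by metis
      \<comment> \<open>Within one translate the lattice minimum 6 already exceeds 137/24.\<close>
      then show ?thesis unfolding xyab by linarith
    next
      case False from apart[OF ab ij this] show ?thesis unfolding xy by (simp only: add.commute)
    qed
    then have "sqrt (137 / 24) \<le> norm (x - y)" by (intro real_le_lsqrt) auto
    moreover have "2 * sqrt (137 / 96) = sqrt (137 / 24)"
      using real_sqrt_mult[of 4 "137 / 96"] by simp
    ultimately show "2 * sqrt (137 / 96) \<le> dist x y" by (simp add: dist_norm)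
  qed simp
  have cT: "finite T" "card T = 6" using inj by (simp_all add: T_def card_image)
  have "has_center_density C (sqrt (137 / 96)) (real (card T) * sqrt (137 / 96) ^ CARD(43) / sqrt 3072)"
    by (rule periodic_packing_center_density[OF det[unfolded sim_det] cT(1) disj C_def pack])
  moreover have "union_of_translates 6 C"
    unfolding union_of_translates_def using f(5) cT disj C_def by blast
  ultimately show ?thesis using pack unfolding cT(2) by (intro exI[of _ C] exI[of _ "sqrt (137 / 96)"]) simp
qed

section \<open>Closed forms and decimal bounds of the densities\<close>

lemma powr_half: "x > 0 \<Longrightarrow> x powr (real n + 1 / 2) = x ^ n * sqrt x"
  by (simp add: powr_add powr_realpow powr_half_sqrt)

lemma density_values:
  "(sqrt 6 / 2) ^ 38 / sqrt (25 * 3 ^ 7) = 3 powr (31/2) / (2 ^ 19 * 5)"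
  "(sqrt 6 / 2) ^ 39 / sqrt (10 * 3 ^ 7) = 3 ^ 16 / (2 ^ 20 * 5 powr (1/2))"
  "(sqrt 6 / 2) ^ 40 / sqrt (3 ^ 8) = (3 ^ 16 / 2 ^ 20 :: real)"
  "(sqrt 6 / 2) ^ 41 / sqrt (2 * 3 ^ 7) = (3 ^ 17 / 2 ^ 21 :: real)"
  "(sqrt 6 / 2) ^ 42 / sqrt (3 ^ 7) = 3 powr (35/2) / 2 ^ 21"
  "6 * sqrt (137 / 96) ^ 43 / sqrt 3072 = 137 powr (43/2) / (2 powr (223/2) * 3 ^ 21)"
proof -
  have p: "3 powr (31/2) = 3 ^ 15 * sqrt 3" "3 powr (35/2) = 3 ^ 17 * sqrt 3" "5 powr (1/2) = sqrt (5::real)"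
    "137 powr (43/2) = 137 ^ 21 * sqrt 137" "2 powr (223/2) = 2 ^ 111 * sqrt 2"
    using powr_half[of 3 15] powr_half[of 3 17] powr_half[of 5 0] powr_half[of 137 21] powr_half[of 2 111] by simp_all
  have e: "(sqrt 6 / 2) ^ (2 * n) = (3 / 2 :: real) ^ n" for n
    by (simp add: power_mult power_divide)
  have s37: "sqrt (3 ^ 7) = 27 * sqrt 3" using real_sqrt_mult[of 729 3] real_sqrt_abs[of 27] by simp
  have s38: "sqrt (3 ^ 8) = 81" using real_sqrt_abs[of 81] by simp
  have s2: "sqrt (2 * 3 ^ 7) = 27 * sqrt 6" using real_sqrt_mult[of 729 6] real_sqrt_abs[of 27] by simp
  have s10: "sqrt (10 * 3 ^ 7) = 27 * (sqrt 5 * sqrt 6)"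
    using real_sqrt_mult[of 729 30] real_sqrt_mult[of 5 6] real_sqrt_abs[of 27] by simp
  have s25: "sqrt (25 * 3 ^ 7) = 135 * sqrt 3" using real_sqrt_mult[of 18225 3] real_sqrt_abs[of 135] by simp
  have s3: "sqrt 3 * sqrt 3 = (3::real)" by simp
  show "(sqrt 6 / 2) ^ 38 / sqrt (25 * 3 ^ 7) = 3 powr (31/2) / (2 ^ 19 * 5)"
    unfolding p s25 using e[of 19] s3 by (simp add: power_divide field_simps)
  show "(sqrt 6 / 2) ^ 39 / sqrt (10 * 3 ^ 7) = 3 ^ 16 / (2 ^ 20 * 5 powr (1/2))"
    unfolding p s10 using e[of 19] power_Suc[of "sqrt 6 / 2 :: real" 38] by (simp add: power_divide field_simps)
  show "(sqrt 6 / 2) ^ 40 / sqrt (3 ^ 8) = (3 ^ 16 / 2 ^ 20 :: real)"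
    unfolding s38 using e[of 20] by (simp add: power_divide)
  show "(sqrt 6 / 2) ^ 41 / sqrt (2 * 3 ^ 7) = (3 ^ 17 / 2 ^ 21 :: real)"
    unfolding s2 using e[of 20] power_Suc[of "sqrt 6 / 2 :: real" 40] by (simp add: power_divide field_simps)
  show "(sqrt 6 / 2) ^ 42 / sqrt (3 ^ 7) = 3 powr (35/2) / 2 ^ 21"
    unfolding p s37 using e[of 21] s3 by (simp add: power_divide field_simps)
  have r: "sqrt (137 / 96) = sqrt 137 / (4 * sqrt 6)" "sqrt 3072 = 32 * sqrt 3"
    using real_sqrt_divide[of 137 96] real_sqrt_mult[of 16 6] real_sqrt_mult[of 1024 3] real_sqrt_abs[of 4] real_sqrt_abs[of 32] by simp_all
  have r43: "sqrt (137 / 96) ^ 43 = (137 / 96) ^ 21 * sqrt (137 / 96 :: real)"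
  proof -
    have "sqrt (137 / 96) ^ (2 * 21) = (137 / 96 :: real) ^ 21" unfolding power_mult by simp
    then show ?thesis using power_Suc[of "sqrt (137 / 96) :: real" 42] by simp
  qed
  have s36: "sqrt 6 * sqrt 3 = 3 * sqrt (2::real)"
    using real_sqrt_mult[of 6 3] real_sqrt_mult[of 9 2] by simp
  have "6 * sqrt (137 / 96) ^ 43 / sqrt 3072 = 6 * ((137 / 96) ^ 21 * sqrt 137) / (128 * (sqrt 6 * sqrt 3))"
    unfolding r43 unfolding r by simp
  also have "\<dots> = 137 powr (43/2) / (2 powr (223/2) * 3 ^ 21)"
    unfolding s36 p by (simp add: power_divide)
  finally show "6 * sqrt (137 / 96) ^ 43 / sqrt 3072 = 137 powr (43/2) / (2 powr (223/2) * 3 ^ 21)" .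
qed

lemma sup_center_density_ge:
  fixes C :: "'a::euclidean_space set"
  assumes "sphere_packing C r" "has_center_density C r \<delta>"
  shows "ereal \<delta> \<le> sup_center_density TYPE('a)"
  unfolding sup_center_density_def has_center_density_imp_center_density[OF assms(2), symmetric]
  using assms(1) by (intro Sup_upper) blast

lemma sup_lattice_center_density_ge:
  fixes C :: "'a::euclidean_space set"
  assumes "lattice_packing C r" "has_center_density C r \<delta>"
  shows "ereal \<delta> \<le> sup_lattice_center_density TYPE('a)"
  unfolding sup_lattice_center_density_def has_center_density_imp_center_density[OF assms(2), symmetric]
  using assms(1) by (intro Sup_upper) blast

lemma sqrt_between: "0 \<le> a \<Longrightarrow> 0 \<le> b \<Longrightarrow> a\<^sup>2 < x \<Longrightarrow> x < b\<^sup>2 \<Longrightarrow> a < sqrt x \<and> sqrt x < b"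
  by (simp add: real_less_rsqrt real_less_lsqrt)

lemma density_bounds:
  "3 powr (31/2) / (2 ^ 19 * 5) \<in> {9.48::real..<9.49}"
  "3 ^ 16 / (2 ^ 20 * 5 powr (1/2)) \<in> {18.35::real..<18.36}"
  "3 ^ 16 / 2 ^ 20 \<in> {41.05::real..<41.06}"
  "3 ^ 17 / 2 ^ 21 \<in> {61.57::real..<61.58}"
  "3 powr (35/2) / 2 ^ 21 \<in> {106.65::real..<106.66}"
  "137 powr (43/2) / (2 powr (223/2) * 3 ^ 21) \<in> {226.51::real..<226.52}"
proof -
  have p: "3 powr (31/2) = 3 ^ 15 * sqrt 3" "3 powr (35/2) = 3 ^ 17 * sqrt 3" "5 powr (1/2) = sqrt (5::real)"
    "137 powr (43/2) = 137 ^ 21 * sqrt 137" "2 powr (223/2) = 2 ^ 111 * sqrt 2"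
    using powr_half[of 3 15] powr_half[of 3 17] powr_half[of 5 0] powr_half[of 137 21] powr_half[of 2 111] by simp_all
  have s3: "1.73205 < sqrt 3 \<and> sqrt 3 < (1.73206::real)" by (rule sqrt_between) (simp_all add: power2_eq_square)
  have s5: "2.23606 < sqrt 5 \<and> sqrt 5 < (2.23607::real)" by (rule sqrt_between) (simp_all add: power2_eq_square)
  \<comment> \<open>Merging the two roots leaves a single irrational factor to enclose.\<close>
  have "sqrt 137 / sqrt 2 = sqrt (68.5::real)" by (simp add: real_sqrt_divide[symmetric])
  moreover have "8.276472 < sqrt 68.5 \<and> sqrt 68.5 < (8.276474::real)" by (rule sqrt_between) (simp_all add: power2_eq_square)
  ultimately have s: "8.276472 < sqrt 137 / sqrt 2" "sqrt 137 / sqrt 2 < (8.276474::real)" by simp_all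
  show "3 powr (31/2) / (2 ^ 19 * 5) \<in> {9.48::real..<9.49}" unfolding p using s3 by (auto simp: field_simps)
  show "3 ^ 16 / (2 ^ 20 * 5 powr (1/2)) \<in> {18.35::real..<18.36}" unfolding p using s5 by (auto simp: field_simps)
  show "3 ^ 16 / 2 ^ 20 \<in> {41.05::real..<41.06}" by simp
  show "3 ^ 17 / 2 ^ 21 \<in> {61.57::real..<61.58}" by simp
  show "3 powr (35/2) / 2 ^ 21 \<in> {106.65::real..<106.66}" unfolding p using s3 by (auto simp: field_simps)
  define q where "q = sqrt 137 / sqrt (2::real)"
  have "137 powr (43/2) / (2 powr (223/2) * 3 ^ 21) = 137 ^ 21 / (2 ^ 111 * 3 ^ 21) * q"
    unfolding p q_def by simp
  moreover have "137 ^ 21 / (2 ^ 111 * 3 ^ 21) * q \<in> {226.51::real..<226.52}"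
    using s unfolding q_def[symmetric] by (auto simp: field_simps)
  ultimately show "137 powr (43/2) / (2 powr (223/2) * 3 ^ 21) \<in> {226.51::real..<226.52}" by simp
qed

lemma section_packing:
  assumes "k + CARD('d::{finite,wellorder}) = 48" "k \<le> 10"
    and "(sqrt 6 / 2) ^ CARD('d) / sqrt (Determinant.det (gram_mat k sec_b)) = \<delta>"
  shows "\<exists>(C :: (real,'d) vec set) r. lattice_packing C r \<and> bare_cross_section_packing P48 C r \<and>
      has_center_density C r \<delta>"
  unfolding assms(3)[symmetric]
proof (rule bare_section_packing[OF assms(1), where t = sec_t])
  show "sec_b i \<in> P48" "sec_t i \<in> P48" if "i < k" for i
    using that assms(2) sec_mem by auto
  show "sec_b i \<bullet> sec_t j = (if i = j then 1 else 0)" if "i < k" "j < k" for i j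
    using that assms(2) by (intro sec_inner(2)) auto
qed

lemma P48_section_packings:
  "\<exists>(C :: (real ^ 38) set) r. lattice_packing C r \<and> bare_cross_section_packing P48 C r \<and>
     has_center_density C r (3 powr (31/2) / (2 ^ 19 * 5))"
  "\<exists>(C :: (real ^ 39) set) r. lattice_packing C r \<and> bare_cross_section_packing P48 C r \<and>
     has_center_density C r (3 ^ 16 / (2 ^ 20 * 5 powr (1/2)))"
  "\<exists>(C :: (real ^ 40) set) r. lattice_packing C r \<and> bare_cross_section_packing P48 C r \<and>
     has_center_density C r (3 ^ 16 / 2 ^ 20)"
  "\<exists>(C :: (real ^ 41) set) r. lattice_packing C r \<and> bare_cross_section_packing P48 C r \<and>
     has_center_density C r (3 ^ 17 / 2 ^ 21)"
  "\<exists>(C :: (real ^ 42) set) r. lattice_packing C r \<and> bare_cross_section_packing P48 C r \<and>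
     has_center_density C r (3 powr (35/2) / 2 ^ 21)"
proof -
  have cards: "CARD(38) = 38" "CARD(39) = 39" "CARD(40) = 40" "CARD(41) = 41" "CARD(42) = 42" by simp_all
  show "\<exists>(C :: (real ^ 38) set) r. lattice_packing C r \<and> bare_cross_section_packing P48 C r \<and>
     has_center_density C r (3 powr (31/2) / (2 ^ 19 * 5))"
    by (rule section_packing[of 10]) (simp, simp, simp only: sec_dets cards density_values)
  show "\<exists>(C :: (real ^ 39) set) r. lattice_packing C r \<and> bare_cross_section_packing P48 C r \<and>
     has_center_density C r (3 ^ 16 / (2 ^ 20 * 5 powr (1/2)))"
    by (rule section_packing[of 9]) (simp, simp, simp only: sec_dets cards density_values)
  show "\<exists>(C :: (real ^ 40) set) r. lattice_packing C r \<and> bare_cross_section_packing P48 C r \<and>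
     has_center_density C r (3 ^ 16 / 2 ^ 20)"
    by (rule section_packing[of 8]) (simp, simp, simp only: sec_dets cards density_values)
  show "\<exists>(C :: (real ^ 41) set) r. lattice_packing C r \<and> bare_cross_section_packing P48 C r \<and>
     has_center_density C r (3 ^ 17 / 2 ^ 21)"
    by (rule section_packing[of 7]) (simp, simp, simp only: sec_dets cards density_values)
  show "\<exists>(C :: (real ^ 42) set) r. lattice_packing C r \<and> bare_cross_section_packing P48 C r \<and>
     has_center_density C r (3 powr (35/2) / 2 ^ 21)"
    by (rule section_packing[of 6]) (simp, simp, simp only: sec_dets cards density_values)
qed

theorem theorem1:
  shows
    "sup_lattice_center_density TYPE(real ^ 38) \<ge> ereal (3 powr (31/2) / (2 ^ 19 * 5)) \<and>
     sup_lattice_center_density TYPE(real ^ 39) \<ge> ereal (3 ^ 16 / (2 ^ 20 * 5 powr (1/2))) \<and>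
     sup_lattice_center_density TYPE(real ^ 40) \<ge> ereal (3 ^ 16 / 2 ^ 20) \<and>
     sup_lattice_center_density TYPE(real ^ 41) \<ge> ereal (3 ^ 17 / 2 ^ 21) \<and>
     sup_lattice_center_density TYPE(real ^ 42) \<ge> ereal (3 powr (35/2) / 2 ^ 21) \<and>
     sup_center_density TYPE(real ^ 43) \<ge> ereal (137 powr (43/2) / (2 powr (223/2) * 3 ^ 21)) \<and>
     3 powr (31/2) / (2 ^ 19 * 5) \<in> {9.48::real..<9.49} \<and>
     3 ^ 16 / (2 ^ 20 * 5 powr (1/2)) \<in> {18.35::real..<18.36} \<and>
     3 ^ 16 / 2 ^ 20 \<in> {41.05::real..<41.06} \<and>
     3 ^ 17 / 2 ^ 21 \<in> {61.57::real..<61.58} \<and>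
     3 powr (35/2) / 2 ^ 21 \<in> {106.65::real..<106.66} \<and>
     137 powr (43/2) / (2 powr (223/2) * 3 ^ 21) \<in> {226.51::real..<226.52} \<and>
     (\<exists>\<Lambda> :: (real ^ 48) set. unimodular_lattice \<Lambda> \<and> lattice_has_minimum \<Lambda> 6 \<and>
        (\<exists>(C :: (real ^ 38) set) r. lattice_packing C r \<and> bare_cross_section_packing \<Lambda> C r \<and>
           has_center_density C r (3 powr (31/2) / (2 ^ 19 * 5))) \<and>
        (\<exists>(C :: (real ^ 39) set) r. lattice_packing C r \<and> bare_cross_section_packing \<Lambda> C r \<and>
           has_center_density C r (3 ^ 16 / (2 ^ 20 * 5 powr (1/2)))) \<and>
        (\<exists>(C :: (real ^ 40) set) r. lattice_packing C r \<and> bare_cross_section_packing \<Lambda> C r \<and>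
           has_center_density C r (3 ^ 16 / 2 ^ 20)) \<and>
        (\<exists>(C :: (real ^ 41) set) r. lattice_packing C r \<and> bare_cross_section_packing \<Lambda> C r \<and>
           has_center_density C r (3 ^ 17 / 2 ^ 21)) \<and>
        (\<exists>(C :: (real ^ 42) set) r. lattice_packing C r \<and> bare_cross_section_packing \<Lambda> C r \<and>
           has_center_density C r (3 powr (35/2) / 2 ^ 21))) \<and>
     (\<exists>(C :: (real ^ 43) set) r. sphere_packing C r \<and> union_of_translates 6 C \<and>
        has_center_density C r (137 powr (43/2) / (2 powr (223/2) * 3 ^ 21)))"
proof (intro conjI exI[of _ P48] P48_unimodular P48_minimum P48_section_packings density_bounds)
  show "ereal (3 powr (31/2) / (2 ^ 19 * 5)) \<le> sup_lattice_center_density TYPE(real ^ 38)"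
    using P48_section_packings(1) sup_lattice_center_density_ge by blast
  show "ereal (3 ^ 16 / (2 ^ 20 * 5 powr (1/2))) \<le> sup_lattice_center_density TYPE(real ^ 39)"
    using P48_section_packings(2) sup_lattice_center_density_ge by blast
  show "ereal (3 ^ 16 / 2 ^ 20) \<le> sup_lattice_center_density TYPE(real ^ 40)"
    using P48_section_packings(3) sup_lattice_center_density_ge by blast
  show "ereal (3 ^ 17 / 2 ^ 21) \<le> sup_lattice_center_density TYPE(real ^ 41)"
    using P48_section_packings(4) sup_lattice_center_density_ge by blast
  show "ereal (3 powr (35/2) / 2 ^ 21) \<le> sup_lattice_center_density TYPE(real ^ 42)"
    using P48_section_packings(5) sup_lattice_center_density_ge by blast
  show *: "\<exists>(C :: (real ^ 43) set) r. sphere_packing C r \<and> union_of_translates 6 C \<and>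
      has_center_density C r (137 powr (43/2) / (2 powr (223/2) * 3 ^ 21))"
    using packing_43 unfolding density_values .
  then show "ereal (137 powr (43/2) / (2 powr (223/2) * 3 ^ 21)) \<le> sup_center_density TYPE(real ^ 43)"
    using sup_center_density_ge by blast
qed

end
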